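(* Let $m_0,m_1$ be positive integers. For each solution $r$ of the $(m_0,m_1)$-BVP, the Brouwer degree of the self-map $\psi_r$ of $\mathbb{S}^{m_0+m_1+1}$ is $\pm 1$ or $\pm 3$.
   Context: For positive integers $m_0,m_1$, the $(m_0,m_1)$-ODE for a function $r:(0,\tfrac{\pi}{2})\to\mathbb{R}$ is $$\ddot r(t)=\left((m_1-m_0)\csc 2t-(m_0+m_1)\cot 2t\right)\dot r(t)-m_1\frac{\sin 2r(t)}{2\cos^2 t}+m_0\frac{\sin 2r(t)}{2\sin^2 t}.$$ A solution of the $(m_0,m_1)$-BVP is a solution $r$ of the $(m_0,m_1)$-ODE with $r(0)=0$ and $r(\tfrac{\pi}{2})=(2\ell+1)\tfrac{\pi}{2}$ for some $\ell\in\mathbb{Z}$, the boundary values being understood as limits as $t\to 0$ and $t\to\tfrac{\pi}{2}$. For such $r$, the map $\psi_r:\mathbb{S}^{m_0+m_1+1}\to\mathbb{S}^{m_0+m_1+1}$ is, with $\mathbb{S}^{m_0+m_1+1}\subset\mathbb{R}^{m_0+1}\times\mathbb{R}^{m_1+1}$, $$\psi_r(x_1\sin t,\,x_2\cos t)=(x_1\sin r(t),\,x_2\cos r(t)),\qquad x_1\in\mathbb{S}^{m_0},\ x_2\in\mathbb{S}^{m_1},\ t\in[0,\tfrac{\pi}{2}].$$ It is equivariant with respect to the action of $\mathrm{SO}(m_0+1)\times\mathrm{SO}(m_1+1)$ by block-diagonal matrices. *)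

theory Defs
  imports "HOL-Homology.Homology"
begin

text \<open>A function on the open interval is represented by a total function whose values
  outside the interval are irrelevant. The coefficient \<open>csc 2t\<close> is written \<open>1 / sin (2 * t)\<close>.\<close>

definition is_ODE_solution :: "nat \<Rightarrow> nat \<Rightarrow> (real \<Rightarrow> real) \<Rightarrow> bool" where
  "is_ODE_solution m0 m1 r \<longleftrightarrow>
     (\<exists>r' r''. \<forall>t\<in>{0<..<pi/2}.
        (r has_real_derivative r' t) (at t) \<and>
        (r' has_real_derivative r'' t) (at t) \<and>
        r'' t = ((real m1 - real m0) * (1 / sin (2 * t)) - (real m0 + real m1) * cot (2 * t)) * r' t
                - real m1 * (sin (2 * r t) / (2 * (cos t)\<^sup>2))
                + real m0 * (sin (2 * r t) / (2 * (sin t)\<^sup>2)))"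

definition is_BVP_solution :: "nat \<Rightarrow> nat \<Rightarrow> (real \<Rightarrow> real) \<Rightarrow> bool" where
  "is_BVP_solution m0 m1 r \<longleftrightarrow>
     is_ODE_solution m0 m1 r \<and>
     (r \<longlongrightarrow> 0) (at_right 0) \<and>
     (\<exists>l::int. (r \<longlongrightarrow> (2 * of_int l + 1) * (pi/2)) (at_left (pi/2)))"

definition boundary_extension :: "(real \<Rightarrow> real) \<Rightarrow> real \<Rightarrow> real" where
  "boundary_extension r t =
     (if t = 0 then Lim (at_right 0) r
      else if t = pi/2 then Lim (at_left (pi/2)) r
      else r t)"

text \<open>As in \<^const>\<open>nsphere\<close>, vectors in \<open>n\<close>-space are sequences vanishing from index \<open>n\<close> on.
  \<open>block_pair m0 y z\<close> is the vector with blocks \<open>y\<close> (coordinates \<open>0, \<dots>, m0\<close>) and \<open>z\<close>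
  (coordinates from \<open>m0 + 1\<close> on).\<close>

definition block_pair :: "nat \<Rightarrow> (nat \<Rightarrow> real) \<Rightarrow> (nat \<Rightarrow> real) \<Rightarrow> nat \<Rightarrow> real" where
  "block_pair m0 y z = (\<lambda>i. if i \<le> m0 then y i else z (i - Suc m0))"

text \<open>The description is well defined on the sphere when \<open>r\<close> solves the boundary value
  problem; see \<open>psi_block_pair\<close> below.\<close>

definition psi :: "nat \<Rightarrow> nat \<Rightarrow> (real \<Rightarrow> real) \<Rightarrow> (nat \<Rightarrow> real) \<Rightarrow> nat \<Rightarrow> real" where
  "psi m0 m1 r p =
     (THE q. \<exists>x1\<in>topspace (nsphere m0). \<exists>x2\<in>topspace (nsphere m1). \<exists>t\<in>{0..pi/2}.
        p = block_pair m0 (\<lambda>i. sin t * x1 i) (\<lambda>i. cos t * x2 i) \<and>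
        q = block_pair m0 (\<lambda>i. sin (boundary_extension r t) * x1 i)
                          (\<lambda>i. cos (boundary_extension r t) * x2 i))"

lemma topspace_nsphere_iff:
  "x \<in> topspace (nsphere m) \<longleftrightarrow> (\<Sum>i\<le>m. (x i)\<^sup>2) = 1 \<and> (\<forall>i>m. x i = 0)"
  by (auto simp: nsphere)

lemma block_pair_eq_iff: "block_pair m0 y z = block_pair m0 y' z' \<longleftrightarrow> (\<forall>i\<le>m0. y i = y' i) \<and> z = z'"
proof
  assume eq: "block_pair m0 y z = block_pair m0 y' z'"
  have "z j = z' j" for j
    using fun_cong[OF eq, of "j + Suc m0"] by (simp add: block_pair_def)
  moreover have "y i = y' i" if "i \<le> m0" for i
    using fun_cong[OF eq, of i] that by (simp add: block_pair_def)
  ultimately show "(\<forall>i\<le>m0. y i = y' i) \<and> z = z'" by auto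
qed (auto simp: block_pair_def)

lemma boundary_extension_0:
  assumes "is_BVP_solution m0 m1 r"
  shows "boundary_extension r 0 = 0"
  using assms by (auto simp: is_BVP_solution_def boundary_extension_def intro!: tendsto_Lim)

lemma boundary_extension_pi_half:
  assumes "is_BVP_solution m0 m1 r"
  obtains l :: int where "boundary_extension r (pi/2) = (2 * of_int l + 1) * (pi/2)"
proof -
  obtain l :: int where l: "(r \<longlongrightarrow> (2 * of_int l + 1) * (pi/2)) (at_left (pi/2))"
    using assms by (auto simp: is_BVP_solution_def)
  have "Lim (at_left (pi/2)) r = (2 * of_int l + 1) * (pi/2)"
    by (rule tendsto_Lim[OF trivial_limit_at_left_real l])
  then show thesis
    using that[of l] by (simp add: boundary_extension_def)
qed

lemma psi_block_pair:
  assumes r: "is_BVP_solution m0 m1 r"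
    and x1: "x1 \<in> topspace (nsphere m0)" and x2: "x2 \<in> topspace (nsphere m1)"
    and t: "t \<in> {0..pi/2}"
  shows "psi m0 m1 r (block_pair m0 (\<lambda>i. sin t * x1 i) (\<lambda>i. cos t * x2 i)) =
    block_pair m0 (\<lambda>i. sin (boundary_extension r t) * x1 i)
                  (\<lambda>i. cos (boundary_extension r t) * x2 i)"
proof -
  have unique: "block_pair m0 (\<lambda>i. sin (boundary_extension r s) * y1 i)
                  (\<lambda>i. cos (boundary_extension r s) * y2 i) =
        block_pair m0 (\<lambda>i. sin (boundary_extension r t) * x1 i)
                  (\<lambda>i. cos (boundary_extension r t) * x2 i)"
    if y1: "y1 \<in> topspace (nsphere m0)" and y2: "y2 \<in> topspace (nsphere m1)"
      and s: "s \<in> {0..pi/2}"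
      and eq: "block_pair m0 (\<lambda>i. sin t * x1 i) (\<lambda>i. cos t * x2 i) =
               block_pair m0 (\<lambda>i. sin s * y1 i) (\<lambda>i. cos s * y2 i)" for y1 y2 s
  proof -
    have e1: "sin t * x1 i = sin s * y1 i" if "i \<le> m0" for i
      using eq that by (auto simp: block_pair_eq_iff)
    have e2: "cos t * x2 i = cos s * y2 i" for i
      using eq by (auto simp: block_pair_eq_iff dest: fun_cong)
    have "(sin t)\<^sup>2 = (\<Sum>i\<le>m0. (sin t * x1 i)\<^sup>2)"
      using x1 by (simp add: topspace_nsphere_iff power_mult_distrib flip: sum_distrib_left)
    also have "\<dots> = (\<Sum>i\<le>m0. (sin s * y1 i)\<^sup>2)"
      using e1 by simp
    also have "\<dots> = (sin s)\<^sup>2"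
      using y1 by (simp add: topspace_nsphere_iff power_mult_distrib flip: sum_distrib_left)
    finally have "sin t = sin s"
      using s t by (auto intro!: power2_eq_imp_eq sin_ge_zero)
    then have st: "s = t"
      using s t by (auto intro: sin_inj_pi)
    have "sin (boundary_extension r t) * y1 i = sin (boundary_extension r t) * x1 i"
      if "i \<le> m0" for i
    proof (cases "t = 0")
      case True
      then show ?thesis by (simp add: boundary_extension_0[OF r])
    next
      case False
      then have "sin t > 0" using t by (intro sin_gt_zero) auto
      then show ?thesis using e1[OF that] st by simp
    qed
    moreover have "cos (boundary_extension r t) * y2 i = cos (boundary_extension r t) * x2 i" for i
    proof (cases "t = pi/2")
      case True
      obtain l :: int where l: "boundary_extension r (pi/2) = (2 * of_int l + 1) * (pi/2)"
        using boundary_extension_pi_half[OF r] .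
      then have "boundary_extension r t = of_int (2 * l + 1) * (pi/2)"
        unfolding True l by simp
      then have "cos (boundary_extension r t) = 0"
        unfolding cos_zero_iff_int by (intro exI[of _ "2 * l + 1"]) auto
      then show ?thesis by simp
    next
      case False
      then have "cos t > 0" using t by (intro cos_gt_zero_pi) auto
      then show ?thesis using e2[of i] st by simp
    qed
    ultimately show ?thesis using st by (auto simp: block_pair_eq_iff)
  qed
  show ?thesis
    unfolding psi_def
  proof (rule the_equality)
    show "\<exists>y1\<in>topspace (nsphere m0). \<exists>y2\<in>topspace (nsphere m1). \<exists>s\<in>{0..pi/2}.
        block_pair m0 (\<lambda>i. sin t * x1 i) (\<lambda>i. cos t * x2 i) =
          block_pair m0 (\<lambda>i. sin s * y1 i) (\<lambda>i. cos s * y2 i) \<and>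
        block_pair m0 (\<lambda>i. sin (boundary_extension r t) * x1 i)
                      (\<lambda>i. cos (boundary_extension r t) * x2 i) =
          block_pair m0 (\<lambda>i. sin (boundary_extension r s) * y1 i)
                        (\<lambda>i. cos (boundary_extension r s) * y2 i)"
      using x1 x2 t by blast
  next
    fix q
    assume "\<exists>y1\<in>topspace (nsphere m0). \<exists>y2\<in>topspace (nsphere m1). \<exists>s\<in>{0..pi/2}.
        block_pair m0 (\<lambda>i. sin t * x1 i) (\<lambda>i. cos t * x2 i) =
          block_pair m0 (\<lambda>i. sin s * y1 i) (\<lambda>i. cos s * y2 i) \<and>
        q = block_pair m0 (\<lambda>i. sin (boundary_extension r s) * y1 i)
                          (\<lambda>i. cos (boundary_extension r s) * y2 i)"
    then show "q = block_pair m0 (\<lambda>i. sin (boundary_extension r t) * x1 i)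
                      (\<lambda>i. cos (boundary_extension r t) * x2 i)"
      using unique by blast
  qed
qed

end

theory Submission
  imports Defs "HOL-Complex_Analysis.Riemann_Mapping"
begin

text \<open>
  The proof has an analytic and a topological half, which meet in the number
  \<open>k = 2 * l + 1\<close> for which \<open>r\<close> tends to \<open>k * pi / 2\<close> at \<open>pi / 2\<close>.

  Analysis: \<open>\<bar>k\<bar> \<le> 3\<close> (\<open>BVP_solution_limit_bound\<close>). In the variable \<open>x = ln (tan t)\<close> the equation
  is that of a pendulum \<open>\<rho>'' = D \<rho>' + a sin \<rho> cos \<rho>\<close> whose coefficients depend on \<open>x\<close> only through
  \<open>w = (sin t)\<^sup>2\<close>. The force \<open>a = m0 * (1 - w) - m1 * w\<close> is positive up to the time \<open>x0\<close> at which
  \<open>w = m0 / (m0 + m1)\<close>, and negative afterwards. Reversing time and replacing \<open>\<rho>\<close> by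
  \<open>k * pi / 2 - \<rho>\<close> exchanges \<open>m0\<close> and \<open>m1\<close> and maps the second phase to the first. It therefore
  suffices that a solution which leaves \<open>0\<close> at time minus infinity satisfies
  \<open>\<bar>\<rho>\<bar> < 5 * pi / 4\<close> at \<open>x0\<close> (\<open>bound_first_half\<close>): then \<open>\<bar>k * pi / 2\<bar> < 5 * pi / 2\<close>,
  and \<open>k\<close> is odd. The bound rests on explicit barriers for the slope. For \<open>m0 \<ge> 2\<close>
  one has \<open>\<bar>\<rho>'\<bar> \<le> g * \<bar>sin \<rho>\<bar>\<close> with a bounded function \<open>g\<close>, so that \<open>\<rho>\<close> cannot even reach
  \<open>pi\<close>. For \<open>m0 = 1\<close> there is no damping at the start, and fast solutions
  do cross \<open>pi\<close>; here an increasing solution satisfies \<open>\<rho>' \<le> sin \<rho> + F * (1 - cos \<rho>)\<close>, where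
  \<open>F\<close> grows from \<open>0\<close> to at most \<open>31 / 50\<close>, and beyond \<open>pi\<close> this leaves too little speed to reach
  \<open>5 * pi / 4\<close>.

  Topology: for these \<open>k\<close> the degree is \<open>\<plusminus>1\<close> or \<open>\<plusminus>3\<close> (\<open>Brouwer_degree2_join_map\<close>). Interpolating
  angles deforms \<open>psi\<close> into the map with \<open>r(t) = k * t\<close>, and a change of sign of \<open>k\<close> only composes with
  a reflection of the first block. For \<open>k = 1\<close> the map is the identity. For \<open>k = 3\<close> it is the
  polynomial map \<open>(y, z) \<mapsto> ((3 - 4 * \<bar>y\<bar>\<^sup>2) * y, (1 - 4 * \<bar>y\<bar>\<^sup>2) * z)\<close>. On any set of coordinates of even
  size on which such a map is multiplication by a function, the factor may be deformed to \<open>1\<close>,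
  by passing through a complex structure on these coordinates (\<open>Brouwer_degree2_rotate_block\<close>). If
  one of the blocks has even size, this turns the map into the identity or into a reflection. If
  both sizes are odd, all but one coordinate of each block can be treated in this way; the result is
  an iterated suspension (\<open>Brouwer_degree2_suspension\<close>) of the tripling map of the circle,
  which has degree 3 (\<open>Brouwer_degree2_circle_power\<close>).
\<close>

section \<open>The degree of the power maps of the circle\<close>

text \<open>The degree of \<open>z \<mapsto> z ^ k\<close> is read off from a homomorphism on singular 1-chains of the circle: to a
1-simplex it assigns its winding around the origin, which is meaningful for open paths as well. It
vanishes on boundaries, is multiplied by \<open>k\<close> when the power map is applied, and takes the value \<open>1\<close> on a loop
that runs once around the circle.

The identification with complex numbers puts coordinate 0 on the imaginary axis, so that
\<open>(sin t, cos t)\<close> becomes \<open>cis t\<close>.\<close>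

definition circle_point :: "(nat \<Rightarrow> real) \<Rightarrow> complex" where
  "circle_point p = Complex (p 1) (p 0)"

definition edge_path :: "real \<Rightarrow> nat \<Rightarrow> real" where
  "edge_path t = (\<lambda>i. if i = 0 then 1 - t else if i = 1 then t else 0)"

definition angle_change :: "((nat \<Rightarrow> real) \<Rightarrow> nat \<Rightarrow> real) \<Rightarrow> complex" where
  "angle_change \<sigma> = winding_number (\<lambda>t. circle_point (\<sigma> (edge_path t))) 0"

definition chain_angle :: "(nat \<Rightarrow> real) chain \<Rightarrow> complex" where
  "chain_angle c = (\<Sum>\<sigma>\<in>Poly_Mapping.keys c. of_int (Poly_Mapping.lookup c \<sigma>) * angle_change \<sigma>)"

lemma chain_angle_superset:
  assumes "finite A" "Poly_Mapping.keys c \<subseteq> A"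
  shows "chain_angle c = (\<Sum>\<sigma>\<in>A. of_int (Poly_Mapping.lookup c \<sigma>) * angle_change \<sigma>)"
  unfolding chain_angle_def
  by (rule sum.mono_neutral_left) (use assms in \<open>auto simp: in_keys_iff\<close>)

lemma chain_angle_diff: "chain_angle (a - b) = chain_angle a - chain_angle b"
proof -
  let ?A = "Poly_Mapping.keys a \<union> Poly_Mapping.keys b"
  have "chain_angle (a - b) = (\<Sum>\<sigma>\<in>?A. of_int (Poly_Mapping.lookup (a - b) \<sigma>) * angle_change \<sigma>)"
    by (rule chain_angle_superset) (use keys_diff[of a b] in auto)
  also have "\<dots> = (\<Sum>\<sigma>\<in>?A. of_int (Poly_Mapping.lookup a \<sigma>) * angle_change \<sigma>)
                 - (\<Sum>\<sigma>\<in>?A. of_int (Poly_Mapping.lookup b \<sigma>) * angle_change \<sigma>)"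
    by (simp add: lookup_minus algebra_simps flip: sum_subtractf)
  also have "\<dots> = chain_angle a - chain_angle b"
    using chain_angle_superset[of ?A a] chain_angle_superset[of ?A b] by simp
  finally show ?thesis .
qed

lemma chain_angle_0 [simp]: "chain_angle 0 = 0"
  by (simp add: chain_angle_def)

lemma chain_angle_of [simp]: "chain_angle (frag_of \<sigma>) = angle_change \<sigma>"
  by (simp add: chain_angle_def)

lemma chain_angle_minus: "chain_angle (- a) = - chain_angle a"
  using chain_angle_diff[of 0 a] by simp

lemma chain_angle_add: "chain_angle (a + b) = chain_angle a + chain_angle b"
  using chain_angle_diff[of a "- b"] by (simp add: chain_angle_minus)

lemma edge_path_in_simplex: "t \<in> {0..1} \<Longrightarrow> edge_path t \<in> standard_simplex 1"
  by (auto simp: edge_path_def standard_simplex_def)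

lemma circle_point_nonzero:
  assumes "p \<in> topspace (nsphere 1)" shows "circle_point p \<noteq> 0"
  using assms by (auto simp: nsphere circle_point_def complex_eq_iff)

lemma singular_simplex_nsphere:
  assumes "singular_simplex n (nsphere m) \<sigma>"
  shows "continuous_on (standard_simplex n) \<sigma>" "\<sigma> ` standard_simplex n \<subseteq> topspace (nsphere m)"
proof -
  have *: "continuous_map (top_of_set (standard_simplex n)) (nsphere m) \<sigma>"
    using assms by (simp add: singular_simplex_def euclidean_product_topology)
  show "\<sigma> ` standard_simplex n \<subseteq> topspace (nsphere m)"
    using continuous_map_image_subset_topspace[OF *] by simp
  have "continuous_map (top_of_set (standard_simplex n)) euclidean \<sigma>"
    using * by (simp add: nsphere continuous_map_in_subtopology euclidean_product_topology)
  then show "continuous_on (standard_simplex n) \<sigma>" by simp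
qed

lemma continuous_on_circle_point: 
  assumes "continuous_on S f"
  shows "continuous_on S (\<lambda>x. circle_point (f x))"
proof -
  have *: "continuous_on S (\<lambda>x. f x i)" for i
    using assms by (rule continuous_on_product_then_coordinatewise)
  show ?thesis
    unfolding circle_point_def Complex_eq by (intro continuous_intros *)
qed

lemma continuous_on_edge_path: "continuous_on S edge_path"
proof (rule continuous_on_coordinatewise_then_product)
  fix i show "continuous_on S (\<lambda>t. edge_path t i)"
    by (cases "i = 0"; cases "i = 1") (auto simp: edge_path_def intro!: continuous_intros)
qed

lemma circle_path:
  assumes "singular_simplex 1 (nsphere 1) \<sigma>"
  shows "path (\<lambda>t. circle_point (\<sigma> (edge_path t)))"
    and "0 \<notin> path_image (\<lambda>t. circle_point (\<sigma> (edge_path t)))"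
proof -
  note \<sigma> = singular_simplex_nsphere[OF assms]
  show "path (\<lambda>t. circle_point (\<sigma> (edge_path t)))"
    unfolding path_def
    by (intro continuous_on_circle_point continuous_on_compose2[OF \<sigma>(1) continuous_on_edge_path])
       (use edge_path_in_simplex in auto)
  have "circle_point (\<sigma> (edge_path t)) \<noteq> 0" if "t \<in> {0..1}" for t
    using \<sigma>(2) edge_path_in_simplex[OF that] by (intro circle_point_nonzero) auto
  then show "0 \<notin> path_image (\<lambda>t. circle_point (\<sigma> (edge_path t)))"
    unfolding path_image_def by force
qed

text \<open>The winding of a path, closed or not, is the increment of any continuous logarithm along it.\<close>

lemma winding_number_eq_log_difference:
  assumes "path q" and "\<And>t. t \<in> {0..1} \<Longrightarrow> \<gamma> t = exp (q t)"
  shows "winding_number \<gamma> 0 = (q 1 - q 0) / (2 * of_real pi * \<i>)"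
proof -
  have "winding_number \<gamma> 0 = winding_number (exp \<circ> q) 0"
    by (rule winding_number_cong) (use assms in auto)
  then show ?thesis
    using winding_number_compose_exp[OF assms(1)] by (simp add: pathfinish_def pathstart_def)
qed

lemma angle_change_power:
  assumes \<sigma>: "singular_simplex 1 (nsphere 1) \<sigma>"
    and f: "\<And>p. p \<in> topspace (nsphere 1) \<Longrightarrow> circle_point (f p) = circle_point p ^ k"
  shows "angle_change (simplex_map 1 f \<sigma>) = of_nat k * angle_change \<sigma>"
proof -
  obtain q where q: "path q"
    "pathfinish q - pathstart q = 2 * of_real pi * \<i> * winding_number (\<lambda>t. circle_point (\<sigma> (edge_path t))) 0"
    "\<And>t. t \<in> {0..1} \<Longrightarrow> circle_point (\<sigma> (edge_path t)) = 0 + exp (q t)"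
    using winding_number_as_continuous_log[OF circle_path[OF \<sigma>]] by metis
  have "circle_point (simplex_map 1 f \<sigma> (edge_path t)) = exp (of_nat k * q t)" if t: "t \<in> {0..1}" for t
  proof -
    have "\<sigma> (edge_path t) \<in> topspace (nsphere 1)"
      using singular_simplex_nsphere(2)[OF \<sigma>] edge_path_in_simplex[OF t] by auto
    then show ?thesis
      using f q(3)[OF t] edge_path_in_simplex[OF t]
      by (simp add: simplex_map_def exp_of_nat_mult)
  qed
  moreover have "path (\<lambda>t. of_nat k * q t)"
    using q(1) unfolding path_def by (intro continuous_intros)
  ultimately have "angle_change (simplex_map 1 f \<sigma>) = (of_nat k * q 1 - of_nat k * q 0) / (2 * of_real pi * \<i>)"
    unfolding angle_change_def by (intro winding_number_eq_log_difference) auto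
  also have "\<dots> = of_nat k * ((q 1 - q 0) / (2 * of_real pi * \<i>))"
    by (simp add: field_simps)
  also have "(q 1 - q 0) / (2 * of_real pi * \<i>) = angle_change \<sigma>"
    using q(2) by (simp add: angle_change_def pathfinish_def pathstart_def)
  finally show ?thesis .
qed

lemma chain_angle_power:
  assumes "singular_chain 1 (nsphere 1) c"
    and f: "\<And>p. p \<in> topspace (nsphere 1) \<Longrightarrow> circle_point (f p) = circle_point p ^ k"
  shows "chain_angle (chain_map 1 f c) = of_nat k * chain_angle c"
  using assms(1) unfolding singular_chain_def
proof (induction c rule: frag_induction)
  case (diff a b)
  then show ?case by (simp add: chain_map_diff chain_angle_diff algebra_simps)
qed (use angle_change_power[OF _ f] in \<open>auto simp: chain_map_of\<close>)

definition plane_triangle :: "(real \<times> real) set" where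
  "plane_triangle = {(u, v). 0 \<le> u \<and> 0 \<le> v \<and> u + v \<le> 1}"

definition triangle_simplex :: "real \<times> real \<Rightarrow> nat \<Rightarrow> real" where
  "triangle_simplex = (\<lambda>(u, v) i. if i = 0 then 1 - u - v else if i = 1 then u else if i = 2 then v else 0)"

text \<open>A triangle is contractible, so a 2-simplex in the circle has a continuous logarithm on all of it. The
winding of each edge is a difference of values of this logarithm at the vertices, and the alternating sum cancels.\<close>

lemma chain_angle_boundary_simplex:
  assumes \<tau>: "singular_simplex 2 (nsphere 1) \<tau>"
  shows "chain_angle (chain_boundary 2 (frag_of \<tau>)) = 0"
proof -
  note tau = singular_simplex_nsphere[OF \<tau>]
  have tri: "triangle_simplex z \<in> standard_simplex 2" if "z \<in> plane_triangle" for z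
    using that by (auto simp: plane_triangle_def triangle_simplex_def standard_simplex_def numeral_2_eq_2)
  have "convex plane_triangle"
  proof -
    have eq: "plane_triangle = {z. (1,0) \<bullet> z \<ge> 0} \<inter> {z. (0,1) \<bullet> z \<ge> 0} \<inter> {z. (1,1) \<bullet> z \<le> 1}"
      by (auto simp: plane_triangle_def inner_prod_def)
    show ?thesis
      unfolding eq by (intro convex_Int convex_halfspace_ge convex_halfspace_le)
  qed
  then have con: "contractible plane_triangle"
    by (rule convex_imp_contractible)
  have cont: "continuous_on plane_triangle (\<lambda>z. circle_point (\<tau> (triangle_simplex z)))"
  proof (intro continuous_on_circle_point continuous_on_compose2[OF tau(1)])
    show "continuous_on plane_triangle triangle_simplex"
    proof (rule continuous_on_coordinatewise_then_product)
      fix i show "continuous_on plane_triangle (\<lambda>z. triangle_simplex z i)"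
        by (cases "i = 0"; cases "i = 1"; cases "i = 2")
           (auto simp: triangle_simplex_def case_prod_unfold intro!: continuous_intros)
    qed
  qed (use tri in auto)
  have nz: "circle_point (\<tau> (triangle_simplex z)) \<noteq> 0" if "z \<in> plane_triangle" for z
    using tau(2) tri[OF that] by (intro circle_point_nonzero) auto
  have "\<exists>g. continuous_on plane_triangle g \<and> (\<forall>z\<in>plane_triangle. circle_point (\<tau> (triangle_simplex z)) = exp (g z))"
    by (rule continuous_logarithm_on_contractible[OF cont con nz]) auto
  then obtain g where g: "continuous_on plane_triangle g"
      "\<And>z. z \<in> plane_triangle \<Longrightarrow> circle_point (\<tau> (triangle_simplex z)) = exp (g z)"
    by auto
  have face: "angle_change (singular_face 2 k \<tau>) = (g (h 1) - g (h 0)) / (2 * of_real pi * \<i>)"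
    if h: "continuous_on {0..1} h" "h \<in> {0..1} \<rightarrow> plane_triangle"
      and hk: "\<And>t. simplical_face k (edge_path t) = triangle_simplex (h t)" for k and h :: "real \<Rightarrow> real \<times> real"
    unfolding angle_change_def
  proof (rule winding_number_eq_log_difference)
    show "path (\<lambda>t. g (h t))"
      unfolding path_def by (rule continuous_on_compose2[OF g(1) h(1)]) (use h in auto)
  next
    fix t :: real assume t: "t \<in> {0..1}"
    show "circle_point (singular_face 2 k \<tau> (edge_path t)) = exp (g (h t))"
      using edge_path_in_simplex[OF t] g(2)[OF funcset_mem[OF h(2) t]]
      by (simp add: singular_face_def hk)
  qed
  \<comment> \<open>The faces run along the edges of the triangle with vertices \<open>(0,0)\<close>, \<open>(1,0)\<close> and \<open>(0,1)\<close>.\<close>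
  have faces: "simplical_face 0 (edge_path t) = triangle_simplex (1 - t, t)"
    "simplical_face 1 (edge_path t) = triangle_simplex (0, t)"
    "simplical_face 2 (edge_path t) = triangle_simplex (t, 0)" for t
  proof -
    have "simplical_face 0 (edge_path t) i = triangle_simplex (1 - t, t) i \<and>
      simplical_face 1 (edge_path t) i = triangle_simplex (0, t) i \<and>
      simplical_face 2 (edge_path t) i = triangle_simplex (t, 0) i" for i
    proof -
      consider "i = 0" | "i = 1" | "i = 2" | "i > 2" by linarith
      then show ?thesis
        by cases (simp_all add: simplical_face_def edge_path_def triangle_simplex_def)
    qed
    then show "simplical_face 0 (edge_path t) = triangle_simplex (1 - t, t)"
      "simplical_face 1 (edge_path t) = triangle_simplex (0, t)"
      "simplical_face 2 (edge_path t) = triangle_simplex (t, 0)"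
      by blast+
  qed
  have "angle_change (singular_face 2 0 \<tau>) = (g (0,1) - g (1,0)) / (2 * of_real pi * \<i>)"
    by (subst face[where h = "\<lambda>t. (1 - t, t)", OF _ _ faces(1)])
       (auto simp: plane_triangle_def intro!: continuous_intros)
  moreover have "angle_change (singular_face 2 1 \<tau>) = (g (0,1) - g (0,0)) / (2 * of_real pi * \<i>)"
    by (subst face[where h = "\<lambda>t. (0, t)", OF _ _ faces(2)])
       (auto simp: plane_triangle_def intro!: continuous_intros)
  moreover have "angle_change (singular_face 2 2 \<tau>) = (g (1,0) - g (0,0)) / (2 * of_real pi * \<i>)"
    by (subst face[where h = "\<lambda>t. (t, 0)", OF _ _ faces(3)])
       (auto simp: plane_triangle_def intro!: continuous_intros)
  moreover have "chain_boundary 2 (frag_of \<tau>)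
      = frag_of (singular_face 2 0 \<tau>) - frag_of (singular_face 2 1 \<tau>) + frag_of (singular_face 2 2 \<tau>)"
    by (simp add: chain_boundary_of frag_cmul_minus_one numeral_2_eq_2)
  ultimately show ?thesis
    by (simp add: chain_angle_add chain_angle_diff flip: diff_divide_distrib add_divide_distrib)
qed

lemma chain_angle_boundary:
  assumes "singular_relboundary 1 (nsphere 1) {} c"
  shows "chain_angle c = 0"
proof -
  obtain d where d: "singular_chain 2 (nsphere 1) d" "chain_boundary 2 d = c"
    using assms by (auto simp: singular_boundary numeral_2_eq_2)
  have "chain_angle (chain_boundary 2 d) = 0"
    using d(1) unfolding singular_chain_def
  proof (induction d rule: frag_induction)
    case (diff a b)
    then show ?case by (simp add: chain_boundary_diff chain_angle_diff)
  qed (use chain_angle_boundary_simplex in auto)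
  then show ?thesis using d by simp
qed

definition standard_loop :: "(nat \<Rightarrow> real) \<Rightarrow> nat \<Rightarrow> real" where
  "standard_loop = restrict (\<lambda>x i. if i = 0 then sin (2 * pi * x 1) else if i = 1 then cos (2 * pi * x 1) else 0)
     (standard_simplex 1)"

lemma singular_relcycle_standard_loop:
  "singular_relcycle 1 (nsphere 1) {} (frag_of standard_loop)"
proof -
  have cont: "continuous_map (subtopology (powertop_real UNIV) (standard_simplex 1)) (nsphere 1) standard_loop"
  proof -
    have "continuous_on (standard_simplex 1) (\<lambda>x::nat\<Rightarrow>real. \<lambda>i. if i = 0 then sin (2 * pi * x 1) else if i = 1 then cos (2 * pi * x 1) else 0)"
    proof (rule continuous_on_coordinatewise_then_product)
      fix i
      have "continuous_on (standard_simplex 1) (\<lambda>x::nat\<Rightarrow>real. x 1)"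
        by (rule continuous_on_product_then_coordinatewise) (rule continuous_on_id)
      then show "continuous_on (standard_simplex 1)
          (\<lambda>x. if i = 0 then sin (2 * pi * x 1) else if i = 1 then cos (2 * pi * x 1) else 0)"
        by (cases "i = 0"; cases "i = 1") (auto intro!: continuous_intros)
    qed
    then have "continuous_on (standard_simplex 1) standard_loop"
      unfolding standard_loop_def by (rule continuous_on_eq) simp
    moreover have "standard_loop x \<in> {x. (\<Sum>i\<le>1. (x i)\<^sup>2) = 1 \<and> (\<forall>i>1. x i = 0)}" if "x \<in> standard_simplex 1" for x
      using that by (auto simp: standard_loop_def)
    ultimately show ?thesis
      unfolding nsphere by (auto simp: continuous_map_in_subtopology euclidean_product_topology)
  qed
  then have sing: "singular_simplex 1 (nsphere 1) standard_loop"
    by (simp add: singular_simplex_def standard_loop_def)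
  have "singular_face 1 0 standard_loop = singular_face 1 1 standard_loop"
  proof
    fix x
    show "singular_face 1 0 standard_loop x = singular_face 1 1 standard_loop x"
    proof (cases "x \<in> standard_simplex 0")
      case True
      then have "x = (\<lambda>j. if j = 0 then 1 else 0)"
        by (simp add: standard_simplex_0)
      moreover have "simplical_face 0 x \<in> standard_simplex 1" "simplical_face 1 x \<in> standard_simplex 1"
        using True by (auto intro: simplical_face_in_standard_simplex)
      ultimately show ?thesis
        using True by (auto simp: singular_face_def standard_loop_def simplical_face_def)
    qed (simp add: singular_face_def)
  qed
  moreover have "{..1::nat} = {0,1}" by auto
  ultimately have "chain_boundary 1 (frag_of standard_loop) = 0"
    by (simp add: chain_boundary_of)
  then show ?thesis
    using sing by (simp add: singular_cycle singular_chain_of)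
qed

lemma chain_angle_standard_loop: "chain_angle (frag_of standard_loop) = 1"
proof -
  have "angle_change standard_loop = ((2 * of_real pi * \<i> * of_real 1) - (2 * of_real pi * \<i> * of_real 0)) / (2 * of_real pi * \<i>)"
    unfolding angle_change_def
  proof (rule winding_number_eq_log_difference)
    show "path (\<lambda>t. 2 * of_real pi * \<i> * complex_of_real t)"
      unfolding path_def by (intro continuous_intros)
  next
    fix t :: real assume t: "t \<in> {0..1}"
    have "circle_point (standard_loop (edge_path t)) = cis (2 * pi * t)"
      using edge_path_in_simplex[OF t]
      by (simp add: standard_loop_def circle_point_def cis.ctr edge_path_def)
    also have "\<dots> = exp (2 * of_real pi * \<i> * complex_of_real t)"
      by (simp add: cis_conv_exp mult_ac)
    finally show "circle_point (standard_loop (edge_path t)) = exp (2 * of_real pi * \<i> * complex_of_real t)" .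
  qed
  then show ?thesis by simp
qed

text \<open>Homology groups are written multiplicatively while chains form an additive group; this
translates powers of a class into multiples of a representing cycle.\<close>

lemma homology_group_int_pow:
  assumes "singular_relcycle p X S c"
  shows "homologous_rel_set p X S c [^]\<^bsub>relative_homology_group (int p) X S\<^esub> (k::int)
       = homologous_rel_set p X S (frag_cmul k c)"
proof -
  let ?C = "relcycle_group p X S"
  let ?N = "singular_relboundary_set p X S"
  have hom: "(\<lambda>a. homologous_rel_set p X S a) \<in> hom ?C (relative_homology_group (int p) X S)"
    using normal.r_coset_hom_Mod[OF normal_subgroup_singular_relboundary_relcycle[of p X S]]
    by (simp add: nontrivial_relative_homology_group right_coset_singular_relboundary)
  interpret group_hom ?C "relative_homology_group (int p) X S" "\<lambda>a. homologous_rel_set p X S a"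
    using hom by (simp add: group_hom_def group_hom_axioms_def)
  have "c [^]\<^bsub>?C\<^esub> k = frag_cmul k c"
  proof -
    have nat: "c [^]\<^bsub>?C\<^esub> n = frag_cmul (int n) c" for n :: nat
    proof (induction n)
      case (Suc n)
      have "frag_cmul (int (Suc n)) c = frag_cmul (int n) c + frag_cmul 1 c"
        unfolding frag_cmul_distrib[symmetric] by (simp add: add.commute)
      then show ?case using Suc by simp
    qed simp
    show ?thesis
    proof (cases "k \<ge> 0")
      case True
      then have "c [^]\<^bsub>?C\<^esub> k = c [^]\<^bsub>?C\<^esub> nat k"
        unfolding int_pow_def2 by simp
      then show ?thesis using nat[of "nat k"] True by (simp only: nat_0_le)
    next
      case False
      then have "c [^]\<^bsub>?C\<^esub> k = inv\<^bsub>?C\<^esub> (c [^]\<^bsub>?C\<^esub> nat (- k))"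
        unfolding int_pow_def2 by simp
      also have "c [^]\<^bsub>?C\<^esub> nat (- k) = frag_cmul (- k) c"
        using nat[of "nat (- k)"] False by (simp only: nat_0_le)
      also have "inv\<^bsub>?C\<^esub> (frag_cmul (- k) c) = frag_cmul k c"
      proof (rule G.inv_equality)
        have "frag_cmul k c + frag_cmul (- k) c = frag_cmul (k + - k) c"
          by (rule frag_cmul_distrib[symmetric])
        then show "frag_cmul k c \<otimes>\<^bsub>?C\<^esub> frag_cmul (- k) c = \<one>\<^bsub>?C\<^esub>"
          by simp
        show "frag_cmul k c \<in> carrier ?C" "frag_cmul (- k) c \<in> carrier ?C"
          using singular_relcycle_cmul[OF assms] by simp_all
      qed
      finally show ?thesis .
    qed
  qed
  then show ?thesis
    using assms hom_int_pow[of c k] by simp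
qed

text \<open>If \<open>c\<close> is the standard loop and \<open>d\<close> the degree of \<open>f\<close>, the cycle \<open>f c - d * c\<close> bounds. Its total winding \<open>k - d\<close>
therefore vanishes.\<close>

lemma Brouwer_degree2_circle_power:
  assumes cont: "continuous_map (nsphere 1) (nsphere 1) f"
    and f: "\<And>p. p \<in> topspace (nsphere 1) \<Longrightarrow> circle_point (f p) = circle_point p ^ k"
  shows "Brouwer_degree2 1 f = int k"
proof -
  let ?c = "frag_of standard_loop" and ?d = "Brouwer_degree2 1 f"
  note cyc = singular_relcycle_standard_loop
  have "homologous_rel_set 1 (nsphere 1) {} ?c \<in> carrier (reduced_homology_group (int 1) (nsphere 1))"
    unfolding un_reduced_homology_group[OF of_nat_neq_0[of 0], simplified] 
    using cyc by (simp add: un_reduced_homology_group carrier_relative_homology_group[of 1, simplified])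
  then have "hom_induced (int 1) (nsphere 1) {} (nsphere 1) {} f (homologous_rel_set 1 (nsphere 1) {} ?c)
      = homologous_rel_set 1 (nsphere 1) {} ?c [^]\<^bsub>reduced_homology_group (int 1) (nsphere 1)\<^esub> ?d"
    by (rule Brouwer_degree2)
  then have "homologous_rel_set 1 (nsphere 1) {} (chain_map 1 f ?c) = homologous_rel_set 1 (nsphere 1) {} (frag_cmul ?d ?c)"
    using hom_induced_chain_map[OF cont, of "{}" "{}" 1 ?c] cyc homology_group_int_pow[OF cyc, of ?d]
    by (simp add: un_reduced_homology_group)
  then have "singular_relboundary 1 (nsphere 1) {} (chain_map 1 f ?c - frag_cmul ?d ?c)"
    by (metis homologous_rel_def homologous_rel_set_eq)
  then have "chain_angle (chain_map 1 f ?c - frag_cmul ?d ?c) = 0"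
    by (rule chain_angle_boundary)
  moreover have "chain_angle (chain_map 1 f ?c) = of_nat k"
    using chain_angle_power[OF _ f, of ?c] cyc by (simp only: singular_cycle chain_angle_standard_loop) simp
  moreover have "chain_angle (frag_cmul ?d ?c) = of_int ?d"
  proof -
    have "Poly_Mapping.keys (frag_cmul ?d ?c) \<subseteq> {standard_loop}"
      by (auto dest: subsetD[OF keys_cmul])
    then show ?thesis
      using chain_angle_superset[of "{standard_loop}" "frag_cmul ?d ?c"] chain_angle_standard_loop
      by simp
  qed
  ultimately have "complex_of_int (int k) = of_int ?d"
    by (simp add: chain_angle_diff)
  then show ?thesis by (simp only: of_int_eq_iff)
qed

section \<open>Suspensions\<close>

text \<open>A map that preserves both closed hemispheres preserves the equator, and has the same degree there. The
top homology of the sphere and that of the equator are both isomorphic to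
the relative homology of the upper hemisphere modulo the equator: the latter by the
boundary map, the former via the homology of the sphere modulo the lower hemisphere and excision. All
these isomorphisms commute with the maps induced by \<open>f\<close>.\<close>

lemma Brouwer_degree2_suspension_aux:
  fixes f :: "(nat \<Rightarrow> real) \<Rightarrow> nat \<Rightarrow> real"
  assumes cont: "continuous_map (nsphere (Suc n)) (nsphere (Suc n)) f"
    and up: "f \<in> {x. 0 \<le> x (Suc n)} \<rightarrow> {x. 0 \<le> x (Suc n)}"
    and down: "f \<in> {x. x (Suc n) \<le> 0} \<rightarrow> {x. x (Suc n) \<le> 0}"
  shows "Brouwer_degree2 (Suc n) f = Brouwer_degree2 n f"
proof -
  let ?S = "nsphere (Suc n)" and ?E = "{x::nat \<Rightarrow> real. x (Suc n) = 0}"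
    and ?L = "{x::nat \<Rightarrow> real. x (Suc n) \<le> 0}"
  let ?U = "subtopology ?S {x. 0 \<le> x (Suc n)}"
  let ?p = "1 + int n"
  let ?H0 = "reduced_homology_group (int n) (nsphere n)"
  let ?H1 = "reduced_homology_group ?p ?S"
  let ?GU = "relative_homology_group ?p ?U ?E"
  let ?GL = "relative_homology_group ?p ?S ?L"
  let ?bd = "hom_boundary ?p ?U ?E"
  let ?i = "hom_induced ?p ?U ?E ?S ?L id"
  let ?j = "hom_induced ?p ?S {} ?S ?L id"
  let ?d = "Brouwer_degree2 n f"
  have fE: "f \<in> ?E \<rightarrow> ?E"
  proof (rule funcsetI)
    fix x :: "nat \<Rightarrow> real" assume "x \<in> ?E"
    then have "f x \<in> {x. 0 \<le> x (Suc n)}" "f x \<in> ?L"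
      using up down by (auto simp: Pi_iff)
    then show "f x \<in> ?E" by auto
  qed
  have contU: "continuous_map ?U ?U f"
  proof (rule continuous_map_into_subtopology)
    show "continuous_map ?U ?S f" by (rule continuous_map_from_subtopology[OF cont])
    show "f \<in> topspace ?U \<rightarrow> {x. 0 \<le> x (Suc n)}" using up by (auto simp: Pi_iff)
  qed
  have equator: "subtopology ?U ?E = nsphere n"
  proof -
    have "{x. 0 \<le> x (Suc n)} \<inter> ?E = ?E" by auto
    then show ?thesis by (simp only: subtopology_subtopology subtopology_nsphere_equator)
  qed
  have iso_bd: "?bd \<in> iso ?GU ?H0"
    by (rule iso_upper_hemisphere_reduced_homology_group)
  have iso_i: "?i \<in> iso ?GU ?GL"
    by (rule iso_relative_homology_group_upper_hemisphere)
  have iso_j: "?j \<in> iso ?H1 ?GL"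
    by (rule iso_reduced_homology_group_lower_hemisphere) simp
  have inj_bd: "inj_on ?bd (carrier ?GU)" and inj_j: "inj_on ?j (carrier ?H1)"
    using iso_bd iso_j by (simp_all add: iso_def bij_betw_def)
  interpret bd: group_hom ?GU ?H0 ?bd
    using iso_bd by (simp add: group_hom_def group_hom_axioms_def iso_def)
  interpret i: group_hom ?GU ?GL ?i
    using iso_i by (simp add: group_hom_def group_hom_axioms_def iso_def)
  interpret j: group_hom ?H1 ?GL ?j
    using iso_j by (simp add: group_hom_def group_hom_axioms_def iso_def)
  let ?fU = "hom_induced ?p ?U ?E ?U ?E f"
  have fU: "?fU e = e [^]\<^bsub>?GU\<^esub> ?d" if e: "e \<in> carrier ?GU" for e
  proof -
    have "?bd (?fU e) = hom_induced (int n) (nsphere n) {} (nsphere n) {} f (?bd e)"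
      using fun_cong[OF naturality_hom_induced[OF contU fE, of ?p], of e]
      unfolding equator o_apply add_diff_cancel_left' .
    also have "\<dots> = ?bd e [^]\<^bsub>?H0\<^esub> ?d"
      by (rule Brouwer_degree2) (rule bd.hom_closed[OF e])
    also have "\<dots> = ?bd (e [^]\<^bsub>?GU\<^esub> ?d)"
      using bd.hom_int_pow[OF e] by simp
    finally show ?thesis
      by (rule inj_onD[OF inj_bd _ hom_induced_carrier bd.G.int_pow_closed[OF e]])
  qed
  have "hom_induced ?p ?S {} ?S {} f c = c [^]\<^bsub>?H1\<^esub> ?d" if c: "c \<in> carrier ?H1" for c
  proof -
    have "?i ` carrier ?GU = carrier ?GL"
      using iso_i by (simp add: iso_def bij_betw_def)
    then have "?j c \<in> ?i ` carrier ?GU"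
      using j.hom_closed[OF c] by (simp only:)
    then obtain e where e: "?j c = ?i e" "e \<in> carrier ?GU"
      by (rule imageE)
    have incl: "continuous_map ?U ?S id" "id \<in> ?E \<rightarrow> ?L"
      and id: "continuous_map ?S ?S id" "id \<in> {} \<rightarrow> ?L" and f0: "f \<in> {} \<rightarrow> {}"
      by auto
    have "?j (hom_induced ?p ?S {} ?S {} f c) = hom_induced ?p ?S ?L ?S ?L f (?j c)"
      unfolding hom_induced_compose'[OF cont f0 id] hom_induced_compose'[OF id cont down]
      by (simp only: id_comp comp_id)
    also have "\<dots> = ?i (?fU e)"
      unfolding e(1) hom_induced_compose'[OF incl cont down] hom_induced_compose'[OF contU fE incl]
      by (simp only: id_comp comp_id)
    also have "\<dots> = ?i e [^]\<^bsub>?GL\<^esub> ?d"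
      unfolding fU[OF e(2)] by (rule i.hom_int_pow[OF e(2)])
    also have "\<dots> = ?j (c [^]\<^bsub>?H1\<^esub> ?d)"
      unfolding e(1)[symmetric] using j.hom_int_pow[OF c] by simp
    finally show ?thesis
      by (rule inj_onD[OF inj_j _ hom_induced_reduced[OF c] j.G.int_pow_closed[OF c]])
  qed
  then show ?thesis
    by (intro Brouwer_degree2_unique[OF cont]) simp
qed

text \<open>It is enough to preserve the hemispheres of the sphere itself, since the values of \<open>f\<close> elsewhere
do not influence its degree.\<close>

lemma Brouwer_degree2_suspension:
  assumes cont: "continuous_map (nsphere (Suc n)) (nsphere (Suc n)) f"
    and up: "\<And>x. x \<in> topspace (nsphere (Suc n)) \<Longrightarrow> 0 \<le> x (Suc n) \<Longrightarrow> 0 \<le> f x (Suc n)"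
    and down: "\<And>x. x \<in> topspace (nsphere (Suc n)) \<Longrightarrow> x (Suc n) \<le> 0 \<Longrightarrow> f x (Suc n) \<le> 0"
  shows "Brouwer_degree2 (Suc n) f = Brouwer_degree2 n f"
proof -
  define g where "g x = (if x \<in> topspace (nsphere (Suc n)) then f x else x)" for x
  have "topspace (nsphere n) \<subseteq> topspace (nsphere (Suc n))"
    by (metis Int_lower1 subtopology_nsphere_equator topspace_subtopology)
  then have "Brouwer_degree2 (Suc n) f = Brouwer_degree2 (Suc n) g" "Brouwer_degree2 n f = Brouwer_degree2 n g"
    by (auto intro!: Brouwer_degree2_eq simp: g_def)
  moreover have "continuous_map (nsphere (Suc n)) (nsphere (Suc n)) g"
    by (rule continuous_map_eq[OF cont]) (simp add: g_def)
  then have "Brouwer_degree2 (Suc n) g = Brouwer_degree2 n g"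
    by (rule Brouwer_degree2_suspension_aux) (use up down in \<open>auto simp: g_def\<close>)
  ultimately show ?thesis by simp
qed

section \<open>Maps that rescale the coordinates\<close>

text \<open>Homotopies are written down as maps into Euclidean space without zeros and projected to
the sphere afterwards.\<close>

definition radial :: "nat \<Rightarrow> (nat \<Rightarrow> real) \<Rightarrow> nat \<Rightarrow> real" where
  "radial n v = (\<lambda>i. if i \<le> n then v i / sqrt (\<Sum>j\<le>n. (v j)\<^sup>2) else 0)"

definition rescale :: "(nat \<Rightarrow> (nat \<Rightarrow> real) \<Rightarrow> real) \<Rightarrow> (nat \<Rightarrow> real) \<Rightarrow> nat \<Rightarrow> real" where
  "rescale c x = (\<lambda>i. c i x * x i)"

lemma sum_squares_pos:
  fixes v :: "nat \<Rightarrow> real"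
  assumes "i \<le> n" "v i \<noteq> 0"
  shows "0 < (\<Sum>j\<le>n. (v j)\<^sup>2)"
  by (rule sum_pos2[of _ i]) (use assms in auto)

lemma radial_in_nsphere:
  assumes "i \<le> n" "v i \<noteq> 0"
  shows "radial n v \<in> topspace (nsphere n)"
proof -
  have "(\<Sum>j\<le>n. (radial n v j)\<^sup>2) = (\<Sum>j\<le>n. (v j)\<^sup>2 / (\<Sum>j\<le>n. (v j)\<^sup>2))"
    using sum_squares_pos[of i n v, OF assms] by (intro sum.cong) (auto simp: radial_def power_divide)
  also have "\<dots> = 1"
    using sum_squares_pos[of i n v, OF assms] by (simp flip: sum_divide_distrib)
  finally show ?thesis
    by (simp add: topspace_nsphere_iff radial_def)
qed

lemma radial_nsphere: "v \<in> topspace (nsphere n) \<Longrightarrow> radial n v = v"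
  by (auto simp: topspace_nsphere_iff radial_def fun_eq_iff)

lemma continuous_map_radial:
  assumes cont: "\<And>i. i \<le> n \<Longrightarrow> continuous_map X euclideanreal (\<lambda>x. G x i)"
    and nz: "\<And>x. x \<in> topspace X \<Longrightarrow> \<exists>i\<le>n. G x i \<noteq> 0"
  shows "continuous_map X (nsphere n) (\<lambda>x. radial n (G x))"
proof -
  have "continuous_map X euclideanreal (\<lambda>x. radial n (G x) i)" for i
  proof (cases "i \<le> n")
    case True
    have "sqrt (\<Sum>j\<le>n. (G x j)\<^sup>2) \<noteq> 0" if "x \<in> topspace X" for x
      using nz[OF that] sum_squares_pos[of _ n "G x"] by fastforce
    then show ?thesis
      using True cont unfolding radial_def
      by (auto intro!: continuous_map_real_divide continuous_map_sqrt continuous_map_sum continuous_map_real_pow)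
  qed (simp add: radial_def)
  moreover have "radial n (G x) \<in> topspace (nsphere n)" if "x \<in> topspace X" for x
    using nz[OF that] radial_in_nsphere by blast
  ultimately show ?thesis
    unfolding nsphere continuous_map_in_subtopology continuous_map_componentwise_UNIV
    by (auto simp: topspace_nsphere_iff)
qed

lemma Brouwer_degree2_radial_homotopy:
  fixes G :: "real \<Rightarrow> (nat \<Rightarrow> real) \<Rightarrow> nat \<Rightarrow> real"
  assumes cont: "\<And>i. i \<le> n \<Longrightarrow>
        continuous_map (prod_topology (top_of_set {0..1}) (nsphere n)) euclideanreal (\<lambda>p. G (fst p) (snd p) i)"
    and nz: "\<And>s x. s \<in> {0..1} \<Longrightarrow> x \<in> topspace (nsphere n) \<Longrightarrow> \<exists>i\<le>n. G s x i \<noteq> 0"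
  shows "Brouwer_degree2 n (\<lambda>x. radial n (G 0 x)) = Brouwer_degree2 n (\<lambda>x. radial n (G 1 x))"
proof (rule Brouwer_degree2_homotopic)
  have "continuous_map (prod_topology (top_of_set {0..1}) (nsphere n)) (nsphere n)
      (\<lambda>p. radial n (G (fst p) (snd p)))"
    by (rule continuous_map_radial[OF cont]) (use nz in auto)
  then show "homotopic_with (\<lambda>x. True) (nsphere n) (nsphere n) (\<lambda>x. radial n (G 0 x)) (\<lambda>x. radial n (G 1 x))"
    by (subst homotopic_with) (auto intro!: exI[of _ "\<lambda>p. radial n (G (fst p) (snd p))"])
qed

lemma Brouwer_degree2_rescale_linear:
  assumes c: "\<And>i. i \<le> n \<Longrightarrow> continuous_map (nsphere n) euclideanreal (c i)"
    and d: "\<And>i. i \<le> n \<Longrightarrow> continuous_map (nsphere n) euclideanreal (d i)"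
    and nz: "\<And>s x. s \<in> {0..1} \<Longrightarrow> x \<in> topspace (nsphere n) \<Longrightarrow>
        \<exists>i\<le>n. ((1 - s) * c i x + s * d i x) * x i \<noteq> 0"
  shows "Brouwer_degree2 n (\<lambda>x. radial n (rescale c x)) = Brouwer_degree2 n (\<lambda>x. radial n (rescale d x))"
proof -
  let ?X = "prod_topology (top_of_set {0..1::real}) (nsphere n)"
  let ?G = "\<lambda>s x i. ((1 - s) * c i x + s * d i x) * x i"
  have s: "continuous_map ?X euclideanreal fst"
    using continuous_map_fst continuous_map_into_fulltopology by blast
  have x: "continuous_map ?X euclideanreal (\<lambda>p. snd p i)" for i
    using continuous_map_compose[OF continuous_map_snd continuous_map_nsphere_projection] by (simp add: o_def)
  have c': "continuous_map ?X euclideanreal (\<lambda>p. c i (snd p))" if "i \<le> n" for i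
    using continuous_map_compose[OF continuous_map_snd c[OF that]] by (simp add: o_def)
  have d': "continuous_map ?X euclideanreal (\<lambda>p. d i (snd p))" if "i \<le> n" for i
    using continuous_map_compose[OF continuous_map_snd d[OF that]] by (simp add: o_def)
  have "Brouwer_degree2 n (\<lambda>x. radial n (?G 0 x)) = Brouwer_degree2 n (\<lambda>x. radial n (?G 1 x))"
  proof (rule Brouwer_degree2_radial_homotopy)
    show "continuous_map ?X euclideanreal (\<lambda>p. ?G (fst p) (snd p) i)" if "i \<le> n" for i
      by (intro continuous_map_real_mult continuous_map_add continuous_map_diff s x c'[OF that] d'[OF that])
         simp
  qed (rule nz)
  then show ?thesis by (simp add: rescale_def)
qed

text \<open>Multiplication by \<open>\<i>\<close> on the coordinates from \<open>a\<close> on, which are paired as real and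
imaginary parts \<open>(a, a + 1)\<close>, \<open>(a + 2, a + 3)\<close> and so on.\<close>

definition quarter_turn :: "nat \<Rightarrow> (nat \<Rightarrow> real) \<Rightarrow> nat \<Rightarrow> real" where
  "quarter_turn a x i = (if even (i - a) then - x (Suc i) else x (i - 1))"

lemma rotation_eq_0D:
  fixes u v \<alpha> \<beta> :: real
  assumes "\<alpha> * u - \<beta> * v = 0" "\<alpha> * v + \<beta> * u = 0" "\<beta> \<noteq> 0"
  shows "u = 0" "v = 0"
proof -
  have "(\<alpha>\<^sup>2 + \<beta>\<^sup>2) * u = \<alpha> * (\<alpha> * u - \<beta> * v) + \<beta> * (\<alpha> * v + \<beta> * u)"
       "(\<alpha>\<^sup>2 + \<beta>\<^sup>2) * v = \<alpha> * (\<alpha> * v + \<beta> * u) - \<beta> * (\<alpha> * u - \<beta> * v)"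
    by (auto simp: power2_eq_square algebra_simps)
  moreover have "\<alpha>\<^sup>2 + \<beta>\<^sup>2 \<noteq> 0"
    using assms(3) by (simp add: add_nonneg_eq_0_iff)
  ultimately show "u = 0" "v = 0"
    using assms(1,2) by auto
qed

text \<open>On each pair of coordinates \<open>\<alpha> + \<beta> \<i>\<close> acts as multiplication by a nonzero complex number, hence
injectively.\<close>

lemma rotated_block_nonzero:
  assumes "even (b - a)" "a \<le> i" "i < b" "x i \<noteq> 0" "\<beta> \<noteq> 0"
  shows "\<exists>j. a \<le> j \<and> j < b \<and> \<alpha> * x j + \<beta> * quarter_turn a x j \<noteq> 0"
proof -
  \<comment> \<open>The first index of the pair that contains \<open>i\<close>.\<close>
  define k where "k = (if even (i - a) then i else i - 1)"
  have k: "a \<le> k" "Suc k < b" "even (k - a)" "i = k \<or> i = Suc k"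
  proof -
    show "a \<le> k"
      using assms(2) by (cases "i = a") (auto simp: k_def)
    have "Suc i \<noteq> b" if "even (i - a)"
      using that assms by (metis Suc_diff_le even_Suc)
    then show "Suc k < b"
      using assms(2,3) by (cases "i = a") (auto simp: k_def)
    show "even (k - a)"
      using assms(2) by (cases "i = a") (auto simp: k_def)
    show "i = k \<or> i = Suc k"
      using assms(2) by (cases "i = a") (auto simp: k_def)
  qed
  have "\<alpha> * x k - \<beta> * x (Suc k) \<noteq> 0 \<or> \<alpha> * x (Suc k) + \<beta> * x k \<noteq> 0"
    using rotation_eq_0D[of \<alpha> "x k" \<beta> "x (Suc k)"] assms(4,5) k(4) by blast
  then show ?thesis
  proof
    assume "\<alpha> * x k - \<beta> * x (Suc k) \<noteq> 0"
    then show ?thesis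
      using k by (intro exI[of _ k]) (simp add: quarter_turn_def)
  next
    assume "\<alpha> * x (Suc k) + \<beta> * x k \<noteq> 0"
    then show ?thesis
      using k by (intro exI[of _ "Suc k"]) (simp add: quarter_turn_def Suc_diff_le)
  qed
qed

text \<open>The straight line from the factor \<open>\<gamma>\<close> to \<open>1\<close> may pass through \<open>0\<close>. On a block of even size it
can be bent around \<open>0\<close> through the complex factor \<open>(1 - s) * \<gamma> + s + s * (1 - s) * \<i>\<close>, which vanishes
at no interior time \<open>s\<close>. Where the block vanishes, some other coordinate of the map is nonzero.\<close>

lemma Brouwer_degree2_rotate_block:
  assumes c: "\<And>i. i \<le> n \<Longrightarrow> continuous_map (nsphere n) euclideanreal (c i)"
    and block: "\<And>i. i \<in> {a..<b} \<Longrightarrow> c i = \<gamma>"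
    and b: "b \<le> Suc n" "even (b - a)"
    and nz: "\<And>x. x \<in> topspace (nsphere n) \<Longrightarrow> \<exists>i\<le>n. c i x * x i \<noteq> 0"
  shows "Brouwer_degree2 n (\<lambda>x. radial n (rescale c x))
       = Brouwer_degree2 n (\<lambda>x. radial n (rescale (\<lambda>i x. if i \<in> {a..<b} then 1 else c i x) x))"
proof -
  let ?X = "prod_topology (top_of_set {0..1::real}) (nsphere n)"
  let ?G = "\<lambda>s x i. if i \<in> {a..<b} then ((1 - s) * \<gamma> x + s) * x i + s * (1 - s) * quarter_turn a x i
      else c i x * x i"
  have s: "continuous_map ?X euclideanreal fst"
    using continuous_map_fst continuous_map_into_fulltopology by blast
  have x: "continuous_map ?X euclideanreal (\<lambda>p. snd p i)" for i
    using continuous_map_compose[OF continuous_map_snd continuous_map_nsphere_projection] by (simp add: o_def)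
  have c': "continuous_map ?X euclideanreal (\<lambda>p. c i (snd p))" if "i \<le> n" for i
    using continuous_map_compose[OF continuous_map_snd c[OF that]] by (simp add: o_def)
  have q: "continuous_map ?X euclideanreal (\<lambda>p. quarter_turn a (snd p) i)" for i
    unfolding quarter_turn_def by (cases "even (i - a)") (simp_all add: x continuous_map_minus)
  have "Brouwer_degree2 n (\<lambda>x. radial n (?G 0 x)) = Brouwer_degree2 n (\<lambda>x. radial n (?G 1 x))"
  proof (rule Brouwer_degree2_radial_homotopy)
    show "continuous_map ?X euclideanreal (\<lambda>p. ?G (fst p) (snd p) i)" if "i \<le> n" for i
    proof (cases "i \<in> {a..<b}")
      case True
      then have "continuous_map ?X euclideanreal (\<lambda>p. \<gamma> (snd p))"
        using c'[OF that] block by simp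
      then have "continuous_map ?X euclideanreal (\<lambda>p. ((1 - fst p) * \<gamma> (snd p) + fst p) * snd p i
          + fst p * (1 - fst p) * quarter_turn a (snd p) i)"
        by (intro continuous_map_real_mult continuous_map_add continuous_map_diff s x q) auto
      then show ?thesis using True by simp
    next
      case False
      have "continuous_map ?X euclideanreal (\<lambda>p. c i (snd p) * snd p i)"
        by (intro continuous_map_real_mult x c' that)
      then show ?thesis using False by (simp only: if_False)
    qed
  next
    fix s :: real and x :: "nat \<Rightarrow> real"
    assume s: "s \<in> {0..1}" and x: "x \<in> topspace (nsphere n)"
    obtain i where i: "i \<le> n" "c i x * x i \<noteq> 0"
      using nz[OF x] by blast
    show "\<exists>i\<le>n. ?G s x i \<noteq> 0"
    proof (cases "\<exists>k\<in>{a..<b}. x k \<noteq> 0")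
      case False
      then have "i \<notin> {a..<b}" using i by auto
      then have "?G s x i = c i x * x i" by (simp only: if_False)
      then show ?thesis using i by metis
    next
      case True
      then obtain k where k: "k \<in> {a..<b}" "x k \<noteq> 0" by blast
      consider "s = 0" | "s = 1" | "s \<noteq> 0" "s \<noteq> 1" by blast
      then show ?thesis
      proof cases
        case 1
        then show ?thesis using i block by (intro exI[of _ i]) auto
      next
        case 2
        then show ?thesis using k b by (intro exI[of _ k]) auto
      next
        case 3
        then obtain j where "a \<le> j" "j < b"
            "((1 - s) * \<gamma> x + s) * x j + s * (1 - s) * quarter_turn a x j \<noteq> 0"
          using rotated_block_nonzero[of b a k x "s * (1 - s)" "(1 - s) * \<gamma> x + s"] k b by auto
        then show ?thesis using b by (intro exI[of _ j]) auto
      qed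
    qed
  qed
  moreover have "?G 0 x = rescale c x" for x
    using block by (auto simp: rescale_def)
  moreover have "?G 1 x = rescale (\<lambda>i x. if i \<in> {a..<b} then 1 else c i x) x" for x
    by (auto simp: rescale_def)
  ultimately show ?thesis by (simp only:)
qed

lemma nsphere_mono: "m \<le> n \<Longrightarrow> topspace (nsphere m) \<subseteq> topspace (nsphere n)"
proof -
  assume "m \<le> n"
  have "(\<Sum>i\<le>n. (x i)\<^sup>2) = (\<Sum>i\<le>m. (x i)\<^sup>2)" if "\<forall>i>m. x i = 0" for x :: "nat \<Rightarrow> real"
    using \<open>m \<le> n\<close> that by (intro sum.mono_neutral_right) auto
  then show ?thesis
    using \<open>m \<le> n\<close> by (auto simp: topspace_nsphere_iff)
qed

lemma continuous_map_nsphere_mono: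
  assumes "continuous_map (nsphere n) X f" "m \<le> n"
  shows "continuous_map (nsphere m) X f"
proof -
  have "nsphere m = subtopology (nsphere n) (topspace (nsphere m))"
    using nsphere_mono[OF assms(2)]
    by (simp add: nsphere subtopology_subtopology Int_absorb1)
  then show ?thesis
    using continuous_map_from_subtopology[OF assms(1)] by metis
qed

lemma Brouwer_degree2_involution:
  assumes "continuous_map (nsphere n) (nsphere n) f"
    and "\<And>x. x \<in> topspace (nsphere n) \<Longrightarrow> f (f x) = x"
  shows "\<bar>Brouwer_degree2 n f\<bar> = 1"
  using assms Brouwer_degree2_homeomorphic_map[of n f]
  by (auto simp: homeomorphic_map_maps homeomorphic_maps_def)

text \<open>A coordinate with factor \<open>1\<close> keeps its sign under the map, so the map preserves the two
hemispheres that this coordinate defines and is a suspension up to homotopy.\<close>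

lemma Brouwer_degree2_rescale_drop:
  assumes c: "\<And>i. i \<le> k + j \<Longrightarrow> continuous_map (nsphere (k + j)) euclideanreal (c i)"
    and nz: "\<And>x. x \<in> topspace (nsphere (k + j)) \<Longrightarrow> \<exists>i\<le>k + j. c i x * x i \<noteq> 0"
    and one: "\<And>i x. k < i \<Longrightarrow> c i x = 1"
  shows "Brouwer_degree2 (k + j) (\<lambda>x. radial (k + j) (rescale c x))
       = Brouwer_degree2 k (\<lambda>x. radial k (rescale c x))"
  using c nz
proof (induction j)
  case (Suc j)
  let ?n = "k + j" and ?f = "\<lambda>n x. radial n (rescale c x)"
  have c': "continuous_map (nsphere ?n) euclideanreal (c i)" if "i \<le> ?n" for i
    using continuous_map_nsphere_mono[OF Suc.prems(1), of i ?n] that by simp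
  have nz': "\<exists>i\<le>?n. c i x * x i \<noteq> 0" if x: "x \<in> topspace (nsphere ?n)" for x
  proof -
    have "x \<in> topspace (nsphere (k + Suc j))"
      using x nsphere_mono[of ?n "k + Suc j"] by auto
    then obtain i where "c i x * x i \<noteq> 0"
      using Suc.prems(2) by blast
    moreover have "i \<le> ?n"
      using calculation x by (force simp: topspace_nsphere_iff not_less[symmetric])
    ultimately show ?thesis by blast
  qed
  have cont: "continuous_map (nsphere (Suc ?n)) (nsphere (Suc ?n)) (?f (Suc ?n))"
  proof (rule continuous_map_radial)
    show "continuous_map (nsphere (Suc ?n)) euclideanreal (\<lambda>x. rescale c x i)" if "i \<le> Suc ?n" for i
      unfolding rescale_def
      by (intro continuous_map_real_mult continuous_map_nsphere_projection) (use Suc.prems(1) that in simp)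
  qed (use Suc.prems(2) in \<open>simp add: rescale_def\<close>)
  have "Brouwer_degree2 (Suc ?n) (?f (Suc ?n)) = Brouwer_degree2 ?n (?f (Suc ?n))"
    by (rule Brouwer_degree2_suspension[OF cont])
       (auto simp: radial_def rescale_def one sum_nonneg zero_le_divide_iff divide_le_0_iff)
  also have "\<dots> = Brouwer_degree2 ?n (?f ?n)"
  proof (rule Brouwer_degree2_eq)
    fix x assume "x \<in> topspace (nsphere ?n)"
    then have "rescale c x (Suc ?n) = 0"
      by (simp add: rescale_def topspace_nsphere_iff)
    then show "?f (Suc ?n) x = ?f ?n x"
      by (auto simp: radial_def fun_eq_iff le_Suc_eq)
  qed
  also have "\<dots> = Brouwer_degree2 k (?f k)"
    by (rule Suc.IH[OF c' nz'])
  finally show ?case by simp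
qed simp

section \<open>The degree of the angle-tripling map of the join\<close>

text \<open>The factors of the map that triples the angle in the plane of the coordinates \<open>0\<close> and \<open>k\<close> and
suspends it in all other directions, from
\<open>sin (3 * t) = (4 * (cos t)\<^sup>2 - 1) * sin t\<close> and \<open>cos (3 * t) = (4 * (cos t)\<^sup>2 - 3) * cos t\<close>.\<close>

definition pair_triple :: "nat \<Rightarrow> nat \<Rightarrow> (nat \<Rightarrow> real) \<Rightarrow> real" where
  "pair_triple k i x = (if i = 0 then 4 * (x k)\<^sup>2 - 1 else if i = k then 4 * (x k)\<^sup>2 - 3 else 1)"

lemma continuous_map_pair_triple: "continuous_map (nsphere n) euclideanreal (pair_triple k i)"
proof -
  have "continuous_map (nsphere n) euclideanreal (\<lambda>x. 4 * (x k)\<^sup>2 - a)" for a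
    by (intro continuous_map_diff continuous_map_real_mult continuous_map_real_pow
        continuous_map_nsphere_projection) auto
  moreover have "pair_triple k i = (\<lambda>x. 4 * (x k)\<^sup>2 - 1) \<or> pair_triple k i = (\<lambda>x. 4 * (x k)\<^sup>2 - 3) \<or> pair_triple k i = (\<lambda>x. 1)"
    by (auto simp: pair_triple_def fun_eq_iff)
  ultimately show ?thesis by auto
qed

lemma tripling_norm:
  fixes u v :: real
  assumes "u\<^sup>2 + v\<^sup>2 = 1"
  shows "((4 * v\<^sup>2 - 1) * u)\<^sup>2 + ((4 * v\<^sup>2 - 3) * v)\<^sup>2 = 1"
proof -
  have u: "u\<^sup>2 = 1 - v\<^sup>2" using assms by simp
  show ?thesis
    unfolding power_mult_distrib u by (simp add: power2_eq_square algebra_simps)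
qed

lemma pair_triple_nonvanishing:
  assumes "1 \<le> k" "k \<le> n" "x \<in> topspace (nsphere n)"
  shows "\<exists>i\<le>n. pair_triple k i x * x i \<noteq> 0"
proof (cases "\<exists>i\<le>n. i \<noteq> 0 \<and> i \<noteq> k \<and> x i \<noteq> 0")
  case True
  then show ?thesis by (auto simp: pair_triple_def)
next
  case False
  have "(\<Sum>i\<le>n. (x i)\<^sup>2) = (\<Sum>i\<in>{0,k}. (x i)\<^sup>2)"
    by (rule sum.mono_neutral_right) (use assms False in auto)
  then have "(x 0)\<^sup>2 + (x k)\<^sup>2 = 1"
    using assms by (simp add: topspace_nsphere_iff)
  from tripling_norm[OF this] have "pair_triple k 0 x * x 0 \<noteq> 0 \<or> pair_triple k k x * x k \<noteq> 0"
    using assms(1) by (auto simp: pair_triple_def)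
  then show ?thesis using assms(2) by auto
qed

text \<open>All coordinates from 2 on are suspension coordinates. What remains is the map
\<open>z \<mapsto> z ^ 3\<close> of the circle.\<close>

lemma Brouwer_degree2_pair_triple_1:
  assumes "1 \<le> n"
  shows "Brouwer_degree2 n (\<lambda>x. radial n (rescale (pair_triple 1) x)) = 3"
proof -
  have "Brouwer_degree2 (1 + (n - 1)) (\<lambda>x. radial (1 + (n - 1)) (rescale (pair_triple 1) x))
      = Brouwer_degree2 1 (\<lambda>x. radial 1 (rescale (pair_triple 1) x))"
    using pair_triple_nonvanishing[of 1] 
    by (intro Brouwer_degree2_rescale_drop continuous_map_pair_triple) (auto simp: pair_triple_def)
  also have "\<dots> = int 3"
  proof (rule Brouwer_degree2_circle_power)
    show "continuous_map (nsphere 1) (nsphere 1) (\<lambda>x. radial 1 (rescale (pair_triple 1) x))"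
    proof (rule continuous_map_radial)
      show "continuous_map (nsphere 1) euclideanreal (\<lambda>x. rescale (pair_triple 1) x i)" for i
        unfolding rescale_def by (intro continuous_map_real_mult continuous_map_pair_triple continuous_map_nsphere_projection)
    qed (use pair_triple_nonvanishing[of 1 1] in \<open>simp add: rescale_def\<close>)
  next
    fix x :: "nat \<Rightarrow> real" assume "x \<in> topspace (nsphere 1)"
    then have x: "(x 0)\<^sup>2 + (x 1)\<^sup>2 = 1"
      by (simp add: topspace_nsphere_iff)
    have x0: "(x 0)\<^sup>2 = 1 - (x 1)\<^sup>2" using x by simp
    have cube: "x 0 ^ 3 = x 0 * (1 - (x 1)\<^sup>2)"
      unfolding x0[symmetric] by (simp add: power2_eq_square power3_eq_cube)
    have "(\<Sum>j\<le>1. (rescale (pair_triple 1) x j)\<^sup>2) = 1"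
      using tripling_norm[OF x] by (simp add: rescale_def pair_triple_def)
    then have "circle_point (radial 1 (rescale (pair_triple 1) x)) = Complex ((4 * (x 1)\<^sup>2 - 3) * x 1) ((4 * (x 1)\<^sup>2 - 1) * x 0)"
      by (simp add: circle_point_def radial_def) (simp add: rescale_def pair_triple_def)
    also have "\<dots> = circle_point x ^ 3"
    proof -
      have "circle_point x ^ 3 = Complex ((x 1)^3 - 3 * x 1 * (x 0)\<^sup>2) (3 * (x 1)\<^sup>2 * x 0 - (x 0)^3)"
        by (simp add: circle_point_def complex_eq_iff power2_eq_square power3_eq_cube algebra_simps)
      then show ?thesis
        unfolding cube x0 by (simp add: power2_eq_square power3_eq_cube algebra_simps)
    qed
    finally show "circle_point (radial 1 (rescale (pair_triple 1) x)) = circle_point x ^ 3" .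
  qed
  finally show ?thesis using assms by simp
qed

text \<open>Exchanging the coordinates \<open>1\<close> and \<open>k\<close> is an involution and conjugates this map to the one with \<open>k = 1\<close>;
the degree of the involution enters squared.\<close>

lemma Brouwer_degree2_pair_triple:
  assumes "1 \<le> k" "k \<le> n"
  shows "Brouwer_degree2 n (\<lambda>x. radial n (rescale (pair_triple k) x)) = 3"
proof -
  define \<tau> where "\<tau> x = x \<circ> Transposition.transpose 1 k" for x :: "nat \<Rightarrow> real"
  have bij: "bij_betw (Transposition.transpose 1 k) {..n} {..n}"
    using assms by (intro bij_betw_byWitness[where f' = "Transposition.transpose 1 k"])
                   (auto simp: Transposition.transpose_def)
  have in_n: "Transposition.transpose 1 k i \<le> n \<longleftrightarrow> i \<le> n" for i
    using assms by (auto simp: Transposition.transpose_def)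
  have sum: "(\<Sum>i\<le>n. (\<tau> x i)\<^sup>2) = (\<Sum>i\<le>n. (x i)\<^sup>2)" for x
    unfolding \<tau>_def o_def using sum.reindex_bij_betw[OF bij, of "\<lambda>i. (x i)\<^sup>2"] .
  have inv: "\<tau> (\<tau> x) = x" for x
    by (simp add: \<tau>_def fun_eq_iff)
  have sphere: "\<tau> x \<in> topspace (nsphere n)" if "x \<in> topspace (nsphere n)" for x
    using that sum[of x] in_n by (simp add: topspace_nsphere_iff) (simp add: \<tau>_def not_le[symmetric])
  have cont: "continuous_map (nsphere n) (nsphere n) \<tau>"
  proof -
    have "continuous_map (nsphere n) (powertop_real UNIV) \<tau>"
      unfolding continuous_map_componentwise_UNIV \<tau>_def o_def
      by (auto intro: continuous_map_nsphere_projection)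
    then show ?thesis
      using sphere by (subst (2) nsphere) (auto simp: continuous_map_in_subtopology topspace_nsphere_iff)
  qed
  let ?f = "\<lambda>x. radial n (rescale (pair_triple 1) x)"
  have contf: "continuous_map (nsphere n) (nsphere n) ?f"
  proof (rule continuous_map_radial)
    show "continuous_map (nsphere n) euclideanreal (\<lambda>x. rescale (pair_triple 1) x i)" for i
      unfolding rescale_def by (intro continuous_map_real_mult continuous_map_pair_triple continuous_map_nsphere_projection)
  qed (use pair_triple_nonvanishing[of 1 n] assms in \<open>simp add: rescale_def\<close>)
  have radial: "\<tau> (radial n v) = radial n (\<tau> v)" for v
    using sum[of v] in_n by (auto simp: radial_def fun_eq_iff \<tau>_def)
  have pair_triple: "\<tau> (rescale (pair_triple 1) (\<tau> x)) = rescale (pair_triple k) x" for x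
    using assms(1) by (auto simp: fun_eq_iff \<tau>_def rescale_def pair_triple_def Transposition.transpose_def)
  have "(\<lambda>x. radial n (rescale (pair_triple k) x)) = \<tau> \<circ> (?f \<circ> \<tau>)"
    by (rule ext) (simp only: o_def radial pair_triple)
  then have "Brouwer_degree2 n (\<lambda>x. radial n (rescale (pair_triple k) x))
      = Brouwer_degree2 n \<tau> * (Brouwer_degree2 n ?f * Brouwer_degree2 n \<tau>)"
    using cont contf by (simp add: Brouwer_degree2_compose continuous_map_compose)
  moreover have "Brouwer_degree2 n \<tau> * Brouwer_degree2 n \<tau> = 1"
    using Brouwer_degree2_involution[OF cont inv] by (metis abs_mult_self_eq mult_1)
  ultimately show ?thesis
    using Brouwer_degree2_pair_triple_1[of n] assms by simp
qed

text \<open>The factors of \<open>(x1 sin t, x2 cos t) \<mapsto> (x1 sin 3t, x2 cos 3t)\<close> on the blocks \<open>{0..m}\<close> and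
\<open>{m<..}\<close>, where the sum of squares is \<open>(sin t)\<^sup>2\<close>.\<close>

definition join_triple :: "nat \<Rightarrow> nat \<Rightarrow> (nat \<Rightarrow> real) \<Rightarrow> real" where
  "join_triple m i x = (if i \<le> m then 3 else 1) - 4 * (\<Sum>j\<le>m. (x j)\<^sup>2)"

lemma continuous_map_join_triple: "continuous_map (nsphere n) euclideanreal (join_triple m i)"
  unfolding join_triple_def
  by (intro continuous_map_diff continuous_map_real_mult continuous_map_sum continuous_map_real_pow
      continuous_map_nsphere_projection) auto

lemma radial_cong: "(\<And>i. i \<le> n \<Longrightarrow> v i = w i) \<Longrightarrow> radial n v = radial n w"
  by (auto simp: radial_def fun_eq_iff intro!: arg_cong[where f = "\<lambda>a. _ / sqrt a"] sum.cong)

lemma sum_split_block: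
  fixes g :: "nat \<Rightarrow> real"
  assumes "m \<le> n"
  shows "(\<Sum>i\<le>n. g i) = (\<Sum>i\<le>m. g i) + (\<Sum>i\<in>{m<..n}. g i)"
proof -
  have "{..n} = {..m} \<union> {m<..n}" using assms by auto
  moreover have "sum g ({..m} \<union> {m<..n}) = sum g {..m} + sum g {m<..n}"
    by (rule sum.union_disjoint) auto
  ultimately show ?thesis by simp
qed

lemma join_triple_nonvanishing:
  assumes x: "x \<in> topspace (nsphere n)" and "m \<le> n"
  shows "\<exists>i\<le>n. join_triple m i x * x i \<noteq> 0"
proof (rule ccontr)
  assume "\<not> ?thesis"
  then have 0: "join_triple m i x = 0 \<or> x i = 0" if "i \<le> n" for i
    using that by auto
  let ?Y = "\<Sum>j\<le>m. (x j)\<^sup>2"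
  have sum: "?Y + (\<Sum>i\<in>{m<..n}. (x i)\<^sup>2) = 1"
    using x sum_split_block[OF assms(2), of "\<lambda>i. (x i)\<^sup>2"] by (simp add: topspace_nsphere_iff)
  show False
  proof (cases "?Y = 3 / 4")
    case True
    then have "x i = 0" if "i \<in> {m<..n}" for i
      using 0[of i] that by (auto simp: join_triple_def)
    then show False using sum True by simp
  next
    case False
    then have "x i = 0" if "i \<le> m" for i
      using 0[of i] that assms(2) by (auto simp: join_triple_def)
    then have Y: "?Y = 0" by simp
    then have "x i = 0" if "i \<in> {m<..n}" for i
      using 0[of i] that by (auto simp: join_triple_def)
    then show False using sum Y by simp
  qed
qed

lemma block_reflection:
  defines "\<rho> m \<equiv> rescale (\<lambda>i x. if i \<le> m then - 1 else 1)"
  shows "continuous_map (nsphere n) (nsphere n) (\<rho> m)"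
    and "\<bar>Brouwer_degree2 n (\<rho> m)\<bar> = 1"
    and "x \<in> topspace (nsphere n) \<Longrightarrow> \<rho> m x \<in> topspace (nsphere n)"
proof -
  have "(\<rho> m x i)\<^sup>2 = (x i)\<^sup>2" for x i
    by (simp add: \<rho>_def rescale_def)
  then have sphere: "\<rho> m x \<in> topspace (nsphere n)" if "x \<in> topspace (nsphere n)" for x
    using that by (simp add: topspace_nsphere_iff) (simp add: \<rho>_def rescale_def)
  then show "x \<in> topspace (nsphere n) \<Longrightarrow> \<rho> m x \<in> topspace (nsphere n)" .
  have "continuous_map (nsphere n) euclideanreal (\<lambda>x. (if i \<le> m then - 1 else 1) * x i)" for i
    by (intro continuous_map_real_mult continuous_map_nsphere_projection) simp
  then have "continuous_map (nsphere n) (powertop_real UNIV) (\<rho> m)"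
    unfolding continuous_map_componentwise_UNIV by (simp add: \<rho>_def rescale_def)
  moreover have "\<rho> m \<in> topspace (nsphere n) \<rightarrow> {x. (\<Sum>i\<le>n. (x i)\<^sup>2) = 1 \<and> (\<forall>i>n. x i = 0)}"
  proof (rule funcsetI)
    fix x assume "x \<in> topspace (nsphere n)"
    from sphere[OF this] show "\<rho> m x \<in> {x. (\<Sum>i\<le>n. (x i)\<^sup>2) = 1 \<and> (\<forall>i>n. x i = 0)}"
      by (simp add: topspace_nsphere_iff)
  qed
  ultimately show cont: "continuous_map (nsphere n) (nsphere n) (\<rho> m)"
    by (subst (2) nsphere) (simp only: continuous_map_in_subtopology)
  show "\<bar>Brouwer_degree2 n (\<rho> m)\<bar> = 1"
    by (rule Brouwer_degree2_involution[OF cont]) (simp add: \<rho>_def rescale_def fun_eq_iff)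
qed

text \<open>The parities of the block sizes \<open>m0 + 1\<close> and \<open>m1 + 1\<close> decide. If the first is even, its factor can be
deformed to \<open>1\<close>, and then the second factor to \<open>1\<close> as well, since it equals \<open>1\<close> wherever the first
block vanishes. If the second is even, its factor can be deformed to \<open>1\<close>, and then the first one
to its value \<open>- 1\<close> at the points where the second block vanishes. If both are odd, one coordinate
per block is left over.\<close>

lemma Brouwer_degree2_triple:
  fixes m0 m1 :: nat
  defines "n \<equiv> m0 + m1 + 1"
  shows "Brouwer_degree2 n (\<lambda>x. radial n (rescale (join_triple m0) x)) \<in> {1, -1, 3}"
proof -
  let ?c = "join_triple m0"
  let ?deg = "\<lambda>c. Brouwer_degree2 n (\<lambda>x. radial n (rescale c x))"
  have m0: "m0 \<le> n" by (simp add: n_def)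
  note cont = continuous_map_join_triple[of n m0]
  have nz: "\<exists>i\<le>n. ?c i x * x i \<noteq> 0" if "x \<in> topspace (nsphere n)" for x
    by (rule join_triple_nonvanishing[OF that m0])
  have rot: "?deg ?c = ?deg (\<lambda>i x. if i \<in> {a..<b} then 1 else ?c i x)"
    if "b \<le> Suc n" "even (b - a)" "b \<le> Suc m0 \<or> Suc m0 \<le> a" for a b
    by (rule Brouwer_degree2_rotate_block[where \<gamma> = "?c a", OF cont _ that(1,2) nz])
       (use that(3) in \<open>auto simp: join_triple_def fun_eq_iff\<close>)
  have contm: "continuous_map (nsphere n) euclideanreal (\<lambda>x. if i \<in> A then 1 else ?c i x)" for i A
    using cont[of i] by (cases "i \<in> A") (auto simp: eta_contract_eq)
  have Y: "(\<Sum>j\<le>m0. (x j)\<^sup>2) + (\<Sum>j\<in>{m0<..n}. (x j)\<^sup>2) = 1" if "x \<in> topspace (nsphere n)" for x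
    using that sum_split_block[OF m0, of "\<lambda>i. (x i)\<^sup>2"] by (simp add: topspace_nsphere_iff)
  consider (odd0) "odd m0" | (odd1) "odd m1" | (even) "even m0" "even m1" by blast
  then show ?thesis
  proof cases
    case odd0
    let ?d = "\<lambda>i x. if i \<in> {0..<Suc m0} then 1 else ?c i x"
    have "?deg ?c = ?deg ?d"
      by (rule rot) (use m0 odd0 in auto)
    also have "\<dots> = ?deg (\<lambda>i x. 1)"
    proof (rule Brouwer_degree2_rescale_linear[OF contm])
      fix s :: real and x :: "nat \<Rightarrow> real"
      assume "s \<in> {0..1}" and x: "x \<in> topspace (nsphere n)"
      show "\<exists>i\<le>n. ((1 - s) * ?d i x + s * 1) * x i \<noteq> 0"
      proof (cases "\<exists>i\<le>m0. x i \<noteq> 0")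
        case True
        then obtain i where "i \<le> m0" "x i \<noteq> 0" by blast
        then show ?thesis using m0 by (intro exI[of _ i]) auto
      next
        case False
        then have "(\<Sum>j\<le>m0. (x j)\<^sup>2) = 0" by simp
        moreover have "\<exists>i\<in>{m0<..n}. x i \<noteq> 0"
        proof (rule ccontr)
          assume "\<not> ?thesis"
          then have "(\<Sum>j\<in>{m0<..n}. (x j)\<^sup>2) = 0" by simp
          then show False using Y[OF x] calculation by simp
        qed
        then obtain i where "i \<in> {m0<..n}" "x i \<noteq> 0" by blast
        ultimately show ?thesis by (intro exI[of _ i]) (auto simp: join_triple_def)
      qed
    qed simp
    also have "\<dots> = Brouwer_degree2 n id"
      by (rule Brouwer_degree2_eq) (simp add: rescale_def radial_nsphere)
    finally show ?thesis by simp
  next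
    case odd1
    let ?d = "\<lambda>i x. if i \<in> {Suc m0..<Suc n} then 1 else ?c i x"
    let ?e = "\<lambda>i (x::nat \<Rightarrow> real). if i \<le> m0 then -1 else (1::real)"
    have "?deg ?c = ?deg ?d"
      by (rule rot) (use odd1 in \<open>auto simp: n_def\<close>)
    also have "\<dots> = ?deg ?e"
    proof (rule Brouwer_degree2_rescale_linear[OF contm])
      fix s :: real and x :: "nat \<Rightarrow> real"
      assume "s \<in> {0..1}" and x: "x \<in> topspace (nsphere n)"
      show "\<exists>i\<le>n. ((1 - s) * ?d i x + s * ?e i x) * x i \<noteq> 0"
      proof (cases "\<exists>i\<in>{m0<..n}. x i \<noteq> 0")
        case True
        then obtain i where "i \<in> {m0<..n}" "x i \<noteq> 0" by blast
        then show ?thesis by (intro exI[of _ i]) auto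
      next
        case False
        then have "(\<Sum>j\<in>{m0<..n}. (x j)\<^sup>2) = 0" by simp
        then have 1: "(\<Sum>j\<le>m0. (x j)\<^sup>2) = 1" using Y[OF x] by simp
        have "\<exists>i\<le>m0. x i \<noteq> 0"
        proof (rule ccontr)
          assume "\<not> ?thesis"
          then have "(\<Sum>j\<le>m0. (x j)\<^sup>2) = 0" by simp
          then show False using 1 by simp
        qed
        then obtain i where "i \<le> m0" "x i \<noteq> 0" by blast
        then show ?thesis using 1 m0 by (intro exI[of _ i]) (auto simp: join_triple_def)
      qed
    qed simp
    also have "\<dots> = Brouwer_degree2 n (rescale ?e)"
    proof (rule Brouwer_degree2_eq)
      fix x assume "x \<in> topspace (nsphere n)"
      then show "radial n (rescale ?e x) = rescale ?e x" by (intro radial_nsphere block_reflection)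
    qed
    finally have eq: "?deg ?c = Brouwer_degree2 n (rescale ?e)" .
    have "\<bar>Brouwer_degree2 n (rescale ?e)\<bar> = 1"
      by (rule block_reflection)
    then show ?thesis unfolding eq by (auto simp: abs_if split: if_splits)
  next
    case even
    define q where "q = Suc m0"
    let ?d = "\<lambda>i x. if i \<in> {1..<Suc m0} then 1 else ?c i x"
    \<comment> \<open>Coordinates \<open>0\<close> and \<open>q\<close> are the ones left over in the two blocks.\<close>
    let ?e = "\<lambda>i x. if i \<in> {Suc q..<Suc n} then 1 else ?d i x"
    let ?e' = "\<lambda>i x. if i = 0 \<or> i = q then ?c i x else 1"
    have nq: "n = q + m1" by (simp add: n_def q_def)
    have "?deg ?c = ?deg ?d"
      by (rule rot) (use even m0 in auto)
    also have "\<dots> = ?deg ?e"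
    proof (rule Brouwer_degree2_rotate_block[where \<gamma> = "?c (Suc q)", OF contm])
      show "?d i = ?c (Suc q)" if "i \<in> {Suc q..<Suc n}" for i
        using that by (auto simp: q_def join_triple_def fun_eq_iff)
      show "even (Suc n - Suc q)" using even by (simp add: n_def q_def)
      show "\<exists>i\<le>n. ?d i x * x i \<noteq> 0" if x: "x \<in> topspace (nsphere n)" for x
        using nz[OF x] by fastforce
    qed simp
    also have "\<dots> = ?deg ?e'"
      by (intro Brouwer_degree2_eq radial_cong) (auto simp: rescale_def q_def)
    also have "\<dots> = Brouwer_degree2 q (\<lambda>x. radial q (rescale ?e' x))"
      unfolding nq
    proof (rule Brouwer_degree2_rescale_drop)
      show "continuous_map (nsphere (q + m1)) euclideanreal (?e' i)" for i
        using cont[of i] by (cases "i = 0 \<or> i = q") (auto simp: nq)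
      show "\<exists>i\<le>q + m1. ?e' i x * x i \<noteq> 0" if x: "x \<in> topspace (nsphere (q + m1))" for x
      proof -
        obtain i where "i \<le> q + m1" "?c i x * x i \<noteq> 0"
          using nz[of x] x by (auto simp: nq)
        then show ?thesis by (intro exI[of _ i]) auto
      qed
    qed (simp add: q_def)
    also have "\<dots> = Brouwer_degree2 q (\<lambda>x. radial q (rescale (pair_triple q) x))"
    proof (rule Brouwer_degree2_eq)
      fix x assume x: "x \<in> topspace (nsphere q)"
      have "(\<Sum>j\<le>m0. (x j)\<^sup>2) = 1 - (x q)\<^sup>2"
        using x by (simp add: topspace_nsphere_iff q_def)
      then have "rescale ?e' x = rescale (pair_triple q) x"
        by (auto simp: rescale_def pair_triple_def join_triple_def q_def fun_eq_iff)
      then show "radial q (rescale ?e' x) = radial q (rescale (pair_triple q) x)" by simp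
    qed
    also have "\<dots> = 3"
      by (rule Brouwer_degree2_pair_triple) (auto simp: q_def)
    finally show ?thesis by simp
  qed
qed

section \<open>Maps of joins that act on the latitude\<close>

definition block_norm2 :: "nat \<Rightarrow> (nat \<Rightarrow> real) \<Rightarrow> real" where
  "block_norm2 m x = (\<Sum>j\<le>m. (x j)\<^sup>2)"

text \<open>In the notation \<open>x = (x1 sin t, x2 cos t)\<close> this is \<open>(x1 sin \<theta>, x2 cos \<theta>)\<close>. Where \<open>x1\<close> or \<open>x2\<close> is
undefined, the convention \<open>a / 0 = 0\<close> gives the value \<open>0\<close>, which is the right one if
\<open>sin \<theta>\<close> respectively \<open>cos \<theta>\<close> vanishes there.\<close>

definition join_map :: "nat \<Rightarrow> ((nat \<Rightarrow> real) \<Rightarrow> real) \<Rightarrow> (nat \<Rightarrow> real) \<Rightarrow> nat \<Rightarrow> real" where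
  "join_map m \<theta> x = (\<lambda>i. if i \<le> m then x i / sqrt (block_norm2 m x) * sin (\<theta> x)
                           else x i / sqrt (1 - block_norm2 m x) * cos (\<theta> x))"

definition latitude :: "nat \<Rightarrow> (nat \<Rightarrow> real) \<Rightarrow> real" where
  "latitude m x = arcsin (sqrt (block_norm2 m x))"

lemma block_norm2_sphere:
  assumes "x \<in> topspace (nsphere n)" "m \<le> n"
  shows "0 \<le> block_norm2 m x" "block_norm2 m x \<le> 1" "(\<Sum>i\<in>{m<..n}. (x i)\<^sup>2) = 1 - block_norm2 m x"
proof -
  have *: "block_norm2 m x + (\<Sum>i\<in>{m<..n}. (x i)\<^sup>2) = 1"
    using assms sum_split_block[OF assms(2), of "\<lambda>i. (x i)\<^sup>2"]
    by (simp add: topspace_nsphere_iff block_norm2_def)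
  then show "(\<Sum>i\<in>{m<..n}. (x i)\<^sup>2) = 1 - block_norm2 m x" by simp
  show "0 \<le> block_norm2 m x" by (simp add: block_norm2_def sum_nonneg)
  have "0 \<le> (\<Sum>i\<in>{m<..n}. (x i)\<^sup>2)" by (simp add: sum_nonneg)
  then show "block_norm2 m x \<le> 1" using * by simp
qed

lemma latitude_sphere:
  assumes "x \<in> topspace (nsphere n)" "m \<le> n"
  shows "latitude m x \<in> {0..pi/2}" "sin (latitude m x) = sqrt (block_norm2 m x)"
    "cos (latitude m x) = sqrt (1 - block_norm2 m x)"
proof -
  let ?Y = "block_norm2 m x"
  have Y: "0 \<le> sqrt ?Y" "sqrt ?Y \<le> 1"
    using block_norm2_sphere[OF assms] by auto
  have Y': "-1 \<le> sqrt ?Y"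
    using Y(1) by linarith
  show "latitude m x \<in> {0..pi/2}"
    using arcsin_bounded[OF Y' Y(2)] arcsin_le_arcsin[of 0 "sqrt ?Y"] Y by (simp add: latitude_def)
  show "sin (latitude m x) = sqrt ?Y"
    using sin_arcsin[OF Y' Y(2)] by (simp only: latitude_def)
  show "cos (latitude m x) = sqrt (1 - ?Y)"
    using cos_arcsin[OF Y' Y(2)] block_norm2_sphere[OF assms] by (simp add: latitude_def)
qed

lemma block_eq_0:
  assumes "x \<in> topspace (nsphere n)" "m \<le> n"
  shows "block_norm2 m x = 0 \<Longrightarrow> i \<le> m \<Longrightarrow> x i = 0"
    and "block_norm2 m x = 1 \<Longrightarrow> m < i \<Longrightarrow> x i = 0"
proof -
  show "block_norm2 m x = 0 \<Longrightarrow> i \<le> m \<Longrightarrow> x i = 0"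
    by (simp add: block_norm2_def sum_nonneg_eq_0_iff)
  assume "block_norm2 m x = 1" "m < i"
  then have "(\<Sum>i\<in>{m<..n}. (x i)\<^sup>2) = 0"
    using block_norm2_sphere(3)[OF assms] by simp
  then have "i \<in> {m<..n} \<Longrightarrow> x i = 0"
    by (simp add: sum_nonneg_eq_0_iff)
  then show "x i = 0"
    using assms(1) \<open>m < i\<close> by (cases "i \<le> n") (auto simp: topspace_nsphere_iff)
qed

lemma join_map_in_sphere:
  assumes x: "x \<in> topspace (nsphere n)" "m \<le> n"
    and 0: "block_norm2 m x = 0 \<Longrightarrow> sin (\<theta> x) = 0"
    and 1: "block_norm2 m x = 1 \<Longrightarrow> cos (\<theta> x) = 0"
  shows "join_map m \<theta> x \<in> topspace (nsphere n)"
proof -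
  let ?Y = "block_norm2 m x"
  note Y = block_norm2_sphere[OF x]
  have "(\<Sum>i\<le>m. (join_map m \<theta> x i)\<^sup>2) = (\<Sum>i\<le>m. (x i)\<^sup>2 * ((sin (\<theta> x))\<^sup>2 / ?Y))"
    using Y by (intro sum.cong) (auto simp: join_map_def power_mult_distrib power_divide)
  also have "\<dots> = ?Y * ((sin (\<theta> x))\<^sup>2 / ?Y)"
    by (simp only: sum_distrib_right[symmetric] block_norm2_def)
  also have "\<dots> = (sin (\<theta> x))\<^sup>2"
    using 0 by (cases "?Y = 0") auto
  finally have s: "(\<Sum>i\<le>m. (join_map m \<theta> x i)\<^sup>2) = (sin (\<theta> x))\<^sup>2" .
  have "(\<Sum>i\<in>{m<..n}. (join_map m \<theta> x i)\<^sup>2) = (\<Sum>i\<in>{m<..n}. (x i)\<^sup>2 * ((cos (\<theta> x))\<^sup>2 / (1 - ?Y)))"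
    using Y by (intro sum.cong) (auto simp: join_map_def power_mult_distrib power_divide)
  also have "\<dots> = (1 - ?Y) * ((cos (\<theta> x))\<^sup>2 / (1 - ?Y))"
    by (simp only: sum_distrib_right[symmetric] Y(3))
  also have "\<dots> = (cos (\<theta> x))\<^sup>2"
    using 1 by (cases "?Y = 1") auto
  finally have "(\<Sum>i\<le>n. (join_map m \<theta> x i)\<^sup>2) = 1"
    using s sum_split_block[OF x(2), of "\<lambda>i. (join_map m \<theta> x i)\<^sup>2"] by simp
  moreover have "join_map m \<theta> x i = 0" if "i > n" for i
    using that x by (simp add: join_map_def topspace_nsphere_iff)
  ultimately show ?thesis by (simp add: topspace_nsphere_iff)
qed

text \<open>The unit vector \<open>x1\<close> has no limit where its block vanishes, but it stays bounded and is multiplied by a factor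
tending to \<open>0\<close>.\<close>

lemma continuous_on_bounded_quotient_mult:
  fixes u v g :: "'a::t2_space \<Rightarrow> real"
  assumes u: "continuous_on A u" and v: "continuous_on A v" and g: "continuous_on A g"
    and bound: "\<And>p. p \<in> A \<Longrightarrow> \<bar>u p\<bar> \<le> v p"
    and zero: "\<And>p. p \<in> A \<Longrightarrow> v p = 0 \<Longrightarrow> g p = 0"
  shows "continuous_on A (\<lambda>p. u p / v p * g p)"
  unfolding continuous_on_eq_continuous_within
proof
  fix p assume p: "p \<in> A"
  have cont: "continuous (at p within A) u" "continuous (at p within A) v" "continuous (at p within A) g"
    using u v g p by (simp_all add: continuous_on_eq_continuous_within)
  show "continuous (at p within A) (\<lambda>p. u p / v p * g p)"
  proof (cases "g p = 0")
    case False
    then show ?thesis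
      using zero[OF p] cont unfolding continuous_within
      by (intro tendsto_mult tendsto_divide) auto
  next
    case True
    have "norm (u x / v x * g x) \<le> \<bar>g x\<bar>" if "x \<in> A" for x
    proof -
      have "\<bar>u x / v x\<bar> \<le> 1"
        using bound[OF that] by (cases "v x = 0") (auto simp: abs_divide divide_le_eq_1)
      then show ?thesis by (simp only: real_norm_def abs_mult mult_left_le_one_le abs_ge_zero)
    qed
    then have "eventually (\<lambda>x. norm (u x / v x * g x) \<le> \<bar>g x\<bar>) (at p within A)"
      by (simp add: eventually_at_filter)
    moreover have "((\<lambda>p. \<bar>g p\<bar>) \<longlongrightarrow> 0) (at p within A)"
      using cont(3) True by (metis abs_zero continuous_within tendsto_rabs)
    ultimately have "((\<lambda>p. u p / v p * g p) \<longlongrightarrow> 0) (at p within A)"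
      by (rule Lim_null_comparison)
    then show ?thesis using True by (simp add: continuous_within)
  qed
qed

lemma nsphere_top_of_set: "nsphere n = top_of_set (topspace (nsphere n))"
  by (simp add: nsphere euclidean_product_topology)

lemma continuous_on_coordinate:
  assumes "continuous_on A f"
  shows "continuous_on A (\<lambda>p. f p (i::nat) :: real)"
  using assms by (rule continuous_on_product_then_coordinatewise)

text \<open>Interpolating the angle linearly keeps its values at both ends of the interval, and these values are what makes the join map
continuous at the two focal spheres.\<close>

lemma homotopic_join_maps:
  assumes m: "m \<le> n"
    and R: "continuous_on {0..pi/2} R0" "continuous_on {0..pi/2} R1"
    and 0: "R0 0 = 0" "R1 0 = 0"
    and 1: "R0 (pi/2) = R1 (pi/2)" "cos (R1 (pi/2)) = 0"
  shows "homotopic_with (\<lambda>x. True) (nsphere n) (nsphere n)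
      (join_map m (\<lambda>x. R0 (latitude m x))) (join_map m (\<lambda>x. R1 (latitude m x)))"
proof -
  let ?S = "topspace (nsphere n)"
  let ?A = "{0..1::real} \<times> ?S"
  define \<theta> where "\<theta> s x = (1 - s) * R0 (latitude m x) + s * R1 (latitude m x)" for s x
  let ?h = "\<lambda>p. join_map m (\<theta> (fst p)) (snd p)"
  have top: "prod_topology (top_of_set {0..1::real}) (nsphere n) = top_of_set ?A"
    by (subst nsphere_top_of_set) simp
  have contx: "continuous_on ?A (\<lambda>p. snd p i)" for i
    by (intro continuous_on_coordinate continuous_on_snd continuous_on_id)
  have contY: "continuous_on ?A (\<lambda>p. block_norm2 m (snd p))"
    unfolding block_norm2_def by (intro continuous_on_sum continuous_on_power contx)
  have contl: "continuous_on ?A (\<lambda>p. latitude m (snd p))"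
    unfolding latitude_def
    by (intro continuous_on_arcsin continuous_on_real_sqrt contY)
       (use block_norm2_sphere[OF _ m] in \<open>auto intro: order_trans[of _ 0]\<close>)
  have cont\<theta>: "continuous_on ?A (\<lambda>p. \<theta> (fst p) (snd p))"
    unfolding \<theta>_def
    by (intro continuous_on_add continuous_on_mult continuous_on_diff continuous_on_const
          continuous_on_fst continuous_on_id continuous_on_compose2[OF R(1) contl] continuous_on_compose2[OF R(2) contl])
       (use latitude_sphere(1)[OF _ m] in auto)
  have lat0: "latitude m x = 0" if "block_norm2 m x = 0" for x
    using that by (simp add: latitude_def)
  have lat1: "latitude m x = pi/2" if "block_norm2 m x = 1" for x
    using that by (simp add: latitude_def)
  have s0: "sin (\<theta> s x) = 0" if "block_norm2 m x = 0" for s x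
    using 0 lat0[OF that] by (simp add: \<theta>_def)
  have c1: "cos (\<theta> s x) = 0" if "block_norm2 m x = 1" for s x
  proof -
    have "\<theta> s x = R1 (pi/2)"
      unfolding \<theta>_def lat1[OF that] 1(1) by (simp add: algebra_simps)
    then show ?thesis using 1(2) by simp
  qed
  have comp: "continuous_on ?A (\<lambda>p. ?h p i)" for i
  proof (cases "i \<le> m")
    case True
    have "continuous_on ?A (\<lambda>p. snd p i / sqrt (block_norm2 m (snd p)) * sin (\<theta> (fst p) (snd p)))"
    proof (rule continuous_on_bounded_quotient_mult)
      show "\<bar>snd p i\<bar> \<le> sqrt (block_norm2 m (snd p))" for p :: "real \<times> (nat \<Rightarrow> real)"
      proof -
        have "(snd p i)\<^sup>2 \<le> block_norm2 m (snd p)"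
          unfolding block_norm2_def using True by (intro member_le_sum) auto
        then show ?thesis by (simp add: real_le_rsqrt)
      qed
    qed (auto intro!: continuous_on_sin continuous_on_real_sqrt cont\<theta> contx contY s0)
    then show ?thesis using True by (simp add: join_map_def)
  next
    case False
    have "continuous_on ?A (\<lambda>p. snd p i / sqrt (1 - block_norm2 m (snd p)) * cos (\<theta> (fst p) (snd p)))"
    proof (rule continuous_on_bounded_quotient_mult)
      show "\<bar>snd p i\<bar> \<le> sqrt (1 - block_norm2 m (snd p))" if "p \<in> ?A" for p
      proof -
        have x: "snd p \<in> ?S" using that by auto
        have "(snd p i)\<^sup>2 \<le> 1 - block_norm2 m (snd p)"
        proof (cases "i \<le> n")
          case True
          have "(snd p i)\<^sup>2 \<le> (\<Sum>i\<in>{m<..n}. (snd p i)\<^sup>2)"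
            by (rule member_le_sum) (use True \<open>\<not> i \<le> m\<close> in auto)
          then show ?thesis using block_norm2_sphere(3)[OF x m] by simp
        next
          case False
          then show ?thesis using block_norm2_sphere(2)[OF x m] x by (simp add: topspace_nsphere_iff)
        qed
        then show ?thesis by (simp add: real_le_rsqrt)
      qed
    qed (auto intro!: continuous_on_cos continuous_on_real_sqrt continuous_on_diff continuous_on_const cont\<theta> contx contY c1)
    then show ?thesis using False by (simp add: join_map_def)
  qed
  have "continuous_map (top_of_set ?A) (nsphere n) ?h"
  proof -
    have "continuous_on ?A ?h"
      by (rule continuous_on_coordinatewise_then_product) (rule comp)
    moreover have "?h p \<in> ?S" if "p \<in> ?A" for p
      by (rule join_map_in_sphere[OF _ m]) (use that s0 c1 in auto)
    ultimately have "continuous_map (top_of_set ?A) (top_of_set ?S) ?h"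
      by auto
    then show ?thesis by (simp only: nsphere_top_of_set[symmetric])
  qed
  then show ?thesis
  proof (subst homotopic_with, simp, intro exI[of _ ?h] conjI ballI)
    have "\<theta> 0 = (\<lambda>x. R0 (latitude m x))" "\<theta> 1 = (\<lambda>x. R1 (latitude m x))"
      by (simp_all add: \<theta>_def fun_eq_iff)
    then show "?h (0, x) = join_map m (\<lambda>x. R0 (latitude m x)) x"
      "?h (1, x) = join_map m (\<lambda>x. R1 (latitude m x)) x" for x by simp_all
  qed (simp_all add: top)
qed


lemma continuous_map_join_map:
  assumes m: "m \<le> n" and R: "continuous_on {0..pi/2} R" and 0: "R 0 = 0" and 1: "cos (R (pi/2)) = 0"
  shows "continuous_map (nsphere n) (nsphere n) (join_map m (\<lambda>x. R (latitude m x)))"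
  using homotopic_with_imp_continuous_maps[OF homotopic_join_maps[OF m R R 0 0 refl 1]] by simp

text \<open>By homotopy only the value at \<open>pi/2\<close> matters, so the angle may be taken to be \<open>t\<close> or \<open>3 * t\<close> up to sign. The
sign is absorbed by a reflection of the first block.\<close>

lemma Brouwer_degree2_join_map:
  fixes m0 m1 :: nat
  defines "n \<equiv> m0 + m1 + 1"
  assumes R: "continuous_on {0..pi/2} R" "R 0 = 0"
    and last: "R (pi/2) \<in> {pi/2, - (pi/2), 3 * (pi/2), - (3 * (pi/2))}"
  shows "Brouwer_degree2 n (join_map m0 (\<lambda>x. R (latitude m0 x))) \<in> {1, -1, 3, -3}"
proof -
  have m0: "m0 \<le> n" by (simp add: n_def)
  have cos3: "cos (3 * (pi/2)) = 0"
    using cos_periodic_pi[of "pi/2"] by (simp add: algebra_simps)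
  have positive: "Brouwer_degree2 n (join_map m0 (\<lambda>x. R (latitude m0 x))) \<in> {1, -1, 3}"
    if R: "continuous_on {0..pi/2} R" "R 0 = 0" and "R (pi/2) = pi/2 \<or> R (pi/2) = 3 * (pi/2)" for R
    using that(3)
  proof
    assume e: "R (pi/2) = pi/2"
    have "Brouwer_degree2 n (join_map m0 (\<lambda>x. R (latitude m0 x)))
        = Brouwer_degree2 n (join_map m0 (\<lambda>x. (\<lambda>t. t) (latitude m0 x)))"
      by (rule Brouwer_degree2_homotopic[OF homotopic_join_maps[OF m0 R(1)]]) (use R e in \<open>auto intro: continuous_intros\<close>)
    also have "\<dots> = Brouwer_degree2 n id"
    proof (rule Brouwer_degree2_eq)
      fix x assume x: "x \<in> topspace (nsphere n)"
      show "join_map m0 (\<lambda>x. latitude m0 x) x = id x"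
        using latitude_sphere[OF x m0] block_eq_0[OF x m0] by (auto simp: join_map_def fun_eq_iff)
    qed
    finally show ?thesis by simp
  next
    assume e: "R (pi/2) = 3 * (pi/2)"
    have "Brouwer_degree2 n (join_map m0 (\<lambda>x. R (latitude m0 x)))
        = Brouwer_degree2 n (join_map m0 (\<lambda>x. (\<lambda>t. 3 * t) (latitude m0 x)))"
      by (rule Brouwer_degree2_homotopic[OF homotopic_join_maps[OF m0 R(1)]]) (use R e cos3 in \<open>auto intro: continuous_intros\<close>)
    also have "\<dots> = Brouwer_degree2 n (\<lambda>x. radial n (rescale (join_triple m0) x))"
    proof (rule Brouwer_degree2_eq)
      fix x assume x: "x \<in> topspace (nsphere n)"
      let ?t = "latitude m0 x" and ?Y = "block_norm2 m0 x"
      note t = latitude_sphere[OF x m0] and Y = block_norm2_sphere[OF x m0]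
      have "sin (3 * ?t) = sin (2 * ?t + ?t)" by simp
      also have "\<dots> = sin ?t * (3 * (cos ?t)\<^sup>2 - (sin ?t)\<^sup>2)"
        unfolding sin_add sin_double cos_double by (simp add: power2_eq_square algebra_simps)
      also have "\<dots> = sin ?t * (3 - 4 * (sin ?t)\<^sup>2)"
        by (simp add: cos_squared_eq)
      finally have "sin (3 * ?t) = sin ?t * (3 - 4 * (sin ?t)\<^sup>2)" .
      moreover have "cos (3 * ?t) = cos ?t * (4 * (cos ?t)\<^sup>2 - 3)"
        unfolding cos_treble_cos by (simp add: power2_eq_square power3_eq_cube algebra_simps)
      ultimately have st: "sin (3 * ?t) = sqrt ?Y * (3 - 4 * ?Y)" "cos (3 * ?t) = sqrt (1 - ?Y) * (1 - 4 * ?Y)"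
        using t Y by simp_all
      have eq: "join_map m0 (\<lambda>x. 3 * latitude m0 x) x = rescale (join_triple m0) x"
        using st block_eq_0[OF x m0]
        by (auto simp: join_map_def rescale_def join_triple_def fun_eq_iff block_norm2_def[symmetric])
      have "join_map m0 (\<lambda>x. 3 * latitude m0 x) x \<in> topspace (nsphere n)"
        by (rule join_map_in_sphere[OF x m0]) (use st in auto)
      then show "join_map m0 (\<lambda>x. 3 * latitude m0 x) x = radial n (rescale (join_triple m0) x)"
        unfolding eq by (simp only: radial_nsphere)
    qed
    also have "\<dots> \<in> {1, -1, 3}"
      unfolding n_def by (rule Brouwer_degree2_triple)
    finally show ?thesis .
  qed
  show ?thesis
  proof (cases "R (pi/2) > 0")
    case True
    then show ?thesis using positive[OF R] last by auto
  next
    case False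
    let ?e = "\<lambda>i (x::nat \<Rightarrow> real). if i \<le> m0 then -1 else (1::real)"
    let ?g = "join_map m0 (\<lambda>x. - R (latitude m0 x))"
    have R': "continuous_on {0..pi/2} (\<lambda>t. - R t)" "- R 0 = 0" "- R (pi/2) = pi/2 \<or> - R (pi/2) = 3 * (pi/2)"
      using R last False pi_gt_zero by (auto intro: continuous_intros simp del: pi_gt_zero)
    have "join_map m0 (\<lambda>x. R (latitude m0 x)) = rescale ?e \<circ> ?g"
      by (auto simp: fun_eq_iff join_map_def rescale_def)
    moreover have "cos (- R (pi/2)) = 0"
      using R'(3) cos3 by (elim disjE) (simp_all only: cos_pi_half)
    then have "continuous_map (nsphere n) (nsphere n) ?g"
      by (intro continuous_map_join_map m0 R') 
    ultimately have "Brouwer_degree2 n (join_map m0 (\<lambda>x. R (latitude m0 x)))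
        = Brouwer_degree2 n (rescale ?e) * Brouwer_degree2 n ?g"
      using block_reflection(1)[where n = n and m = m0] by (simp add: Brouwer_degree2_compose)
    then show ?thesis
      using positive[OF R'] block_reflection(2)[where n = n and m = m0] by (auto simp: abs_if split: if_splits)
  qed
qed

text \<open>A polar representation of \<open>x\<close> is obtained by dividing each block by its norm, or by choosing an arbitrary unit vector if the
block vanishes.\<close>

lemma psi_eq_join_map:
  assumes r: "is_BVP_solution m0 m1 r" and x: "x \<in> topspace (nsphere (m0 + m1 + 1))"
  shows "psi m0 m1 r x = join_map m0 (\<lambda>x. boundary_extension r (latitude m0 x)) x"
proof -
  let ?n = "m0 + m1 + 1" and ?Y = "block_norm2 m0 x" and ?t = "latitude m0 x"
  let ?R = "boundary_extension r (latitude m0 x)"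
  let ?e0 = "\<lambda>i::nat. if i = 0 then 1 else (0::real)"
  have m0: "m0 \<le> ?n" by simp
  note Y = block_norm2_sphere[OF x m0] and t = latitude_sphere[OF x m0] and zero = block_eq_0[OF x m0]
  define x1 where "x1 = (if ?Y = 0 then ?e0 else (\<lambda>i. if i \<le> m0 then x i / sqrt ?Y else 0))"
  define x2 where "x2 = (if ?Y = 1 then ?e0 else (\<lambda>i. x (i + Suc m0) / sqrt (1 - ?Y)))"
  have "x1 \<in> topspace (nsphere m0)"
  proof (cases "?Y = 0")
    case False
    have "(\<Sum>i\<le>m0. (x i / sqrt ?Y)\<^sup>2) = (\<Sum>i\<le>m0. (x i)\<^sup>2) / ?Y"
      using Y by (simp add: power_divide sum_divide_distrib)
    then show ?thesis using False by (simp add: x1_def topspace_nsphere_iff block_norm2_def)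
  qed (simp add: x1_def in_topspace_nsphere)
  moreover have "x2 \<in> topspace (nsphere m1)"
  proof (cases "?Y = 1")
    case False
    have "(\<Sum>i\<le>m1. (x (i + Suc m0))\<^sup>2) = (\<Sum>i\<in>{m0<..?n}. (x i)\<^sup>2)"
      by (rule sum.reindex_bij_witness[of _ "\<lambda>i. i - Suc m0" "\<lambda>i. i + Suc m0"]) auto
    then have "(\<Sum>i\<le>m1. (x (i + Suc m0) / sqrt (1 - ?Y))\<^sup>2) = (1 - ?Y) / (1 - ?Y)"
      using Y by (simp add: power_divide flip: sum_divide_distrib)
    then show ?thesis using False x by (simp add: x2_def topspace_nsphere_iff)
  qed (simp add: x2_def in_topspace_nsphere)
  moreover have "?t \<in> {0..pi/2}" by (rule t)
  ultimately have "psi m0 m1 r (block_pair m0 (\<lambda>i. sin ?t * x1 i) (\<lambda>i. cos ?t * x2 i)) =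
      block_pair m0 (\<lambda>i. sin ?R * x1 i) (\<lambda>i. cos ?R * x2 i)"
    by (rule psi_block_pair[OF r])
  moreover have "block_pair m0 (\<lambda>i. sin ?t * x1 i) (\<lambda>i. cos ?t * x2 i) = x"
    using t zero by (auto simp: block_pair_def x1_def x2_def fun_eq_iff)
  moreover have "sin ?R = 0" if "?Y = 0"
    using boundary_extension_0[OF r] that by (simp add: latitude_def)
  moreover have "cos ?R = 0" if "?Y = 1"
  proof -
    obtain l :: int where l: "boundary_extension r (pi/2) = (2 * of_int l + 1) * (pi/2)"
      using boundary_extension_pi_half[OF r] .
    have "cos (of_int (2 * l + 1) * (pi/2)) = 0"
      unfolding cos_zero_iff_int by (intro exI[of _ "2 * l + 1"]) auto
    then have "cos (boundary_extension r (pi/2)) = 0" unfolding l by simp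
    then show ?thesis using that by (simp add: latitude_def)
  qed
  ultimately show ?thesis
    using zero by (auto simp: join_map_def block_pair_def x1_def x2_def fun_eq_iff)
qed

lemma continuous_on_boundary_extension:
  assumes r: "is_BVP_solution m0 m1 r"
  shows "continuous_on {0..pi/2} (boundary_extension r)"
proof -
  let ?R = "boundary_extension r"
  obtain r' r'' where "\<forall>t\<in>{0<..<pi/2}. (r has_real_derivative r' t) (at t)"
    using r unfolding is_BVP_solution_def is_ODE_solution_def by blast
  then have cont: "isCont r t" if "t \<in> {0<..<pi/2}" for t
    using that DERIV_isCont by blast
  obtain L where L: "(r \<longlongrightarrow> L) (at_left (pi/2))" "?R (pi/2) = L"
    using r tendsto_Lim[OF trivial_limit_at_left_real]
    by (force simp: is_BVP_solution_def boundary_extension_def)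
  have 0: "(r \<longlongrightarrow> ?R 0) (at_right 0)"
    using r boundary_extension_0[OF r] by (simp add: is_BVP_solution_def)
  show ?thesis
  proof (rule continuous_on_IccI)
    show "(?R \<longlongrightarrow> ?R 0) (at_right 0)"
      by (rule Lim_transform_eventually[OF 0])
         (auto simp: eventually_at_right_field boundary_extension_def intro!: exI[of _ "pi/2"])
    show "(?R \<longlongrightarrow> ?R (pi/2)) (at_left (pi/2))"
      unfolding L(2)
      by (rule Lim_transform_eventually[OF L(1)])
         (auto simp: eventually_at_left_field boundary_extension_def intro!: exI[of _ 0])
    show "(?R \<longlongrightarrow> ?R t) (at t)" if "0 < t" "t < pi/2" for t
    proof -
      have "eventually (\<lambda>s. s \<in> {0<..<pi/2}) (nhds t)"
        using that by (intro eventually_nhds_in_open) auto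
      then have "eventually (\<lambda>s. r s = ?R s) (at t)"
        unfolding eventually_at_filter by eventually_elim (auto simp: boundary_extension_def)
      then show ?thesis
        using cont[of t] that by (auto simp: isCont_def boundary_extension_def intro: Lim_transform_eventually)
    qed
  qed simp
qed

theorem Brouwer_degree2_psi:
  assumes r: "is_BVP_solution m0 m1 r"
    and limit: "(r \<longlongrightarrow> (2 * of_int l + 1) * (pi/2)) (at_left (pi/2))" and l: "\<bar>2 * l + 1\<bar> \<le> 3"
  shows "Brouwer_degree2 (m0 + m1 + 1) (psi m0 m1 r) \<in> {1, -1, 3, -3}"
proof -
  have "boundary_extension r (pi/2) = (2 * of_int l + 1) * (pi/2)"
    using tendsto_Lim[OF trivial_limit_at_left_real limit] by (simp add: boundary_extension_def)
  moreover have "l = 0 \<or> l = -1 \<or> l = 1 \<or> l = -2"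
    using l by linarith
  ultimately have "boundary_extension r (pi/2) \<in> {pi/2, - (pi/2), 3 * (pi/2), - (3 * (pi/2))}"
    by auto
  then have "Brouwer_degree2 (m0 + m1 + 1) (join_map m0 (\<lambda>x. boundary_extension r (latitude m0 x))) \<in> {1, -1, 3, -3}"
    by (intro Brouwer_degree2_join_map continuous_on_boundary_extension[OF r] boundary_extension_0[OF r])
  then show ?thesis
    using Brouwer_degree2_eq[of "m0 + m1 + 1" "psi m0 m1 r", OF psi_eq_join_map[OF r]] by simp
qed

section \<open>Comparison principles for differential inequalities\<close>

text \<open>A differential inequality that is only known where \<open>f\<close> is positive suffices: after the last zero of \<open>f\<close>, the function
\<open>f x * exp (- C * x)\<close> would be nonincreasing.\<close>

lemma nonpos_persists:
  fixes f f' :: "real \<Rightarrow> real"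
  assumes "a \<le> b" and fa: "f a \<le> 0"
    and deriv: "\<And>x. a \<le> x \<Longrightarrow> x \<le> b \<Longrightarrow> (f has_real_derivative f' x) (at x)"
    and growth: "\<And>x. a \<le> x \<Longrightarrow> x \<le> b \<Longrightarrow> 0 < f x \<Longrightarrow> f' x \<le> C * f x"
  shows "f b \<le> 0"
proof (rule ccontr)
  assume "\<not> f b \<le> 0"
  then have fb: "0 < f b" by simp
  have cont: "continuous_on {a..b} f"
    using deriv by (intro DERIV_continuous_on) (auto intro: has_field_derivative_at_within)
  define S where "S = {x \<in> {a..b}. f x \<le> 0}"
  have "closed S"
    unfolding S_def by (intro continuous_on_closed_Collect_le cont continuous_on_const) simp
  moreover have S: "a \<in> S" "bdd_above S"
    using fa assms(1) by (auto simp: S_def intro: bdd_aboveI[of _ b])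
  ultimately have c: "Sup S \<in> S"
    by (intro closed_contains_Sup) auto
  define c where "c = Sup S"
  have c': "a \<le> c" "c \<le> b" "f c \<le> 0"
    using c by (auto simp: S_def c_def)
  then have cb: "c < b" using fb by (cases "c = b") auto
  have pos: "0 < f x" if "c < x" "x \<le> b" for x
  proof (rule ccontr)
    assume "\<not> 0 < f x"
    then have "x \<in> S" using that c' by (auto simp: S_def)
    then have "x \<le> c" unfolding c_def by (rule cSup_upper) (rule S)
    then show False using that by simp
  qed
  let ?g = "\<lambda>x. f x * exp (- C * x)"
  have "?g b \<le> ?g c"
  proof (rule DERIV_nonpos_imp_decreasing_open[OF less_imp_le[OF cb]])
    fix x assume x: "c < x" "x < b"
    have "(?g has_real_derivative (f' x - C * f x) * exp (- C * x)) (at x)"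
      using deriv[of x] x c' by (auto intro!: derivative_eq_intros simp: algebra_simps)
    moreover have "(f' x - C * f x) * exp (- C * x) \<le> 0"
      using growth[of x] pos[of x] x c' by (intro mult_nonpos_nonneg) auto
    ultimately show "\<exists>y. (?g has_real_derivative y) (at x) \<and> y \<le> 0" by blast
  next
    show "continuous_on {c..b} ?g"
      using c' by (intro continuous_intros continuous_on_subset[OF cont]) auto
  qed
  moreover have "?g c \<le> 0" using c' by (intro mult_nonpos_nonneg) auto
  moreover have "0 < ?g b" using fb by simp
  ultimately show False by linarith
qed

text \<open>A function that decreases as long as it is positive was at least as large at all earlier times. This
is how an inequality is transported to minus infinity, where it contradicts the asymptotics.\<close>

lemma positive_bounded_below_backwards:
  fixes f f' :: "real \<Rightarrow> real"
  assumes deriv: "\<And>x. x \<le> b \<Longrightarrow> (f has_real_derivative f' x) (at x)"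
    and decr: "\<And>x. x \<le> b \<Longrightarrow> 0 < f x \<Longrightarrow> f' x \<le> 0"
    and pos: "0 < f b" and "x \<le> b"
  shows "f b \<le> f x"
proof (rule ccontr)
  assume "\<not> f b \<le> f x"
  \<comment> \<open>A positive level between \<open>f x\<close> and \<open>f b\<close>, to which the forward principle is applied.\<close>
  define k where "k = max (f x) (f b / 2)"
  have k: "f x \<le> k" "0 < k" "k < f b"
    using \<open>\<not> f b \<le> f x\<close> pos by (auto simp: k_def)
  have "f b - k \<le> 0"
  proof (rule nonpos_persists[where f = "\<lambda>x. f x - k" and f' = f' and C = 0 and a = x])
    fix y assume "x \<le> y" "y \<le> b"
    then show "((\<lambda>x. f x - k) has_real_derivative f' y) (at y)"
      using deriv[of y] by (auto intro!: derivative_eq_intros)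
    show "f' y \<le> 0 * (f y - k)" if "0 < f y - k"
      using decr[of y] \<open>y \<le> b\<close> that k by simp
  qed (use assms k in auto)
  then show False using k by simp
qed

lemma derivative_not_bounded_below_at_bot:
  fixes \<rho> p :: "real \<Rightarrow> real"
  assumes deriv: "\<And>x. x \<le> b \<Longrightarrow> (\<rho> has_real_derivative p x) (at x)"
    and lim: "(\<rho> \<longlongrightarrow> l) at_bot" and "0 < \<epsilon>"
  shows "\<exists>x\<le>b. p x < \<epsilon>"
proof (rule ccontr)
  assume "\<not> ?thesis"
  then have ge: "\<epsilon> \<le> p x" if "x \<le> b" for x using that by force
  have "eventually (\<lambda>x. dist (\<rho> x) l < 1) at_bot"
    using lim by (rule tendstoD) simp
  then obtain c where c: "\<And>x. x \<le> c \<Longrightarrow> dist (\<rho> x) l < 1"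
    by (auto simp: eventually_at_bot_linorder)
  define y where "y = min b c"
  let ?z = "y - 2 / \<epsilon>"
  have zy: "?z \<le> y" using assms(3) by simp
  have "\<rho> ?z - \<epsilon> * ?z \<le> \<rho> y - \<epsilon> * y"
  proof (rule DERIV_nonneg_imp_nondecreasing[OF zy])
    fix x assume "?z \<le> x" "x \<le> y"
    then have "x \<le> b" by (simp add: y_def)
    then show "\<exists>d. ((\<lambda>x. \<rho> x - \<epsilon> * x) has_real_derivative d) (at x) \<and> 0 \<le> d"
      using deriv[of x] ge[of x] by (intro exI[of _ "p x - \<epsilon>"]) (auto intro!: derivative_eq_intros)
  qed
  moreover have "\<epsilon> * y - \<epsilon> * ?z = 2"
    using assms(3) by (simp add: algebra_simps)
  ultimately have "2 \<le> \<rho> y - \<rho> ?z" by linarith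
  moreover have "dist (\<rho> y) l < 1" "dist (\<rho> ?z) l < 1"
    using c[of y] c[of ?z] zy by (auto simp: y_def)
  ultimately show False by (simp add: dist_real_def)
qed

lemma derivative_square_not_bounded_below_at_bot:
  fixes \<rho> p :: "real \<Rightarrow> real"
  assumes deriv: "\<And>x. x \<le> b \<Longrightarrow> (\<rho> has_real_derivative p x) (at x)"
    and cont: "continuous_on {..b} p"
    and lim: "(\<rho> \<longlongrightarrow> l) at_bot" and "0 < \<epsilon>"
  shows "\<exists>x\<le>b. (p x)\<^sup>2 < \<epsilon>"
proof (rule ccontr)
  assume "\<not> ?thesis"
  then have ge: "\<epsilon> \<le> (p x)\<^sup>2" if "x \<le> b" for x using that by force
  then have nz: "p x \<noteq> 0" if "x \<le> b" for x using that assms(4) by fastforce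
  have sqrt: "sqrt \<epsilon> \<le> \<bar>p x\<bar>" if "x \<le> b" for x
    using ge[OF that] real_sqrt_le_mono by fastforce
  have same: "0 < p x * p b" if "x \<le> b" for x
  proof (rule ccontr)
    assume "\<not> 0 < p x * p b"
    then have neg: "p x * p b \<le> 0" "0 \<le> p b * p b" by auto
    have "continuous_on {x..b} (\<lambda>y. p y * p b)"
      by (intro continuous_intros continuous_on_subset[OF cont]) auto
    with IVT'[of "\<lambda>y. p y * p b" x 0 b, OF neg that] obtain y where "y \<le> b" "p y * p b = 0" by auto
    then show False using nz by auto
  qed
  show False
  proof (cases "0 < p b")
    case True
    then have "sqrt \<epsilon> \<le> p x" if "x \<le> b" for x
      using same[OF that] sqrt[OF that] by (simp add: zero_less_mult_iff)
    then show False
      using derivative_not_bounded_below_at_bot[OF deriv lim, of b "sqrt \<epsilon>"] assms(4) by force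
  next
    case False
    then have "sqrt \<epsilon> \<le> - p x" if "x \<le> b" for x
      using same[OF that] sqrt[OF that] nz[of b] by (auto simp: zero_less_mult_iff)
    moreover have "((\<lambda>x. - \<rho> x) has_real_derivative - p x) (at x)" if "x \<le> b" for x
      using deriv[OF that] by (rule DERIV_minus)
    ultimately show False
      using derivative_not_bounded_below_at_bot[of b "\<lambda>x. - \<rho> x" "\<lambda>x. - p x" "- l" "sqrt \<epsilon>"]
        tendsto_minus[OF lim] assms(4) by force
  qed
qed

section \<open>The equation in the logarithmic coordinate\<close>

text \<open>This is \<open>(sin t)\<^sup>2\<close> for \<open>tan t = exp x\<close>.\<close>

definition weight :: "real \<Rightarrow> real" where
  "weight x = exp (2 * x) / (1 + exp (2 * x))"

lemma weight_bounds: "0 < weight x" "weight x < 1"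
  by (auto simp: weight_def add_pos_pos)

lemma weight_minus: "weight (- x) = 1 - weight x"
proof -
  have "1 + exp (2 * x) \<noteq> 0" using exp_gt_zero[of "2 * x"] by linarith
  then show ?thesis by (simp add: weight_def exp_minus field_simps)
qed

lemma DERIV_weight: "(weight has_real_derivative 2 * weight x * (1 - weight x)) (at x)"
proof -
  have nz: "1 + exp (2 * x) \<noteq> 0" using exp_gt_zero[of "2 * x"] by linarith
  have "((\<lambda>x. exp (2 * x) / (1 + exp (2 * x))) has_real_derivative
      (exp (2 * x) * 2 * (1 + exp (2 * x)) - exp (2 * x) * (exp (2 * x) * 2)) / ((1 + exp (2 * x)) * (1 + exp (2 * x)))) (at x)"
    by (rule derivative_eq_intros refl | use nz in simp)+
  moreover have "(exp (2 * x) * 2 * (1 + exp (2 * x)) - exp (2 * x) * (exp (2 * x) * 2)) / ((1 + exp (2 * x)) * (1 + exp (2 * x)))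
     = 2 * weight x * (1 - weight x)"
    using nz by (simp add: weight_def divide_simps) (simp add: algebra_simps)
  ultimately show ?thesis by (simp add: weight_def[abs_def])
qed

lemma weight_mono: "x \<le> y \<Longrightarrow> weight x \<le> weight y"
  by (rule DERIV_nonneg_imp_nondecreasing[of x y])
     (use DERIV_weight weight_bounds in \<open>auto intro!: exI less_imp_le simp: mult_pos_pos\<close>)

lemma weight_tendsto_0: "(weight \<longlongrightarrow> 0) at_bot"
proof -
  have "((\<lambda>x::real. exp (2 * x)) \<longlongrightarrow> 0) at_bot"
    by (rule filterlim_compose[OF exp_at_bot])
       (intro filterlim_tendsto_pos_mult_at_bot[OF tendsto_const] filterlim_ident, simp)
  then have "(weight \<longlongrightarrow> 0 / (1 + 0)) at_bot"
    unfolding weight_def[abs_def] by (intro tendsto_intros) auto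
  then show ?thesis by simp
qed

lemma weight_surj:
  assumes "0 < v" "v < 1"
  obtains x where "weight x = v"
proof
  have "exp (2 * (ln (v / (1 - v)) / 2)) = v / (1 - v)"
    using assms by simp
  then show "weight (ln (v / (1 - v)) / 2) = v"
    using assms by (simp add: weight_def divide_simps)
qed

definition damping :: "nat \<Rightarrow> nat \<Rightarrow> real \<Rightarrow> real" where
  "damping m n x = (real n - 1) * weight x - (real m - 1) * (1 - weight x)"

definition forcing :: "nat \<Rightarrow> nat \<Rightarrow> real \<Rightarrow> real" where
  "forcing m n x = real m * (1 - weight x) - real n * weight x"

text \<open>The equation for \<open>\<rho> x = r (arctan (exp x))\<close>, with \<open>p\<close> its slope. Only the boundary condition at minus
infinity is part of the locale: the one at plus infinity becomes a boundary condition of this form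
after reversing time.\<close>

locale pendulum =
  fixes m n :: nat and \<rho> p :: "real \<Rightarrow> real"
  assumes m_pos: "0 < m" and n_pos: "0 < n"
    and deriv_\<rho>: "(\<rho> has_real_derivative p x) (at x)"
    and deriv_p: "(p has_real_derivative damping m n x * p x + forcing m n x * (sin (\<rho> x) * cos (\<rho> x))) (at x)"
    and \<rho>_at_bot: "(\<rho> \<longlongrightarrow> 0) at_bot"
begin

lemma continuous_\<rho>: "continuous_on S \<rho>" and continuous_p: "continuous_on S p"
  using deriv_\<rho> deriv_p by (meson DERIV_isCont continuous_at_imp_continuous_on)+

lemma deriv_p_square: "((\<lambda>x. (p x)\<^sup>2) has_real_derivative
    2 * p x * (damping m n x * p x + forcing m n x * (sin (\<rho> x) * cos (\<rho> x)))) (at x)"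
  using DERIV_power[OF deriv_p, where n = 2] by (simp add: algebra_simps)

lemma deriv_sin: "((\<lambda>x. sin (\<rho> x)) has_real_derivative cos (\<rho> x) * p x) (at x)"
  by (rule DERIV_chain2[OF DERIV_sin deriv_\<rho>])

lemma deriv_sin_square: "((\<lambda>x. (sin (\<rho> x))\<^sup>2) has_real_derivative 2 * sin (\<rho> x) * cos (\<rho> x) * p x) (at x)"
  using DERIV_power[OF deriv_sin, where n = 2] by (simp add: mult_ac)

lemma uminus_solution: "pendulum m n (\<lambda>x. - \<rho> x) (\<lambda>x. - p x)"
proof
  fix x
  show "((\<lambda>x. - \<rho> x) has_real_derivative - p x) (at x)"
    by (rule DERIV_minus[OF deriv_\<rho>])
  show "((\<lambda>x. - p x) has_real_derivative
      damping m n x * - p x + forcing m n x * (sin (- \<rho> x) * cos (- \<rho> x))) (at x)"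
    using DERIV_minus[OF deriv_p[of x]] by (simp add: algebra_simps)
  show "((\<lambda>x. - \<rho> x) \<longlongrightarrow> 0) at_bot"
    using tendsto_minus[OF \<rho>_at_bot] by simp
qed (use m_pos n_pos in auto)

section \<open>The first phase without crossing pi: m at least 2\<close>

text \<open>As long as \<open>damping + \<bar>forcing - 1\<bar> \<le> 0\<close>, the difference \<open>p\<^sup>2 - (sin \<rho>)\<^sup>2\<close> decreases wherever it is
positive. If it were positive once, then \<open>p\<^sup>2\<close> would be bounded below by a positive constant at all
earlier times, and \<open>\<rho>\<close> would be unbounded.\<close>

lemma slope_le_sin_early:
  assumes w: "(real m + real n - 1) * weight x \<le> real m - 1"
  shows "(p x)\<^sup>2 \<le> (sin (\<rho> x))\<^sup>2"
proof (rule ccontr)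
  assume contr: "\<not> (p x)\<^sup>2 \<le> (sin (\<rho> x))\<^sup>2"
  define f where "f y = (p y)\<^sup>2 - (sin (\<rho> y))\<^sup>2" for y
  define f' where "f' y = 2 * p y * (damping m n y * p y + forcing m n y * (sin (\<rho> y) * cos (\<rho> y)))
      - 2 * sin (\<rho> y) * cos (\<rho> y) * p y" for y
  have fx: "0 < f x" using contr by (simp add: f_def)
  have "f x \<le> f y" if "y \<le> x" for y
  proof (rule positive_bounded_below_backwards[where f = f and f' = f', OF _ _ fx that])
    fix y assume "y \<le> x"
    show "(f has_real_derivative f' y) (at y)"
      unfolding f_def[abs_def] f'_def by (rule DERIV_diff[OF deriv_p_square deriv_sin_square])
    assume "0 < f y"
    then have "\<bar>sin (\<rho> y)\<bar> \<le> \<bar>p y\<bar>"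
      by (simp add: f_def abs_le_square_iff)
    then have "\<bar>sin (\<rho> y)\<bar> * \<bar>cos (\<rho> y)\<bar> * \<bar>p y\<bar> \<le> \<bar>p y\<bar> * 1 * \<bar>p y\<bar>"
      by (intro mult_mono) auto
    then have scp: "\<bar>sin (\<rho> y) * cos (\<rho> y) * p y\<bar> \<le> (p y)\<^sup>2"
      by (simp add: abs_mult power2_eq_square)
    have wy: "(real m + real n - 1) * weight y \<le> real m - 1"
    proof -
      have "(real m + real n - 1) * weight y \<le> (real m + real n - 1) * weight x"
        using m_pos n_pos weight_mono[OF \<open>y \<le> x\<close>] by (intro mult_left_mono) auto
      then show ?thesis using w by linarith
    qed
    have "damping m n y + (forcing m n y - 1) = - 2 * weight y"
      by (simp add: damping_def forcing_def algebra_simps)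
    moreover have "damping m n y - (forcing m n y - 1) \<le> 0"
    proof -
      have "damping m n y - (forcing m n y - 1) = 2 * ((real m + real n - 1) * weight y - (real m - 1))"
        by (simp add: damping_def forcing_def algebra_simps)
      then show ?thesis using wy by simp
    qed
    ultimately have "\<bar>forcing m n y - 1\<bar> \<le> - damping m n y"
      using weight_bounds[of y] by (intro abs_leI) linarith+
    then have coef: "damping m n y + \<bar>forcing m n y - 1\<bar> \<le> 0" by linarith
    let ?u = "sin (\<rho> y) * cos (\<rho> y) * p y"
    have "f' y = 2 * (damping m n y * (p y)\<^sup>2) + 2 * ((forcing m n y - 1) * ?u)"
      by (simp add: f'_def power2_eq_square algebra_simps)
    also have "\<dots> \<le> 2 * (damping m n y * (p y)\<^sup>2) + 2 * (\<bar>forcing m n y - 1\<bar> * (p y)\<^sup>2)"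
    proof -
      have "(forcing m n y - 1) * ?u \<le> \<bar>forcing m n y - 1\<bar> * \<bar>?u\<bar>"
        using abs_ge_self[of "(forcing m n y - 1) * ?u"] by (simp only: abs_mult)
      also have "\<dots> \<le> \<bar>forcing m n y - 1\<bar> * (p y)\<^sup>2"
        by (intro mult_left_mono scp) simp
      finally show ?thesis by linarith
    qed
    also have "\<dots> = 2 * ((damping m n y + \<bar>forcing m n y - 1\<bar>) * (p y)\<^sup>2)"
      by (simp add: algebra_simps)
    also have "\<dots> \<le> 0"
      using mult_nonpos_nonneg[OF coef zero_le_power2[of "p y"]] by linarith
    finally show "f' y \<le> 0" .
  qed
  moreover have "f y \<le> (p y)\<^sup>2" for y by (simp add: f_def)
  ultimately have "f x \<le> (p y)\<^sup>2" if "y \<le> x" for y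
    using that order_trans by blast
  moreover obtain y where "y \<le> x" "(p y)\<^sup>2 < f x"
    using derivative_square_not_bounded_below_at_bot[OF deriv_\<rho> continuous_p \<rho>_at_bot fx] by blast
  ultimately show False by force
qed

text \<open>For \<open>f = p\<^sup>2 - g\<^sup>2 * (sin \<rho>)\<^sup>2\<close> the inequality between arithmetic and geometric mean
gives \<open>f' \<le> C * f\<close> wherever \<open>f > 0\<close>, provided that \<open>g' \<ge> damping * g + \<bar>forcing - g\<^sup>2\<bar>\<close>. A solution \<open>g\<close> of
this Riccati inequality must start at \<open>g = 1\<close>, where the early estimate ends, and stay bounded until the force
vanishes. With \<open>\<eta>\<close> the affine function of the weight that runs
from \<open>0\<close> to \<open>1\<close> between these two moments, the Riccati equation becomes linear for \<open>1 / (1 + g)\<close>, and \<open>1/2 - \<eta>\<^sup>2 / 6\<close> is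
a subsolution. This is the choice \<open>g = (3 + \<eta>\<^sup>2) / (3 - \<eta>\<^sup>2)\<close>.\<close>

lemma slope_le_sin_late:
  assumes m: "2 \<le> m" and w0: "(real m + real n - 1) * weight x0 = real m - 1"
    and x: "x0 \<le> x" "(real m + real n) * weight x \<le> real m"
  shows "(p x)\<^sup>2 \<le> 4 * (sin (\<rho> x))\<^sup>2"
proof -
  define N where "N = real m + real n"
  have N: "N > 0" "N \<ge> 3" using m n_pos by (auto simp: N_def)
  define \<eta> where "\<eta> y = N / real n * ((N - 1) * weight y - (real m - 1))" for y
  define \<eta>' where "\<eta>' y = N / real n * ((N - 1) * (2 * weight y * (1 - weight y)))" for y
  define g where "g y = (3 + (\<eta> y)\<^sup>2) / (3 - (\<eta> y)\<^sup>2)" for y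
  define g' where "g' y = 12 * \<eta> y * \<eta>' y / (3 - (\<eta> y)\<^sup>2)\<^sup>2" for y
  define f where "f y = (p y)\<^sup>2 - (g y)\<^sup>2 * (sin (\<rho> y))\<^sup>2" for y
  define f' where "f' y = 2 * p y * (damping m n y * p y + forcing m n y * (sin (\<rho> y) * cos (\<rho> y)))
      - (2 * g y * g' y * (sin (\<rho> y))\<^sup>2 + (g y)\<^sup>2 * (2 * sin (\<rho> y) * cos (\<rho> y) * p y))" for y
  have wy: "(N - 1) * weight y \<ge> real m - 1" "N * weight y \<le> real m" if "x0 \<le> y" "y \<le> x" for y
  proof -
    have "(N - 1) * weight x0 \<le> (N - 1) * weight y"
      using N weight_mono[OF that(1)] by (intro mult_left_mono) auto
    then show "(N - 1) * weight y \<ge> real m - 1" using w0 by (simp add: N_def)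
    have "N * weight y \<le> N * weight x"
      using N weight_mono[OF that(2)] by (intro mult_left_mono) auto
    then show "N * weight y \<le> real m" using x(2) by (simp add: N_def)
  qed
  have \<eta>: "0 \<le> \<eta> y" "\<eta> y \<le> 1" if "x0 \<le> y" "y \<le> x" for y
  proof -
    show "0 \<le> \<eta> y" using wy[OF that] N by (simp add: \<eta>_def)
    have "N * ((N - 1) * weight y - (real m - 1)) = (N - 1) * (N * weight y) - N * (real m - 1)"
      by (simp add: algebra_simps)
    also have "\<dots> \<le> (N - 1) * real m - N * (real m - 1)"
      using wy(2)[OF that] N by (intro diff_right_mono mult_left_mono) auto
    also have "\<dots> = real n" by (simp add: N_def algebra_simps)
    finally show "\<eta> y \<le> 1" using n_pos by (simp add: \<eta>_def divide_simps)
  qed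
  have \<eta>': "2 \<le> \<eta>' y" if "x0 \<le> y" "y \<le> x" for y
  proof -
    have "1 \<le> (N - 1) * weight y" using wy(1)[OF that] m by simp
    moreover have "real n \<le> N * (1 - weight y)" using wy(2)[OF that] by (simp add: N_def algebra_simps)
    ultimately have "1 * real n \<le> ((N - 1) * weight y) * (N * (1 - weight y))"
      by (intro mult_mono) auto
    moreover have "\<eta>' y = 2 * (((N - 1) * weight y) * (N * (1 - weight y)) / real n)"
      by (simp add: \<eta>'_def)
    ultimately show ?thesis using n_pos by (simp only:) (simp add: le_divide_eq)
  qed
  have nz: "2 \<le> 3 - (\<eta> y)\<^sup>2" if "x0 \<le> y" "y \<le> x" for y
    using power_le_one[OF \<eta>[OF that], of 2] by simp
  have g: "1 \<le> g y" "g y \<le> 2" if "x0 \<le> y" "y \<le> x" for y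
    using nz[OF that] by (simp_all add: g_def divide_simps)
  have g': "damping m n y * g y + \<bar>forcing m n y - (g y)\<^sup>2\<bar> \<le> g' y" if y: "x0 \<le> y" "y \<le> x" for y
  proof -
    define \<omega> where "\<omega> = (N - 1) * weight y - (real m - 1)"
    define h where "h = \<eta> y"
    note * = \<eta>[OF y] nz[OF y]
    have \<omega>: "0 \<le> \<omega>" "\<omega> \<le> h"
    proof -
      show "0 \<le> \<omega>" using wy(1)[OF y] by (simp add: \<omega>_def)
      moreover have "1 \<le> N / real n" using n_pos by (simp add: N_def)
      ultimately show "\<omega> \<le> h"
        unfolding h_def \<eta>_def \<omega>_def[symmetric] using mult_right_mono[of 1 "N / real n" \<omega>] by simp
    qed
    have D: "damping m n y = \<omega> - weight y" and a: "forcing m n y = 1 - \<omega> - weight y"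
      by (simp_all add: damping_def forcing_def \<omega>_def N_def algebra_simps)
    have "forcing m n y \<le> (g y)\<^sup>2"
      unfolding a using one_le_power[OF g(1)[OF y], of 2] \<omega>(1) weight_bounds[of y] by linarith
    then have "damping m n y * g y + \<bar>forcing m n y - (g y)\<^sup>2\<bar>
        = (1 + g y) * (g y - 1 + \<omega>) - weight y * (g y - 1)"
      by (simp add: D a power2_eq_square algebra_simps)
    also have "\<dots> \<le> (1 + g y) * (g y - 1 + h)"
    proof -
      have "0 \<le> weight y * (g y - 1)" using weight_bounds[of y] g(1)[OF y] by simp
      moreover have "(1 + g y) * (g y - 1 + \<omega>) \<le> (1 + g y) * (g y - 1 + h)"
        using \<omega> g(1)[OF y] by (intro mult_left_mono) auto
      ultimately show ?thesis by linarith
    qed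
    also have "\<dots> = 6 * (2 * h\<^sup>2 + 3 * h - h ^ 3) / (3 - h\<^sup>2)\<^sup>2"
      using *(3) unfolding g_def h_def[symmetric]
      by (simp add: divide_simps) (simp add: power2_eq_square power3_eq_cube algebra_simps)
    also have "\<dots> \<le> 12 * h * \<eta>' y / (3 - h\<^sup>2)\<^sup>2"
    proof (rule divide_right_mono)
      \<comment> \<open>The Riccati inequality reduces to a perfect square because \<open>\<eta>' \<ge> 2\<close>.\<close>
      have "6 * (2 * h\<^sup>2 + 3 * h - h ^ 3) = 24 * h - 6 * h * (1 - h)\<^sup>2"
        by (simp add: power2_eq_square power3_eq_cube algebra_simps)
      also have "\<dots> \<le> 24 * h" using *(1) by (simp add: h_def)
      also have "\<dots> \<le> 12 * h * \<eta>' y" using mult_left_mono[OF \<eta>'[OF y], of "12 * h"] *(1) by (simp add: h_def)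
      finally show "6 * (2 * h\<^sup>2 + 3 * h - h ^ 3) \<le> 12 * h * \<eta>' y" .
    qed simp
    also have "\<dots> = g' y" by (simp add: g'_def h_def)
    finally show ?thesis .
  qed
  have "f x \<le> 0"
  proof (rule nonpos_persists[where f = f and f' = f' and C = "2 * N + 2" and a = x0])
    have "g x0 = 1" using w0 by (simp add: g_def \<eta>_def N_def)
    then show "f x0 \<le> 0"
      using slope_le_sin_early[of x0] w0 by (simp add: f_def)
  next
    fix y assume y: "x0 \<le> y" "y \<le> x"
    have "(\<eta> has_real_derivative \<eta>' y) (at y)"
      unfolding \<eta>_def[abs_def] \<eta>'_def
      by (rule derivative_eq_intros DERIV_weight refl)+ simp
    then have "(g has_real_derivative g' y) (at y)"
      unfolding g_def[abs_def] g'_def using nz[OF y]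
      by (auto intro!: derivative_eq_intros simp: power2_eq_square algebra_simps)
    then have "((\<lambda>y. (g y)\<^sup>2) has_real_derivative 2 * g y * g' y) (at y)"
      using DERIV_power[of g "g' y" y UNIV, where n = 2] by (simp add: mult_ac)
    from DERIV_diff[OF deriv_p_square DERIV_mult[OF this deriv_sin_square]]
    show "(f has_real_derivative f' y) (at y)"
      unfolding f_def[abs_def] f'_def by (simp add: algebra_simps)
    assume pos: "0 < f y"
    define A where "A = \<bar>forcing m n y - (g y)\<^sup>2\<bar>"
    have gpos: "0 < g y" using g(1)[OF y] by simp
    have amgm: "2 * \<bar>sin (\<rho> y) * cos (\<rho> y) * p y\<bar> \<le> g y * (sin (\<rho> y))\<^sup>2 + (p y)\<^sup>2 / g y"
    proof -
      have "\<bar>sin (\<rho> y) * p y\<bar> * \<bar>cos (\<rho> y)\<bar> \<le> \<bar>sin (\<rho> y) * p y\<bar> * 1"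
        by (intro mult_left_mono) auto
      then have "2 * g y * \<bar>sin (\<rho> y) * cos (\<rho> y) * p y\<bar> \<le> 2 * g y * (\<bar>sin (\<rho> y)\<bar> * \<bar>p y\<bar>)"
        using gpos by (simp add: abs_mult ac_simps)
      also have "\<dots> \<le> (g y)\<^sup>2 * (sin (\<rho> y))\<^sup>2 + (p y)\<^sup>2"
        using zero_le_power2[of "g y * \<bar>sin (\<rho> y)\<bar> - \<bar>p y\<bar>"]
        by (simp add: power2_diff power_mult_distrib)
      finally show ?thesis using gpos by (simp add: field_simps power2_eq_square)
    qed
    have "f' y = 2 * (damping m n y * (p y)\<^sup>2) + (forcing m n y - (g y)\<^sup>2) * (2 * (sin (\<rho> y) * cos (\<rho> y) * p y))
        - 2 * g y * g' y * (sin (\<rho> y))\<^sup>2"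
      by (simp add: f'_def power2_eq_square algebra_simps)
    also have "\<dots> \<le> 2 * (damping m n y * (p y)\<^sup>2) + A * (g y * (sin (\<rho> y))\<^sup>2 + (p y)\<^sup>2 / g y)
        - 2 * g y * g' y * (sin (\<rho> y))\<^sup>2"
    proof -
      have "(forcing m n y - (g y)\<^sup>2) * (2 * (sin (\<rho> y) * cos (\<rho> y) * p y)) \<le> A * (2 * \<bar>sin (\<rho> y) * cos (\<rho> y) * p y\<bar>)"
        using abs_ge_self[of "(forcing m n y - (g y)\<^sup>2) * (2 * (sin (\<rho> y) * cos (\<rho> y) * p y))"]
        unfolding A_def by (simp only: abs_mult abs_numeral)
      also have "\<dots> \<le> A * (g y * (sin (\<rho> y))\<^sup>2 + (p y)\<^sup>2 / g y)"
        by (intro mult_left_mono amgm) (simp add: A_def)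
      finally show ?thesis by simp
    qed
    also have "\<dots> = (2 * damping m n y + A / g y) * f y
        + 2 * g y * (sin (\<rho> y))\<^sup>2 * (damping m n y * g y + A - g' y)"
      using gpos by (simp add: f_def field_simps power2_eq_square)
    also have "\<dots> \<le> (2 * damping m n y + A / g y) * f y"
    proof -
      have "2 * g y * (sin (\<rho> y))\<^sup>2 * (damping m n y * g y + A - g' y) \<le> 0"
        using g'[OF y] gpos by (intro mult_nonneg_nonpos) (auto simp: A_def)
      then show ?thesis by simp
    qed
    also have "\<dots> \<le> (2 * N + 2) * f y"
    proof (rule mult_right_mono)
      have "(real n - 1) * weight y \<le> (real n - 1) * 1" "0 \<le> (real m - 1) * (1 - weight y)"
        using m n_pos weight_bounds[of y] by (intro mult_left_mono mult_nonneg_nonneg, auto)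
      then have D: "damping m n y \<le> N - 1" by (simp add: damping_def N_def)
      have "0 \<le> forcing m n y"
        using wy(2)[OF y] by (simp add: forcing_def N_def algebra_simps)
      moreover have "forcing m n y \<le> 1"
      proof -
        have "forcing m n y = 1 - ((N - 1) * weight y - (real m - 1)) - weight y"
          by (simp add: forcing_def N_def algebra_simps)
        then show ?thesis using wy(1)[OF y] weight_bounds[of y] by linarith
      qed
      moreover have "(g y)\<^sup>2 \<le> 4" using power_mono[OF g(2)[OF y], of 2] gpos by simp
      moreover have "0 \<le> (g y)\<^sup>2" by simp
      ultimately have "A \<le> 4" unfolding A_def by (intro abs_leI) linarith+
      then have "A \<le> 4 * g y" using g(1)[OF y] by linarith
      then have "A / g y \<le> 4" using gpos by (simp add: divide_le_eq)
      then show "2 * damping m n y + A / g y \<le> 2 * N + 2"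
        using D by linarith
    qed (use pos in simp)
    finally show "f' y \<le> (2 * N + 2) * f y" .
  qed (use x in auto)
  then have "(p x)\<^sup>2 \<le> (g x)\<^sup>2 * (sin (\<rho> x))\<^sup>2" by (simp add: f_def)
  also have "\<dots> \<le> 2\<^sup>2 * (sin (\<rho> x))\<^sup>2"
    using g[OF x(1) order_refl] by (intro mult_right_mono power_mono) auto
  finally show ?thesis by simp
qed

text \<open>The two estimates give \<open>\<bar>p\<bar> \<le> 2 * \<bar>sin \<rho>\<bar>\<close>, so that \<open>\<rho>\<close> cannot reach the zeros \<open>pi\<close> and \<open>- pi\<close> of the sine in
finite time: \<open>1 + cos \<rho>\<close> decays at most exponentially.\<close>

lemma bound_first_half_ge_2:
  assumes m: "2 \<le> m" and x: "(real m + real n) * weight x \<le> real m"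
  shows "\<bar>\<rho> x\<bar> < pi"
proof -
  obtain x0 where "weight x0 = (real m - 1) / (real m + real n - 1)"
    using weight_surj[of "(real m - 1) / (real m + real n - 1)"] m n_pos by auto
  then have w0: "(real m + real n - 1) * weight x0 = real m - 1"
    using m by (simp add: field_simps)
  have slope: "\<bar>p y\<bar> \<le> 2 * \<bar>sin (\<rho> y)\<bar>" if "y \<le> x" for y
  proof -
    have "(p y)\<^sup>2 \<le> 4 * (sin (\<rho> y))\<^sup>2"
    proof (cases "y \<le> x0")
      case True
      have "(real m + real n - 1) * weight y \<le> (real m + real n - 1) * weight x0"
        using m weight_mono[OF True] by (intro mult_left_mono) auto
      then have "(p y)\<^sup>2 \<le> (sin (\<rho> y))\<^sup>2"
        using w0 by (intro slope_le_sin_early) simp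
      then show ?thesis using zero_le_power2[of "sin (\<rho> y)"] by linarith
    next
      case False
      have "(real m + real n) * weight y \<le> (real m + real n) * weight x"
        using m weight_mono[OF that] by (intro mult_left_mono) auto
      then show ?thesis using slope_le_sin_late[OF m w0] False x by simp
    qed
    then have "(p y)\<^sup>2 \<le> (2 * sin (\<rho> y))\<^sup>2" by (simp add: power_mult_distrib)
    then have "\<bar>p y\<bar> \<le> \<bar>2 * sin (\<rho> y)\<bar>" by (simp only: abs_le_square_iff)
    then show ?thesis by (simp add: abs_mult)
  qed
  obtain X where X: "X \<le> x" "\<And>y. y \<le> X \<Longrightarrow> \<bar>\<rho> y\<bar> < 1"
  proof -
    have "eventually (\<lambda>y. dist (\<rho> y) 0 < 1) at_bot"
      using \<rho>_at_bot by (rule tendstoD) simp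
    then obtain c where "\<And>y. y \<le> c \<Longrightarrow> \<bar>\<rho> y\<bar> < 1"
      by (auto simp: eventually_at_bot_linorder)
    then show ?thesis using that[of "min c x"] by auto
  qed
  have "cos (\<rho> X) > 0"
    using X(2)[of X] pi_gt3 by (intro cos_gt_zero_pi) auto
  have cos: "cos (\<rho> y) \<noteq> -1" if y: "X \<le> y" "y \<le> x" for y
  proof
    assume c: "cos (\<rho> y) = -1"
    let ?S = "\<lambda>z. (1 + cos (\<rho> z)) * exp (4 * z)"
    have "?S X \<le> ?S y"
    proof (rule DERIV_nonneg_imp_nondecreasing[OF y(1)])
      fix z assume z: "X \<le> z" "z \<le> y"
      have "(?S has_real_derivative (4 * (1 + cos (\<rho> z)) - sin (\<rho> z) * p z) * exp (4 * z)) (at z)"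
        by (auto intro!: derivative_eq_intros deriv_\<rho> simp: algebra_simps)
      moreover have "sin (\<rho> z) * p z \<le> 4 * (1 + cos (\<rho> z))"
      proof -
        have "sin (\<rho> z) * p z \<le> \<bar>sin (\<rho> z)\<bar> * \<bar>p z\<bar>"
          using abs_ge_self[of "sin (\<rho> z) * p z"] by (simp only: abs_mult)
        also have "\<dots> \<le> \<bar>sin (\<rho> z)\<bar> * (2 * \<bar>sin (\<rho> z)\<bar>)"
          using slope[of z] z y by (intro mult_left_mono) auto
        also have "\<dots> = 2 * (sin (\<rho> z))\<^sup>2" by (simp add: power2_eq_square)
        also have "\<dots> = 2 * (1 - (cos (\<rho> z))\<^sup>2)" by (simp only: sin_squared_eq)
        also have "\<dots> = 2 * (1 - cos (\<rho> z)) * (1 + cos (\<rho> z))"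
          by (simp add: power2_eq_square algebra_simps)
        also have "\<dots> \<le> 4 * (1 + cos (\<rho> z))"
        proof (rule mult_right_mono)
          have "-1 \<le> cos (\<rho> z)" by (rule cos_ge_minus_one)
          then show "2 * (1 - cos (\<rho> z)) \<le> 4" "0 \<le> 1 + cos (\<rho> z)" by argo+
        qed
        finally show ?thesis .
      qed
      ultimately show "\<exists>d. (?S has_real_derivative d) (at z) \<and> 0 \<le> d"
        by (intro exI conjI) auto
    qed
    moreover have "0 < ?S X" using \<open>cos (\<rho> X) > 0\<close> by (intro mult_pos_pos) auto
    ultimately show False using c by simp
  qed
  show ?thesis
  proof (rule ccontr)
    assume "\<not> ?thesis"
    then have "pi \<le> \<bar>\<rho> x\<bar>" by simp
    moreover have "\<bar>\<rho> X\<bar> \<le> pi" using X(2)[of X] pi_gt3 by simp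
    moreover have "continuous_on {X..x} (\<lambda>y. \<bar>\<rho> y\<bar>)"
      by (intro continuous_on_rabs continuous_\<rho>)
    ultimately obtain y where y: "X \<le> y" "y \<le> x" "\<bar>\<rho> y\<bar> = pi"
      using IVT'[of "\<lambda>y. \<bar>\<rho> y\<bar>" X pi x] X(1) by auto
    have "cos (\<rho> y) = cos \<bar>\<rho> y\<bar>" by (simp add: abs_if)
    then show False using cos[OF y(1,2)] y(3) by simp
  qed
qed

end

section \<open>The first phase for m = 1\<close>

lemma sin_ge_two_thirds_mult:
  assumes "0 \<le> x" "x \<le> pi / 4"
  shows "2 / 3 * x \<le> sin x"
proof -
  have "sin 0 - 2 / 3 * 0 \<le> sin x - 2 / 3 * x"
  proof (rule DERIV_nonneg_imp_nondecreasing[OF assms(1)])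
    fix y assume y: "0 \<le> y" "y \<le> x"
    have "cos (pi / 4) \<le> cos y"
      using y assms(2) by (intro cos_monotone_0_pi_le) auto
    moreover have "7 / 5 \<le> sqrt 2" by (rule real_le_rsqrt) (simp add: power2_eq_square)
    then have "2 / 3 \<le> cos (pi / 4)" by (simp add: cos_45)
    ultimately show "\<exists>d. ((\<lambda>x. sin x - 2 / 3 * x) has_real_derivative d) (at y) \<and> 0 \<le> d"
      by (intro exI[of _ "cos y - 2 / 3"]) (auto intro!: derivative_eq_intros)
  qed
  then show ?thesis by simp
qed

lemma linear_trig_bound:
  fixes A B R s c :: real
  assumes "s\<^sup>2 + c\<^sup>2 = 1" "A\<^sup>2 + B\<^sup>2 \<le> R\<^sup>2" "0 \<le> R"
  shows "A * c + B * s \<le> R"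
proof -
  have "(A * c + B * s)\<^sup>2 + (A * s - B * c)\<^sup>2 = (A\<^sup>2 + B\<^sup>2) * (s\<^sup>2 + c\<^sup>2)"
    by (simp add: power2_eq_square algebra_simps)
  then have "(A * c + B * s)\<^sup>2 \<le> R\<^sup>2"
    using assms(1,2) zero_le_power2[of "A * s - B * c"] by (simp only: mult_1_right)
  then show ?thesis by (rule power2_le_imp_le) (rule assms)
qed

text \<open>The difference of the two sides is, up to the estimate \<open>f \<le> 31 / 50\<close> in the term \<open>f ^ 4\<close>, a polynomial of degree 4
in \<open>z\<close> with constant term \<open>29 / 500\<close>, and on the unit interval the higher terms
add up to more than \<open>- 29 / 500\<close>.\<close>

lemma barrier_quartic:
  fixes z f R :: real
  assumes z: "0 \<le> z" "z \<le> 1" and f: "f = (23 + 8 * z) / 50" and R: "R = 3 * f - z * f + 4 / 25 * z"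
  shows "(2 * f)\<^sup>2 + (1 - z * f\<^sup>2)\<^sup>2 \<le> R\<^sup>2" "0 \<le> R"
proof -
  have f01: "0 \<le> f" "f \<le> 31 / 50" using z by (auto simp: f)
  have "z * f \<le> 1 * f" using z f01 by (intro mult_right_mono) auto
  then show "0 \<le> R" using z f01 by (simp add: R)
  have zz: "z\<^sup>2 \<le> z" "z ^ 3 \<le> z" "0 \<le> z ^ 4"
    using z power_le_one[of z 2] mult_left_mono[of z 1 z] mult_left_mono[of "z\<^sup>2" 1 z]
    by (auto simp: power2_eq_square power3_eq_cube)
  have "f ^ 4 \<le> (31 / 50) ^ 4" using f01 by (intro power_mono) auto
  then have "z\<^sup>2 * f ^ 4 \<le> z\<^sup>2 * (31 / 50) ^ 4" by (intro mult_left_mono) auto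
  then have "R\<^sup>2 - (2 * f)\<^sup>2 - (1 - z * f\<^sup>2)\<^sup>2 \<ge> R\<^sup>2 - 4 * f\<^sup>2 - 1 + 2 * z * f\<^sup>2 - z\<^sup>2 * (31 / 50) ^ 4"
    by (simp add: power2_eq_square power4_eq_xxxx algebra_simps)
  also have "R\<^sup>2 - 4 * f\<^sup>2 - 1 + 2 * z * f\<^sup>2 - z\<^sup>2 * (31 / 50) ^ 4
      = 29 / 500 + 207 / 625 * z - 2281021 / 6250000 * z\<^sup>2 - 4 / 625 * z ^ 3 + 16 / 625 * z ^ 4"
    unfolding R f by (simp add: power2_eq_square power3_eq_cube power4_eq_xxxx field_simps)
  finally have "29 / 500 + 207 / 625 * z - 2281021 / 6250000 * z\<^sup>2 - 4 / 625 * z ^ 3 + 16 / 625 * z ^ 4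
      \<le> R\<^sup>2 - (2 * f)\<^sup>2 - (1 - z * f\<^sup>2)\<^sup>2" .
  then show "(2 * f)\<^sup>2 + (1 - z * f\<^sup>2)\<^sup>2 \<le> R\<^sup>2"
    using zz z by linarith
qed

text \<open>The function \<open>F\<close> in the bound \<open>p \<le> sin \<rho> + F * (1 - cos \<rho>)\<close>, in terms of \<open>z = (1 + n) * weight\<close>, which runs from
\<open>0\<close> to \<open>1\<close> while the force \<open>1 - z\<close> is positive. The form of the bound is the one for
which \<open>p = sin \<rho> + F * (1 - cos \<rho>)\<close> is a linear equation for \<open>cot (\<rho> / 2)\<close>. The coefficients in
\<open>F = z * f\<close> with \<open>f = (23 + 8 * z) / 50\<close> are a compromise: \<open>f\<close> must be large enough for
\<open>F\<close> to be a supersolution, for which \<open>f \<ge> 1 / sqrt 5\<close> is necessary at \<open>z = 0\<close>, and small enough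
to stop the solution before \<open>5 * pi / 4\<close>.\<close>

definition barrier :: "real \<Rightarrow> real" where
  "barrier z = z * (23 + 8 * z) / 50"

lemma barrier_bounds:
  assumes "0 \<le> z" "z \<le> 1" shows "0 \<le> barrier z" "barrier z \<le> 31 / 50"
proof -
  show "0 \<le> barrier z" using assms by (simp add: barrier_def)
  have "z * (23 + 8 * z) \<le> 1 * 31" using assms by (intro mult_mono) auto
  then show "barrier z \<le> 31 / 50" by (simp add: barrier_def)
qed

lemma DERIV_barrier_weight:
  "((\<lambda>y. barrier (N * weight y)) has_real_derivative
     2 * (N * weight y) * (1 - weight y) * (23 + 16 * (N * weight y)) / 50) (at y)"
proof -
  have "(barrier has_real_derivative (23 + 16 * z) / 50) (at z)" for z
    unfolding barrier_def[abs_def] by (auto intro!: derivative_eq_intros)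
  from DERIV_chain2[OF this DERIV_cmult[OF DERIV_weight]] show ?thesis
    by (rule DERIV_cong) simp
qed

lemma cos_le_between_pi:
  assumes "pi \<le> r" "r \<le> 5 / 4 * pi"
  shows "cos r \<le> - 7 / 10" "sin r \<le> 0"
proof -
  have r: "0 \<le> r - pi" "r - pi \<le> pi / 4" using assms by auto
  have "7 / 5 \<le> sqrt 2" by (rule real_le_rsqrt) (simp add: power2_eq_square)
  then have "7 / 10 \<le> cos (pi / 4)" by (simp add: cos_45)
  also have "\<dots> \<le> cos (r - pi)" using r by (intro cos_monotone_0_pi_le) auto
  finally show "cos r \<le> - 7 / 10" by (simp add: cos_diff)
  have "0 \<le> sin (r - pi)" using r pi_gt_zero by (intro sin_ge_zero) linarith+
  then show "sin r \<le> 0" by (simp add: sin_diff)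
qed

text \<open>This says that \<open>sin \<rho> + F * (1 - cos \<rho>)\<close> is a supersolution for the slope. The left-hand side is
\<open>z * (1 - cos r) * B - 2 * w * sin r\<close>. Up to \<open>pi\<close> the factor \<open>B\<close> is nonpositive by \<open>barrier_quartic\<close>; beyond \<open>pi\<close>
the second term has the wrong sign but is outweighed by the first.\<close>

lemma barrier_residual:
  fixes w N z r :: real
  assumes w: "0 \<le> w" "w < 1" "2 \<le> N" and z: "z = N * w" "z \<le> 1" and r: "0 \<le> r" "r \<le> 5 / 4 * pi"
  defines "F \<equiv> barrier z" and "F' \<equiv> 2 * z * (1 - w) * (23 + 16 * z) / 50"
    and "D \<equiv> z - 2 * w"
  shows "(D - cos r - F * sin r) * (sin r + F * (1 - cos r)) + (1 - z) * (sin r * cos r) - F' * (1 - cos r) \<le> 0"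
proof -
  define f where "f = (23 + 8 * z) / 50"
  let ?s = "sin r" and ?c = "cos r"
  define B where "B = f * (- 3 - 2 * ?c + z) - 2 * (1 - w) * (z * (4 / 25)) + (1 - z * f\<^sup>2) * ?s"
  have z0: "0 \<le> z" using w z by simp
  have w2: "2 * w \<le> z" "w \<le> 1 / 2" using w z mult_right_mono[of 2 N w] by auto
  have Ff: "F = z * f" and F': "F' = 2 * z * (1 - w) * (f + z * (4 / 25))"
    by (simp_all add: F_def barrier_def f_def F'_def field_simps)
  have s2: "?s * ?s = (1 - ?c) * (1 + ?c)"
    using sin_squared_eq[of r] by (simp add: power2_eq_square algebra_simps)
  have "(D - ?c - F * ?s) * (?s + F * (1 - ?c)) + (1 - z) * (?s * ?c) - F' * (1 - ?c)
      = (D - ?c) * ?s - F * (?s * ?s) + (D - ?c) * F * (1 - ?c) - F * F * ?s * (1 - ?c) + (1 - z) * (?s * ?c) - F' * (1 - ?c)"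
    by (simp add: algebra_simps)
  also have "\<dots> = z * (1 - ?c) * B - 2 * w * ?s"
    unfolding s2 B_def Ff F' D_def by (simp add: power2_eq_square algebra_simps)
  finally have eq: "(D - ?c - F * ?s) * (?s + F * (1 - ?c)) + (1 - z) * (?s * ?c) - F' * (1 - ?c)
      = z * (1 - ?c) * B - 2 * w * ?s" .
  have c1: "0 \<le> 1 - ?c" by simp
  have f01: "0 \<le> f" "f \<le> 31 / 50" using z0 z by (auto simp: f_def)
  have slack: "z * (4 / 25) \<le> 2 * (1 - w) * (z * (4 / 25))"
    using mult_right_mono[of 1 "2 * (1 - w)" "z * (4 / 25)"] w2 z0 by simp
  have "z * (1 - ?c) * B - 2 * w * ?s \<le> 0"
  proof (cases "r \<le> pi")
    case True
    then have s: "0 \<le> ?s" using r by (intro sin_ge_zero)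
    have "- (2 * f) * ?c + (1 - z * f\<^sup>2) * ?s \<le> 3 * f - z * f + 4 / 25 * z"
      by (rule linear_trig_bound) (use barrier_quartic[OF z0 z(2) f_def refl] in auto)
    moreover have "B = (- (2 * f) * ?c + (1 - z * f\<^sup>2) * ?s) - (3 * f - z * f) - 2 * (1 - w) * (z * (4 / 25))"
      by (simp add: B_def algebra_simps)
    ultimately have "B \<le> 0" using slack by linarith
    then have "z * (1 - ?c) * B \<le> 0" using z0 c1 by (intro mult_nonneg_nonpos mult_nonneg_nonneg)
    moreover have "0 \<le> 2 * w * ?s" using s w by simp
    ultimately show ?thesis by linarith
  next
    case False
    then have c: "?c \<le> - 7 / 10" and s: "?s \<le> 0"
      using cos_le_between_pi[of r] r by auto
    have "z * f\<^sup>2 \<le> 1 * (31 / 50)\<^sup>2" using z0 z f01 by (intro mult_mono power_mono) auto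
    then have zf: "3 / 5 \<le> 1 - z * f\<^sup>2" by (simp add: power2_eq_square)
    have "- 3 - 2 * ?c + z \<le> 0" using z(2) cos_ge_minus_one[of r] by argo
    then have "f * (- 3 - 2 * ?c + z) \<le> 0" using f01 by (intro mult_nonneg_nonpos)
    moreover have "0 \<le> 2 * (1 - w) * (z * (4 / 25))" using w z0 by simp
    moreover have "(1 - z * f\<^sup>2) * ?s \<le> 3 / 5 * ?s" using zf s by (intro mult_right_mono_neg)
    ultimately have "B \<le> 3 / 5 * ?s" by (simp add: B_def)
    then have "z * (1 - ?c) * B \<le> z * (1 - ?c) * (3 / 5 * ?s)"
      using z0 c1 by (intro mult_left_mono) auto
    also have "\<dots> = (1 - ?c) * (3 / 5) * (z * ?s)" by simp
    also have "\<dots> \<le> 1 * (z * ?s)"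
    proof (rule mult_right_mono_neg)
      show "1 \<le> (1 - ?c) * (3 / 5)" using c by simp
      show "z * ?s \<le> 0" using z0 s by (intro mult_nonneg_nonpos)
    qed
    also have "z * ?s \<le> 2 * w * ?s" using w2 s by (intro mult_right_mono_neg)
    finally show ?thesis by simp
  qed
  then show ?thesis unfolding eq .
qed


context pendulum
begin

text \<open>For \<open>m = 1\<close> the damping is nonnegative, so the energy \<open>V = p\<^sup>2 - forcing * (sin \<rho>)\<^sup>2\<close> is nondecreasing, and it is nonnegative
because \<open>\<rho>\<close> tends to \<open>0\<close> at minus infinity. A zero of the slope while the force is
nonnegative forces \<open>V = 0\<close> at all earlier times, hence \<open>p = 0\<close> at all earlier times.\<close>

lemma slope_constant_sign:
  assumes m: "m = 1"
  shows "(\<forall>x. (1 + real n) * weight x \<le> 1 \<longrightarrow> 0 \<le> p x) \<or> (\<forall>x. (1 + real n) * weight x \<le> 1 \<longrightarrow> p x \<le> 0)"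
proof (rule ccontr)
  assume "\<not> ?thesis"
  then obtain x y where x: "(1 + real n) * weight x \<le> 1" "p x < 0" and y: "(1 + real n) * weight y \<le> 1" "0 < p y"
    by force
  define V where "V x = (p x)\<^sup>2 - forcing m n x * (sin (\<rho> x))\<^sup>2" for x
  define V' where "V' x = 2 * damping m n x * (p x)\<^sup>2 + 2 * (1 + real n) * weight x * (1 - weight x) * (sin (\<rho> x))\<^sup>2" for x
  have deriv_V: "(V has_real_derivative V' x) (at x)" for x
  proof -
    have "(forcing m n has_real_derivative - ((1 + real n) * (2 * weight x * (1 - weight x)))) (at x)"
      unfolding forcing_def[abs_def] m
      by (auto intro!: derivative_eq_intros DERIV_weight simp: algebra_simps)
    from DERIV_diff[OF deriv_p_square DERIV_mult[OF this deriv_sin_square]]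
    show ?thesis
      unfolding V_def[abs_def] V'_def by (simp add: power2_eq_square algebra_simps)
  qed
  have V'_nonneg: "0 \<le> V' x" for x
    using weight_bounds[of x] n_pos by (simp add: V'_def damping_def m)
  have mono: "V x \<le> V y" if "x \<le> y" for x y
    by (rule DERIV_nonneg_imp_nondecreasing[OF that]) (use deriv_V V'_nonneg in blast)
  have V_nonneg: "0 \<le> V x" for x
  proof (rule ccontr)
    assume "\<not> 0 \<le> V x"
    have "((\<lambda>y. (sin (\<rho> y))\<^sup>2) \<longlongrightarrow> (sin 0)\<^sup>2) at_bot"
      by (intro tendsto_intros \<rho>_at_bot)
    then have "eventually (\<lambda>y. (sin (\<rho> y))\<^sup>2 < - V x) at_bot"
      using \<open>\<not> 0 \<le> V x\<close> by (intro order_tendstoD(2)[where y = 0]) auto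
    then obtain c where c: "\<And>y. y \<le> c \<Longrightarrow> (sin (\<rho> y))\<^sup>2 < - V x"
      by (auto simp: eventually_at_bot_linorder)
    let ?y = "min c x"
    have "0 \<le> real n * weight ?y" using weight_bounds[of ?y] by simp
    moreover have "forcing m n ?y = 1 - weight ?y - real n * weight ?y"
      by (simp add: forcing_def m)
    ultimately have "forcing m n ?y \<le> 1" using weight_bounds[of ?y] by linarith
    then have "forcing m n ?y * (sin (\<rho> ?y))\<^sup>2 \<le> 1 * (sin (\<rho> ?y))\<^sup>2"
      by (intro mult_right_mono) auto
    then have "- (sin (\<rho> ?y))\<^sup>2 \<le> V ?y"
      unfolding V_def using zero_le_power2[of "p ?y"] by linarith
    moreover have "V ?y \<le> V x" by (rule mono) simp
    ultimately show False using c[of ?y] by simp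
  qed
  define lo hi where "lo = min x y" and "hi = max x y"
  have "\<exists>z. lo \<le> z \<and> z \<le> hi \<and> p z = 0"
  proof (cases "x \<le> y")
    case True
    then show ?thesis
      using IVT'[of p x 0 y] x y continuous_p by (auto simp: lo_def hi_def)
  next
    case False
    then show ?thesis
      using IVT2'[of p x 0 y] x y continuous_p by (auto simp: lo_def hi_def)
  qed
  then obtain z where z: "lo \<le> z" "z \<le> hi" "p z = 0" by blast
  have p_lo: "p lo \<noteq> 0" and p_hi: "p hi \<noteq> 0"
    using x y by (auto simp: lo_def hi_def min_def max_def)
  have w_hi: "(1 + real n) * weight hi \<le> 1"
    using x y by (auto simp: hi_def max_def)
  have lz: "lo < z" using z p_lo by (cases "lo = z") auto
  have "(1 + real n) * weight z \<le> (1 + real n) * weight hi"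
    using weight_mono[OF z(2)] by (intro mult_left_mono) auto
  then have "0 \<le> forcing m n z"
    using w_hi by (simp add: forcing_def m algebra_simps)
  then have "V z \<le> 0" using z(3) by (simp add: V_def)
  then have V0: "V u = 0" if "u \<le> z" for u
    using mono[OF that] V_nonneg[of u] by simp
  have "(V has_real_derivative 0) (at lo)"
  proof (rule DERIV_cong_ev[THEN iffD1, OF refl _ refl])
    show "((\<lambda>u. 0::real) has_real_derivative 0) (at lo)" by simp
    have "eventually (\<lambda>u. u \<in> {..<z}) (nhds lo)"
      using lz by (intro eventually_nhds_in_open) auto
    then show "eventually (\<lambda>u. 0 = V u) (nhds lo)"
      by eventually_elim (use V0 in auto)
  qed
  then have "V' lo = 0" using deriv_V[of lo] DERIV_unique by blast
  moreover have "0 \<le> 2 * damping m n lo * (p lo)\<^sup>2"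
    using weight_bounds[of lo] n_pos by (simp add: damping_def m)
  moreover have "0 \<le> 2 * (1 + real n) * weight lo * (1 - weight lo) * (sin (\<rho> lo))\<^sup>2"
    using weight_bounds[of lo] by simp
  ultimately have "2 * (1 + real n) * weight lo * (1 - weight lo) * (sin (\<rho> lo))\<^sup>2 = 0"
    unfolding V'_def by linarith
  then have "sin (\<rho> lo) = 0"
    using weight_bounds[of lo] by auto
  then show False using V0[of lo] lz p_lo by (simp add: V_def)
qed

lemma monotone_from_0:
  assumes slope: "\<And>y. y \<le> x \<Longrightarrow> 0 \<le> p y"
  shows "y \<le> x \<Longrightarrow> 0 \<le> \<rho> y" and "y \<le> z \<Longrightarrow> z \<le> x \<Longrightarrow> \<rho> y \<le> \<rho> z"
proof -
  have mono: "\<rho> y \<le> \<rho> z" if "y \<le> z" "z \<le> x" for y z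
    by (rule DERIV_nonneg_imp_nondecreasing[OF that(1)]) (use deriv_\<rho> slope that in force)
  show "y \<le> z \<Longrightarrow> z \<le> x \<Longrightarrow> \<rho> y \<le> \<rho> z" by (rule mono)
  assume "y \<le> x"
  show "0 \<le> \<rho> y"
  proof (rule tendsto_upperbound[OF \<rho>_at_bot])
    show "eventually (\<lambda>u. \<rho> u \<le> \<rho> y) at_bot"
      using mono \<open>y \<le> x\<close> by (auto simp: eventually_at_bot_linorder intro!: exI[of _ y])
  qed simp
qed

text \<open>The excess \<open>T\<close> of the slope over the barrier satisfies \<open>T' \<le> K * T\<close>. Near minus infinity
\<open>K\<close> is close to \<open>- 1\<close>, so a positive excess would persist backwards in time and make \<open>\<rho>\<close> unbounded; later
it cannot become positive again.\<close>

lemma slope_le_barrier: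
  assumes m: "m = 1" and slope: "\<And>y. y \<le> x \<Longrightarrow> 0 \<le> p y"
    and x: "(1 + real n) * weight x \<le> 1" "\<rho> x \<le> 5 / 4 * pi"
  shows "p x \<le> sin (\<rho> x) + barrier ((1 + real n) * weight x) * (1 - cos (\<rho> x))"
proof -
  define Z where "Z y = (1 + real n) * weight y" for y
  define F where "F y = barrier (Z y)" for y
  define F' where "F' y = 2 * Z y * (1 - weight y) * (23 + 16 * Z y) / 50" for y
  define T where "T y = p y - sin (\<rho> y) - F y * (1 - cos (\<rho> y))" for y
  define K where "K y = damping m n y - cos (\<rho> y) - F y * sin (\<rho> y)" for y
  define T' where "T' y = damping m n y * p y + forcing m n y * (sin (\<rho> y) * cos (\<rho> y))
      - cos (\<rho> y) * p y - (F' y * (1 - cos (\<rho> y)) + F y * (sin (\<rho> y) * p y))" for y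
  have Z: "0 \<le> Z y" "Z y \<le> 1" if "y \<le> x" for y
  proof -
    show "0 \<le> Z y" using weight_bounds[of y] by (simp add: Z_def)
    have "Z y \<le> Z x" unfolding Z_def using weight_mono[OF that] by (intro mult_left_mono) auto
    then show "Z y \<le> 1" by (rule order_trans) (simp add: Z_def x(1))
  qed
  have F: "0 \<le> F y" "F y \<le> 1" if "y \<le> x" for y
    using barrier_bounds[OF Z[OF that]] by (auto simp: F_def)
  have \<rho>: "0 \<le> \<rho> y" "\<rho> y \<le> 5 / 4 * pi" if "y \<le> x" for y
    using monotone_from_0[OF slope] that x(2) order_trans by blast+
  have deriv_T: "(T has_real_derivative T' y) (at y)" for y
  proof -
    have "(F has_real_derivative F' y) (at y)"
      unfolding F_def[abs_def] F'_def Z_def by (rule DERIV_barrier_weight)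
    moreover have "((\<lambda>y. 1 - cos (\<rho> y)) has_real_derivative sin (\<rho> y) * p y) (at y)"
      by (auto intro!: derivative_eq_intros deriv_\<rho>)
    ultimately have "((\<lambda>y. F y * (1 - cos (\<rho> y))) has_real_derivative
        F' y * (1 - cos (\<rho> y)) + F y * (sin (\<rho> y) * p y)) (at y)"
      by (rule DERIV_cong[OF DERIV_mult]) simp
    from DERIV_diff[OF DERIV_diff[OF deriv_p deriv_sin] this]
    show ?thesis unfolding T_def[abs_def] T'_def .
  qed
  have T'_le: "T' y \<le> K y * T y" if "y \<le> x" for y
  proof -
    have D: "damping m n y = Z y - 2 * weight y" and a: "forcing m n y = 1 - Z y"
      by (simp_all add: damping_def forcing_def Z_def m algebra_simps)
    have "T' y = K y * T y + (K y * (sin (\<rho> y) + F y * (1 - cos (\<rho> y)))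
        + (1 - Z y) * (sin (\<rho> y) * cos (\<rho> y)) - F' y * (1 - cos (\<rho> y)))"
      unfolding T'_def T_def a by (simp add: K_def algebra_simps)
    moreover have "K y * (sin (\<rho> y) + F y * (1 - cos (\<rho> y)))
        + (1 - Z y) * (sin (\<rho> y) * cos (\<rho> y)) - F' y * (1 - cos (\<rho> y)) \<le> 0"
      unfolding K_def D F_def F'_def
      by (rule barrier_residual[where N = "1 + real n"])
         (use weight_bounds[of y] n_pos Z[OF that] \<rho>[OF that] in \<open>auto simp: Z_def\<close>)
    ultimately show ?thesis by linarith
  qed
  have K_le: "K y \<le> real n + 2" if "y \<le> x" for y
  proof -
    have "(real n - 1) * weight y \<le> (real n - 1) * 1"
      using n_pos weight_bounds[of y] by (intro mult_left_mono) auto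
    then have "damping m n y \<le> real n" by (simp add: damping_def m)
    moreover have "- (F y * sin (\<rho> y)) \<le> 1 * 1"
    proof -
      have "F y * (- sin (\<rho> y)) \<le> F y * 1" using F[OF that] sin_ge_minus_one[of "\<rho> y"]
        by (intro mult_left_mono) auto
      then show ?thesis using F[OF that] by simp
    qed
    moreover have "- 1 \<le> cos (\<rho> y)" by simp
    ultimately show ?thesis unfolding K_def by linarith
  qed
  obtain X where X: "X \<le> x" "\<And>y. y \<le> X \<Longrightarrow> K y \<le> 0" "\<And>y. y \<le> X \<Longrightarrow> \<rho> y \<le> pi"
  proof -
    have "(K \<longlongrightarrow> (real n - 1) * 0 - 0 * (1 - 0) - cos 0 - barrier ((1 + real n) * 0) * sin 0) at_bot"
      unfolding K_def[abs_def] damping_def m F_def Z_def barrier_def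
      by (intro tendsto_intros weight_tendsto_0 \<rho>_at_bot) auto
    then have "(K \<longlongrightarrow> - 1) at_bot" by (simp add: barrier_def)
    then have "eventually (\<lambda>y. K y < 0) at_bot" by (rule order_tendstoD(2)) simp
    moreover have "eventually (\<lambda>y. \<rho> y < pi) at_bot"
      using \<rho>_at_bot by (rule order_tendstoD(2)) simp
    ultimately have "eventually (\<lambda>y. K y < 0 \<and> \<rho> y < pi) at_bot" by eventually_elim simp
    then obtain c where "\<And>y. y \<le> c \<Longrightarrow> K y < 0 \<and> \<rho> y < pi"
      by (auto simp: eventually_at_bot_linorder)
    then show ?thesis using that[of "min c x"] by (auto intro: less_imp_le)
  qed
  have "T X \<le> 0"
  proof (rule ccontr)
    assume "\<not> T X \<le> 0"
    then have pos: "0 < T X" by simp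
    have "T X \<le> p y" if "y \<le> X" for y
    proof -
      have "T X \<le> T y"
      proof (rule positive_bounded_below_backwards[where f = T and f' = T', OF _ _ pos that])
        fix u assume "u \<le> X" "0 < T u"
        then have "K u * T u \<le> 0" using X(2) by (intro mult_nonpos_nonneg) auto
        then show "T' u \<le> 0" using T'_le[of u] X(1) \<open>u \<le> X\<close> by linarith
      qed (rule deriv_T)
      moreover have "0 \<le> sin (\<rho> y)"
        using \<rho>[of y] X that by (intro sin_ge_zero) auto
      moreover have "0 \<le> F y * (1 - cos (\<rho> y))"
        using F[of y] X that by (intro mult_nonneg_nonneg) auto
      ultimately show ?thesis by (simp add: T_def)
    qed
    moreover obtain y where "y \<le> X" "p y < T X"
      using derivative_not_bounded_below_at_bot[OF deriv_\<rho> \<rho>_at_bot pos] by blast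
    ultimately show False by force
  qed
  then have "T x \<le> 0"
  proof (rule nonpos_persists[where f = T and f' = T' and C = "real n + 2", OF X(1)])
    fix y assume y: "X \<le> y" "y \<le> x" and "0 < T y"
    then have "K y * T y \<le> (real n + 2) * T y" using K_le[OF y(2)] by (intro mult_right_mono) auto
    then show "T' y \<le> (real n + 2) * T y" using T'_le[OF y(2)] by linarith
  qed (rule deriv_T)
  then show ?thesis by (simp add: T_def F_def Z_def)
qed

text \<open>Between \<open>pi\<close> and \<open>5 * pi / 4\<close> the barrier gives \<open>\<phi>' \<le> - 2/3 * \<phi> + 2 * F\<close> for \<open>\<phi> = \<rho> - pi\<close>. As \<open>F' \<ge> F\<close>, the
function \<open>6/5 * F\<close> is a supersolution of this inequality, and it stays below \<open>pi / 4\<close>.\<close>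

lemma increasing_bound:
  assumes m: "m = 1" and slope: "\<And>y. y \<le> x \<Longrightarrow> 0 \<le> p y"
    and x: "(1 + real n) * weight x \<le> 1"
  shows "\<rho> x < 5 / 4 * pi"
proof (rule ccontr)
  assume "\<not> ?thesis"
  then have big: "5 / 4 * pi \<le> \<rho> x" by simp
  have "eventually (\<lambda>y. \<rho> y < pi) at_bot"
    using \<rho>_at_bot by (rule order_tendstoD(2)) simp
  then obtain c where c: "\<And>y. y \<le> c \<Longrightarrow> \<rho> y < pi"
    by (auto simp: eventually_at_bot_linorder)
  define u where "u = min c x"
  have u: "\<rho> u \<le> pi" "u \<le> x" using c[of u] by (auto simp: u_def)
  obtain x2 where x2: "u \<le> x2" "x2 \<le> x" "\<rho> x2 = 5 / 4 * pi"
  proof -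
    have "\<rho> u \<le> 5 / 4 * pi" using u(1) pi_gt_zero by linarith
    from IVT'[OF this big u(2) continuous_\<rho>] show ?thesis using that by blast
  qed
  obtain x1 where x1: "u \<le> x1" "x1 \<le> x2" "\<rho> x1 = pi"
  proof -
    have "pi \<le> \<rho> x2" using x2(3) pi_gt_zero by linarith
    from IVT'[OF u(1) this x2(1) continuous_\<rho>] show ?thesis using that by blast
  qed
  define Z where "Z y = (1 + real n) * weight y" for y
  define F where "F y = barrier (Z y)" for y
  define F' where "F' y = 2 * Z y * (1 - weight y) * (23 + 16 * Z y) / 50" for y
  have Z: "0 \<le> Z y" "Z y \<le> 1" "2 * weight y \<le> 1" if "y \<le> x" for y
  proof -
    show "0 \<le> Z y" using weight_bounds[of y] by (simp add: Z_def)
    have "Z y \<le> Z x" unfolding Z_def using weight_mono[OF that] by (intro mult_left_mono) auto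
    then show "Z y \<le> 1" by (rule order_trans) (simp add: Z_def x(1))
    moreover have "2 * weight y \<le> Z y"
      unfolding Z_def using n_pos weight_bounds[of y] by (intro mult_right_mono) auto
    ultimately show "2 * weight y \<le> 1" by linarith
  qed
  have "\<rho> x2 - pi - 6 / 5 * F x2 \<le> 0"
  proof (rule nonpos_persists[where f = "\<lambda>y. \<rho> y - pi - 6 / 5 * F y" and f' = "\<lambda>y. p y - 6 / 5 * F' y"
        and a = x1 and C = 0])
    show "\<rho> x1 - pi - 6 / 5 * F x1 \<le> 0"
      using barrier_bounds[OF Z(1,2)[of x1]] x1 x2 by (simp add: F_def)
  next
    fix y assume y: "x1 \<le> y" "y \<le> x2"
    have yx: "y \<le> x" using y x2 by simp
    have "(F has_real_derivative F' y) (at y)"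
      unfolding F_def[abs_def] F'_def Z_def by (rule DERIV_barrier_weight)
    then show "((\<lambda>y. \<rho> y - pi - 6 / 5 * F y) has_real_derivative p y - 6 / 5 * F' y) (at y)"
      by (auto intro!: derivative_eq_intros deriv_\<rho>)
    assume pos: "0 < \<rho> y - pi - 6 / 5 * F y"
    have mono: "\<rho> a \<le> \<rho> b" if "a \<le> b" "b \<le> x" for a b
      by (rule monotone_from_0(2)[OF slope that])
    have \<rho>: "pi \<le> \<rho> y" "\<rho> y \<le> 5 / 4 * pi"
      using mono[OF y(1) yx] mono[OF y(2) x2(2)] x1(3) x2(3) by simp_all
    have "p y \<le> sin (\<rho> y) + F y * (1 - cos (\<rho> y))"
      unfolding F_def Z_def
    proof (rule slope_le_barrier[OF m _ _ \<rho>(2)])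
      show "0 \<le> p z" if "z \<le> y" for z using slope that yx by simp
      show "(1 + real n) * weight y \<le> 1" using Z(2)[OF yx] by (simp add: Z_def)
    qed
    moreover have "F y * (1 - cos (\<rho> y)) \<le> F y * 2"
      using barrier_bounds(1)[OF Z(1,2)[OF yx]] cos_ge_minus_one[of "\<rho> y"]
      by (intro mult_left_mono) (auto simp: F_def)
    moreover have "2 / 3 * (\<rho> y - pi) \<le> sin (\<rho> y - pi)"
      using \<rho> by (intro sin_ge_two_thirds_mult) auto
    moreover have "sin (\<rho> y - pi) = - sin (\<rho> y)" by (simp add: sin_diff)
    moreover have "F y \<le> F' y"
    proof -
      have "1 * (Z y * (23 + 8 * Z y)) \<le> (2 * (1 - weight y)) * (Z y * (23 + 16 * Z y))"
        using Z[OF yx] by (intro mult_mono mult_left_mono mult_nonneg_nonneg) auto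
      also have "\<dots> = 2 * Z y * (1 - weight y) * (23 + 16 * Z y)" by simp
      finally show ?thesis by (simp add: F_def F'_def barrier_def)
    qed
    ultimately have "p y - 6 / 5 * F' y \<le> - (2 / 3 * (\<rho> y - pi)) + F y * 2 - 6 / 5 * F y"
      by linarith
    also have "\<dots> \<le> 0" using pos by (simp add: field_simps)
    finally show "p y - 6 / 5 * F' y \<le> 0 * (\<rho> y - pi - 6 / 5 * F y)"
      by simp
  qed (use x1 in auto)
  moreover have "F x2 \<le> 31 / 50"
    using barrier_bounds[OF Z(1,2)[of x2]] x2 by (simp add: F_def)
  ultimately show False using x2(3) pi_gt3 pi_approx by simp
qed

end

lemma (in pendulum) bound_first_half_eq_1:
  assumes m: "m = 1" and x: "(real m + real n) * weight x \<le> real m"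
  shows "\<bar>\<rho> x\<bar> < 5 / 4 * pi"
proof -
  have w: "(1 + real n) * weight y \<le> 1" if "y \<le> x" for y
  proof -
    have "(1 + real n) * weight y \<le> (1 + real n) * weight x"
      using weight_mono[OF that] by (intro mult_left_mono) auto
    then show ?thesis by (rule order_trans) (use x m in simp)
  qed
  interpret neg: pendulum m n "\<lambda>x. - \<rho> x" "\<lambda>x. - p x" by (rule uminus_solution)
  consider "\<forall>y\<le>x. 0 \<le> p y" | "\<forall>y\<le>x. p y \<le> 0"
    using slope_constant_sign[OF m] w by blast
  then show ?thesis
  proof cases
    case 1
    then show ?thesis
      using increasing_bound[OF m, of x] monotone_from_0(1)[of x x] w[of x] by simp
  next
    case 2
    then show ?thesis
      using neg.increasing_bound[OF m, of x] neg.monotone_from_0(1)[of x x] w[of x] by simp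
  qed
qed

lemma (in pendulum) bound_first_half:
  assumes "(real m + real n) * weight x \<le> real m"
  shows "\<bar>\<rho> x\<bar> < 5 / 4 * pi"
proof (cases "m = 1")
  case True
  then show ?thesis using bound_first_half_eq_1 assms by blast
next
  case False
  then have "\<bar>\<rho> x\<bar> < pi" using bound_first_half_ge_2[OF _ assms] m_pos by simp
  then show ?thesis using pi_gt_zero by linarith
qed

section \<open>The limit of a solution of the boundary value problem\<close>

lemma arctan_exp:
  defines "t \<equiv> \<lambda>x. arctan (exp x)"
  shows "t x \<in> {0<..<pi/2}" "(sin (t x))\<^sup>2 = weight x" "(cos (t x))\<^sup>2 = 1 - weight x"
    "0 < sin (t x)" "0 < cos (t x)"
    "(t has_real_derivative sin (t x) * cos (t x)) (at x)"
proof -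
  show t: "t x \<in> {0<..<pi/2}"
    unfolding t_def using arctan_ubound[of "exp x"] by simp
  show "0 < sin (t x)" using t by (intro sin_gt_zero) auto
  show c: "0 < cos (t x)" using t by (intro cos_gt_zero) auto
  have tan: "sin (t x) = exp x * cos (t x)"
    using tan_arctan[of "exp x"] c by (simp add: t_def tan_def field_simps)
  have c2: "(cos (t x))\<^sup>2 = 1 / (1 + (exp x)\<^sup>2)"
    unfolding t_def cos_arctan by (simp add: power_divide real_sqrt_pow2 add_nonneg_nonneg)
  have e2: "(exp x)\<^sup>2 = exp (2 * x)" by (simp add: exp_double)
  have nz: "1 + exp (2 * x) \<noteq> 0" using exp_gt_zero[of "2 * x"] by linarith
  show s2: "(sin (t x))\<^sup>2 = weight x"
    unfolding tan power_mult_distrib c2 e2 by (simp add: weight_def)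
  show "(cos (t x))\<^sup>2 = 1 - weight x"
    using s2 cos_squared_eq[of "t x"] by simp
  have "(t has_real_derivative inverse (1 + (exp x)\<^sup>2) * exp x) (at x)"
    unfolding t_def by (rule DERIV_chain2[OF DERIV_arctan DERIV_exp])
  moreover have "inverse (1 + (exp x)\<^sup>2) * exp x = sin (t x) * cos (t x)"
    unfolding tan using c2 by (simp add: power2_eq_square field_simps)
  ultimately show "(t has_real_derivative sin (t x) * cos (t x)) (at x)" by simp
qed

lemma arctan_exp_at_bot: "filterlim (\<lambda>x. arctan (exp x)) (at_right 0) at_bot"
proof (rule filterlim_at_withinI)
  have "((\<lambda>x. arctan (exp x)) \<longlongrightarrow> arctan 0) at_bot"
    by (intro tendsto_arctan exp_at_bot)
  then show "((\<lambda>x. arctan (exp x)) \<longlongrightarrow> 0) at_bot" by simp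
qed (auto intro!: always_eventually)

lemma arctan_exp_at_top: "filterlim (\<lambda>x. arctan (exp x)) (at_left (pi/2)) at_top"
proof (rule filterlim_at_withinI)
  show "((\<lambda>x. arctan (exp x)) \<longlongrightarrow> pi/2) at_top"
    by (rule filterlim_compose[OF tendsto_arctan_at_top exp_at_top])
  have "arctan (exp x) \<in> {..<pi/2} - {pi/2}" for x
    using arctan_ubound[of "exp x"] by simp
  then show "eventually (\<lambda>x. arctan (exp x) \<in> {..<pi/2} - {pi/2}) at_top"
    by simp
qed

lemma ODE_coefficient:
  fixes t y a b :: real
  assumes "0 < sin t" "0 < cos t"
  shows "((b - a) * (1 / sin (2 * t)) - (a + b) * cot (2 * t)) * (sin t * cos t)
       = (b - 1) * (sin t)\<^sup>2 - (a - 1) * (cos t)\<^sup>2 - ((cos t)\<^sup>2 - (sin t)\<^sup>2)"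
proof -
  have sc: "sin t * cos t = sin (2 * t) / 2" by (simp add: sin_double)
  then have "sin (2 * t) \<noteq> 0" using assms by (metis divide_eq_0_iff less_irrefl mult_pos_pos)
  then have "((b - a) * (1 / sin (2 * t)) - (a + b) * cot (2 * t)) * (sin t * cos t)
      = ((b - a) - (a + b) * cos (2 * t)) / 2"
    unfolding sc cot_def by (simp add: divide_simps)
  also have "\<dots> = ((b - a) * ((sin t)\<^sup>2 + (cos t)\<^sup>2) - (a + b) * ((cos t)\<^sup>2 - (sin t)\<^sup>2)) / 2"
    by (simp add: cos_double)
  also have "\<dots> = (b - 1) * (sin t)\<^sup>2 - (a - 1) * (cos t)\<^sup>2 - ((cos t)\<^sup>2 - (sin t)\<^sup>2)"
    by (simp add: cos_squared_eq field_simps)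
  finally show ?thesis .
qed

text \<open>With \<open>dt/dx = sin t * cos t\<close> the singular coefficients become polynomials in \<open>(sin t)\<^sup>2\<close>.\<close>

lemma ODE_in_log_coordinate:
  assumes "is_ODE_solution m0 m1 r"
  defines "\<rho> \<equiv> \<lambda>x. r (arctan (exp x))"
  obtains p where "\<And>x. (\<rho> has_real_derivative p x) (at x)"
    "\<And>x. (p has_real_derivative damping m0 m1 x * p x + forcing m0 m1 x * (sin (\<rho> x) * cos (\<rho> x))) (at x)"
proof -
  obtain r' r'' where r: "\<And>t. t \<in> {0<..<pi/2} \<Longrightarrow> (r has_real_derivative r' t) (at t)"
      "\<And>t. t \<in> {0<..<pi/2} \<Longrightarrow> (r' has_real_derivative r'' t) (at t)"
    and ode: "\<And>t. t \<in> {0<..<pi/2} \<Longrightarrow>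
      r'' t = ((real m1 - real m0) * (1 / sin (2 * t)) - (real m0 + real m1) * cot (2 * t)) * r' t
                - real m1 * (sin (2 * r t) / (2 * (cos t)\<^sup>2))
                + real m0 * (sin (2 * r t) / (2 * (sin t)\<^sup>2))"
    using assms(1) unfolding is_ODE_solution_def by metis
  define t where "t x = arctan (exp x)" for x :: real
  note t = arctan_exp[folded t_def]
  define p where "p x = r' (t x) * (sin (t x) * cos (t x))" for x
  have "(\<rho> has_real_derivative p x) (at x)" for x
    unfolding \<rho>_def t_def[symmetric] p_def by (rule DERIV_chain2[OF r(1)[OF t(1)] t(6)])
  moreover have "(p has_real_derivative damping m0 m1 x * p x + forcing m0 m1 x * (sin (\<rho> x) * cos (\<rho> x))) (at x)" for x
  proof -
    let ?s = "sin (t x)" and ?c = "cos (t x)"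
    have "((\<lambda>x. sin (t x) * cos (t x)) has_real_derivative (?c\<^sup>2 - ?s\<^sup>2) * (?s * ?c)) (at x)"
      by (auto intro!: derivative_eq_intros t(6) simp: power2_eq_square algebra_simps)
    from DERIV_mult[OF DERIV_chain2[OF r(2)[OF t(1)] t(6)] this]
    have d: "(p has_real_derivative r'' (t x) * (?s * ?c) * (?s * ?c) + (?c\<^sup>2 - ?s\<^sup>2) * (?s * ?c) * r' (t x)) (at x)"
      unfolding p_def[abs_def] .
    have sr: "sin (2 * r (t x)) = 2 * (sin (\<rho> x) * cos (\<rho> x))"
      by (simp add: \<rho>_def t_def sin_double)
    have "r'' (t x) * (?s * ?c) = (((real m1 - real m0) * (1 / sin (2 * t x)) - (real m0 + real m1) * cot (2 * t x)) * (?s * ?c)) * r' (t x)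
        + (real m0 * ?c / ?s - real m1 * ?s / ?c) * (sin (\<rho> x) * cos (\<rho> x))"
      unfolding ode[OF t(1)] sr using t(4,5)[of x] by (simp add: power2_eq_square field_simps)
    then have "r'' (t x) * (?s * ?c) * (?s * ?c)
        = (((real m1 - 1) * ?s\<^sup>2 - (real m0 - 1) * ?c\<^sup>2 - (?c\<^sup>2 - ?s\<^sup>2)) * r' (t x)
        + (real m0 * ?c / ?s - real m1 * ?s / ?c) * (sin (\<rho> x) * cos (\<rho> x))) * (?s * ?c)"
      by (simp only: ODE_coefficient[OF t(4,5)])
    also have "\<dots> = ((real m1 - 1) * ?s\<^sup>2 - (real m0 - 1) * ?c\<^sup>2 - (?c\<^sup>2 - ?s\<^sup>2)) * p x
        + (real m0 * ?c\<^sup>2 - real m1 * ?s\<^sup>2) * (sin (\<rho> x) * cos (\<rho> x))"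
      using t(4,5)[of x] by (simp add: p_def power2_eq_square field_simps)
    finally have "r'' (t x) * (?s * ?c) * (?s * ?c) + (?c\<^sup>2 - ?s\<^sup>2) * (?s * ?c) * r' (t x)
        = ((real m1 - 1) * ?s\<^sup>2 - (real m0 - 1) * ?c\<^sup>2) * p x
        + (real m0 * ?c\<^sup>2 - real m1 * ?s\<^sup>2) * (sin (\<rho> x) * cos (\<rho> x))"
      by (simp add: p_def algebra_simps)
    also have "\<dots> = damping m0 m1 x * p x + forcing m0 m1 x * (sin (\<rho> x) * cos (\<rho> x))"
      by (simp only: t(2,3) damping_def forcing_def)
    finally show ?thesis using d by simp
  qed
  ultimately show ?thesis by (rule that)
qed

text \<open>The bound for the first phase is applied to the solution and to its time reversal, at the time when the
force changes its sign.\<close>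

theorem BVP_solution_limit_bound:
  assumes "0 < m0" "0 < m1" and r: "is_BVP_solution m0 m1 r"
    and l: "(r \<longlongrightarrow> (2 * of_int l + 1) * (pi/2)) (at_left (pi/2))"
  shows "\<bar>2 * l + 1\<bar> \<le> 3"
proof -
  define \<rho> where "\<rho> x = r (arctan (exp x))" for x
  define L where "L = (2 * of_int l + 1) * (pi/2)"
  have "is_ODE_solution m0 m1 r" using r by (simp add: is_BVP_solution_def)
  then obtain p where p: "\<And>x. (\<rho> has_real_derivative p x) (at x)"
    "\<And>x. (p has_real_derivative damping m0 m1 x * p x + forcing m0 m1 x * (sin (\<rho> x) * cos (\<rho> x))) (at x)"
    using ODE_in_log_coordinate[of m0 m1 r] unfolding \<rho>_def[abs_def] by metis
  have bot: "(\<rho> \<longlongrightarrow> 0) at_bot"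
    using filterlim_compose[OF _ arctan_exp_at_bot, of r "nhds 0"] r
    by (simp add: is_BVP_solution_def \<rho>_def[abs_def])
  have top: "(\<rho> \<longlongrightarrow> L) at_top"
    using filterlim_compose[OF l arctan_exp_at_top] by (simp add: \<rho>_def[abs_def] L_def)
  interpret left: pendulum m0 m1 \<rho> p
    by unfold_locales (use assms p bot in auto)
  interpret right: pendulum m1 m0 "\<lambda>x. L - \<rho> (- x)" "\<lambda>x. p (- x)"
  proof unfold_locales
    fix x
    have minus: "(uminus has_real_derivative - 1) (at x)"
      by (rule DERIV_minus[OF DERIV_ident])
    have "((\<lambda>x. \<rho> (- x)) has_real_derivative p (- x) * - 1) (at x)"
      by (rule DERIV_chain2[OF p(1) minus])
    from DERIV_diff[OF DERIV_const this]
    show "((\<lambda>x. L - \<rho> (- x)) has_real_derivative p (- x)) (at x)" by simp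
    \<comment> \<open>As \<open>L\<close> is an odd multiple of \<open>pi/2\<close>, the term \<open>sin \<rho> * cos \<rho>\<close> is invariant under \<open>\<rho> \<mapsto> L - \<rho>\<close>.\<close>
    have cosL: "cos L = 0"
    proof -
      have "cos (of_int (2 * l + 1) * (pi/2)) = 0"
        unfolding cos_zero_iff_int by (intro exI[of _ "2 * l + 1"]) auto
      then show ?thesis by (simp add: L_def)
    qed
    then have "(sin L)\<^sup>2 = 1" using sin_squared_eq[of L] by simp
    then have sinL: "sin L * sin L = 1" by (simp add: power2_eq_square)
    have "sin (L - \<rho> (- x)) * cos (L - \<rho> (- x)) = (sin L * sin L) * (sin (\<rho> (- x)) * cos (\<rho> (- x)))"
      by (simp add: sin_diff cos_diff cosL)
    then have sc: "sin (L - \<rho> (- x)) * cos (L - \<rho> (- x)) = sin (\<rho> (- x)) * cos (\<rho> (- x))"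
      by (simp add: sinL)
    have reflect: "damping m0 m1 (- x) = - damping m1 m0 x" "forcing m0 m1 (- x) = - forcing m1 m0 x"
      by (simp_all add: damping_def forcing_def weight_minus algebra_simps)
    show "((\<lambda>x. p (- x)) has_real_derivative
        damping m1 m0 x * p (- x) + forcing m1 m0 x * (sin (L - \<rho> (- x)) * cos (L - \<rho> (- x)))) (at x)"
      by (rule DERIV_cong[OF DERIV_chain2[OF p(2) minus]]) (simp only: sc reflect, simp)
    have "((\<lambda>x. \<rho> (- x)) \<longlongrightarrow> L) at_bot"
      using filterlim_compose[OF top filterlim_uminus_at_top_at_bot] .
    then have "((\<lambda>x. L - \<rho> (- x)) \<longlongrightarrow> L - L) at_bot"
      by (intro tendsto_intros)
    then show "((\<lambda>x. L - \<rho> (- x)) \<longlongrightarrow> 0) at_bot" by simp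
  qed (use assms in auto)
  obtain x where "weight x = real m0 / (real m0 + real m1)"
    using weight_surj[of "real m0 / (real m0 + real m1)"] assms(1,2) by auto
  then have w: "(real m0 + real m1) * weight x = real m0"
    using assms(1) by simp
  have "(real m1 + real m0) * weight (- x) = (real m0 + real m1) - (real m0 + real m1) * weight x"
    by (simp add: weight_minus algebra_simps)
  then have w': "(real m1 + real m0) * weight (- x) = real m1"
    using w by simp
  have "\<bar>\<rho> x\<bar> < 5 / 4 * pi"
    by (rule left.bound_first_half) (simp add: w)
  moreover have "\<bar>L - \<rho> x\<bar> < 5 / 4 * pi"
    using right.bound_first_half[of "- x"] w' by simp
  ultimately have "\<bar>L\<bar> < 5 * (pi / 2)" by linarith
  then have "\<bar>2 * real_of_int l + 1\<bar> * (pi / 2) < 5 * (pi / 2)"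
    by (simp add: L_def abs_mult)
  then have "\<bar>2 * real_of_int l + 1\<bar> < 5"
    by (rule mult_right_less_imp_less) simp
  then have "\<bar>2 * l + 1\<bar> < 5" by linarith
  then show ?thesis by presburger
qed

theorem theoremE:
  fixes m0 m1 :: nat and r :: "real \<Rightarrow> real"
  assumes "m0 > 0" and "m1 > 0"
    and "is_BVP_solution m0 m1 r"
  shows "Brouwer_degree2 (m0 + m1 + 1) (psi m0 m1 r) \<in> {1, -1, 3, -3}"
proof -
  obtain l :: int where l: "(r \<longlongrightarrow> (2 * of_int l + 1) * (pi/2)) (at_left (pi/2))"
    using assms(3) by (auto simp: is_BVP_solution_def)
  show ?thesis
    by (rule Brouwer_degree2_psi[OF assms(3) l BVP_solution_limit_bound[OF assms l]])
qed

end
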